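(* The quantum algebra $U_q(\mathfrak g_{\bar 0})$ has no zero divisors.
   Context: Let $m,n\ge1$, $\mathbb F$ a field of characteristic $0$, $q$ an indeterminate over $\mathbb F$, $q_i=q$ for $i\le m$ and $q_i=q^{-1}$ for $i>m$. Here $\mathfrak g=\mathfrak{gl}(m,n)$ and $\mathfrak g_{\bar 0}=\mathfrak{gl}_m\oplus\mathfrak{gl}_n$. $U_q(\mathfrak g_{\bar 0})$ is the associative unital $\mathbb F(q)$-algebra with generators $E_{i,i+1},F_{i,i+1}$ ($1\le i<m+n$, $i\ne m$), $K_j^{\pm1}$ ($1\le j\le m+n$) and relations (for all admissible indices $i,j$) (R1) $K_iK_j=K_jK_i$, $K_iK_i^{-1}=K_i^{-1}K_i=1$; (R2) $K_iE_{j,j+1}K_i^{-1}=q_i^{\delta_{ij}-\delta_{i,j+1}}E_{j,j+1}$, $K_iF_{j,j+1}K_i^{-1}=q_i^{-(\delta_{ij}-\delta_{i,j+1})}F_{j,j+1}$; (R3) $E_{i,i+1}F_{j,j+1}-F_{j,j+1}E_{i,i+1}=\delta_{ij}\dfrac{K_iK_{i+1}^{-1}-K_i^{-1}K_{i+1}}{q_i-q_i^{-1}}$; (R5) $E_{i,i+1}E_{j,j+1}=E_{j,j+1}E_{i,i+1}$ and $F_{i,i+1}F_{j,j+1}=F_{j,j+1}F_{i,i+1}$ if $|i-j|>1$; (R6) $E_{i,i+1}^2E_{j,j+1}-(q+q^{-1})E_{i,i+1}E_{j,j+1}E_{i,i+1}+E_{j,j+1}E_{i,i+1}^2=0$ if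 $|i-j|=1$; (R7) the same relation as (R6) with $F$ in place of $E$. *)

theory Defs
  imports
    "HOL-Library.Poly_Mapping"
    "HOL-Computational_Algebra.Polynomial"
    "HOL-Computational_Algebra.Fraction_Field"
    "HOL-Algebra.QuotRing"
begin

text \<open>The free monoid: words under concatenation.  With this instance, finitely supported functions
  on words carry the convolution product, i.e. the multiplication of the free associative algebra.\<close>

instantiation list :: (type) monoid_add
begin

definition zero_list :: "'a list" where "zero_list = []"

definition plus_list :: "'a list \<Rightarrow> 'a list \<Rightarrow> 'a list" where "plus_list xs ys = xs @ ys"

instance by standard (simp_all add: zero_list_def plus_list_def)

end

text \<open>\<open>GE i\<close> and \<open>GF i\<close> stand for $E_{i,i+1}$ and $F_{i,i+1}$; \<open>GKinv j\<close> is the letter for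
  $K_j^{-1}$, which becomes the inverse of $K_j$ only through the relations.\<close>

datatype gen = GE nat | GF nat | GK nat | GKinv nat

text \<open>\<open>'f ratfun\<close> is the field of rational functions $\mathbb F(q)$.\<close>

type_synonym 'f ratfun = "'f poly fract"

type_synonym 'f falg = "gen list \<Rightarrow>\<^sub>0 'f ratfun"

definition qvar :: "'f::field ratfun" where
  "qvar = Fraction_Field.Fract [:0, 1:] 1"

definition qi :: "nat \<Rightarrow> nat \<Rightarrow> 'f::field ratfun" where
  "qi m i = (if i \<le> m then qvar else inverse qvar)"

definition E_idx :: "nat \<Rightarrow> nat \<Rightarrow> nat set" where
  "E_idx m n = {i. 1 \<le> i \<and> i < m + n \<and> i \<noteq> m}"

definition K_idx :: "nat \<Rightarrow> nat \<Rightarrow> nat set" where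
  "K_idx m n = {1..m + n}"

definition gens :: "nat \<Rightarrow> nat \<Rightarrow> gen set" where
  "gens m n = GE ` E_idx m n \<union> GF ` E_idx m n \<union> GK ` K_idx m n \<union> GKinv ` K_idx m n"

definition scal :: "'f::field ratfun \<Rightarrow> 'f falg" where
  "scal c = Poly_Mapping.single [] c"

definition letter :: "gen \<Rightarrow> 'f::field falg" where
  "letter g = Poly_Mapping.single [g] 1"

abbreviation "EE i \<equiv> letter (GE i)"
abbreviation "FF i \<equiv> letter (GF i)"
abbreviation "KK i \<equiv> letter (GK i)"
abbreviation "KKinv i \<equiv> letter (GKinv i)"

text \<open>The free unital associative $\mathbb F(q)$-algebra on the generators with admissible index.\<close>

definition free_alg :: "nat \<Rightarrow> nat \<Rightarrow> 'f::field falg ring" where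
  "free_alg m n = \<lparr>carrier = {x. Poly_Mapping.keys x \<subseteq> lists (gens m n)},
     mult = (*), one = 1, zero = 0, add = (+)\<rparr>"

text \<open>\<open>Uq_rel m n x y\<close>: the equation \<open>x = y\<close> is one of the defining relations.\<close>

inductive Uq_rel :: "nat \<Rightarrow> nat \<Rightarrow> 'f::field falg \<Rightarrow> 'f falg \<Rightarrow> bool" for m n where
  R1_comm: "\<lbrakk>i \<in> K_idx m n; j \<in> K_idx m n\<rbrakk> \<Longrightarrow> Uq_rel m n (KK i * KK j) (KK j * KK i)"
| R1_rinv: "i \<in> K_idx m n \<Longrightarrow> Uq_rel m n (KK i * KKinv i) 1"
| R1_linv: "i \<in> K_idx m n \<Longrightarrow> Uq_rel m n (KKinv i * KK i) 1"
| R2_E: "\<lbrakk>i \<in> K_idx m n; j \<in> E_idx m n\<rbrakk> \<Longrightarrow>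
    Uq_rel m n (KK i * EE j * KKinv i)
      (scal (qi m i powi (of_bool (i = j) - of_bool (i = j + 1))) * EE j)"
| R2_F: "\<lbrakk>i \<in> K_idx m n; j \<in> E_idx m n\<rbrakk> \<Longrightarrow>
    Uq_rel m n (KK i * FF j * KKinv i)
      (scal (qi m i powi (- (of_bool (i = j) - of_bool (i = j + 1)))) * FF j)"
| R3: "\<lbrakk>i \<in> E_idx m n; j \<in> E_idx m n\<rbrakk> \<Longrightarrow>
    Uq_rel m n (EE i * FF j - FF j * EE i)
      (scal (of_bool (i = j) / (qi m i - inverse (qi m i))) *
        (KK i * KKinv (i + 1) - KKinv i * KK (i + 1)))"
| R5_E: "\<lbrakk>i \<in> E_idx m n; j \<in> E_idx m n; \<bar>int i - int j\<bar> > 1\<rbrakk> \<Longrightarrow> Uq_rel m n (EE i * EE j) (EE j * EE i)"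
| R5_F: "\<lbrakk>i \<in> E_idx m n; j \<in> E_idx m n; \<bar>int i - int j\<bar> > 1\<rbrakk> \<Longrightarrow> Uq_rel m n (FF i * FF j) (FF j * FF i)"
| R6: "\<lbrakk>i \<in> E_idx m n; j \<in> E_idx m n; \<bar>int i - int j\<bar> = 1\<rbrakk> \<Longrightarrow>
    Uq_rel m n (EE i ^ 2 * EE j - scal (qvar + inverse qvar) * (EE i * EE j * EE i) + EE j * EE i ^ 2) 0"
| R7: "\<lbrakk>i \<in> E_idx m n; j \<in> E_idx m n; \<bar>int i - int j\<bar> = 1\<rbrakk> \<Longrightarrow>
    Uq_rel m n (FF i ^ 2 * FF j - scal (qvar + inverse qvar) * (FF i * FF j * FF i) + FF j * FF i ^ 2) 0"

definition Uq_ideal :: "nat \<Rightarrow> nat \<Rightarrow> 'f::field falg set" where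
  "Uq_ideal m n = Idl\<^bsub>free_alg m n\<^esub> {x - y | x y. Uq_rel m n x y}"

text \<open>The ideal is two-sided and the constants lie in the free algebra, so the ideal is also an
  $\mathbb F(q)$-subspace and the quotient ring is the $\mathbb F(q)$-algebra with this presentation.\<close>

definition Uq_even :: "nat \<Rightarrow> nat \<Rightarrow> 'f::field falg set ring" where
  "Uq_even m n = free_alg m n Quot Uq_ideal m n"

lemma free_alg_simps [simp]:
  "x \<in> carrier (free_alg m n) \<longleftrightarrow> Poly_Mapping.keys x \<subseteq> lists (gens m n)"
  "mult (free_alg m n) = (*)" "one (free_alg m n) = 1"
  "zero (free_alg m n) = 0" "add (free_alg m n) = (+)"
  by (simp_all add: free_alg_def)

lemma keys_mult_lists:
  fixes x y :: "'f::field falg"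
  assumes "Poly_Mapping.keys x \<subseteq> lists A" "Poly_Mapping.keys y \<subseteq> lists A"
  shows "Poly_Mapping.keys (x * y) \<subseteq> lists A"
proof
  fix w assume "w \<in> Poly_Mapping.keys (x * y)"
  then obtain u v where "w = u + v" "u \<in> Poly_Mapping.keys x" "v \<in> Poly_Mapping.keys y"
    using keys_mult[of x y] by auto
  then show "w \<in> lists A"
    using assms by (auto simp: plus_list_def)
qed

lemma ring_free_alg: "ring (free_alg m n :: 'f::field falg ring)"
proof (rule ringI)
  show "abelian_group (free_alg m n :: 'f falg ring)"
  proof (rule abelian_groupI)
    fix x :: "'f falg" assume "x \<in> carrier (free_alg m n)"
    then show "\<exists>y\<in>carrier (free_alg m n). y \<oplus>\<^bsub>free_alg m n\<^esub> x = \<zero>\<^bsub>free_alg m n\<^esub>"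
      by (intro bexI[of _ "- x"]) (auto simp: keys_minus)
  qed (use Poly_Mapping.keys_add in \<open>fastforce simp: add_ac\<close>)+
  show "Group.monoid (free_alg m n :: 'f falg ring)"
  proof (rule monoidI)
    show "\<one>\<^bsub>free_alg m n\<^esub> \<in> carrier (free_alg m n :: 'f falg ring)"
      by (simp add: zero_list_def)
  qed (auto simp: mult.assoc dest: keys_mult_lists[THEN subsetD])
qed (auto simp: algebra_simps)

lemma keys_diff_lists:
  fixes x y :: "'f::field falg"
  assumes "Poly_Mapping.keys x \<subseteq> lists A" "Poly_Mapping.keys y \<subseteq> lists A"
  shows "Poly_Mapping.keys (x - y) \<subseteq> lists A"
  using keys_diff[of x y] assms by blast

lemma keys_add_lists:
  fixes x y :: "'f::field falg"
  assumes "Poly_Mapping.keys x \<subseteq> lists A" "Poly_Mapping.keys y \<subseteq> lists A"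
  shows "Poly_Mapping.keys (x + y) \<subseteq> lists A"
  using Poly_Mapping.keys_add[of x y] assms by blast

lemma keys_scal_lists: "Poly_Mapping.keys (scal c :: 'f::field falg) \<subseteq> lists A"
  by (auto simp: scal_def)

lemma keys_letter_lists: "g \<in> A \<Longrightarrow> Poly_Mapping.keys (letter g :: 'f::field falg) \<subseteq> lists A"
  by (auto simp: letter_def)

lemma keys_one_lists: "Poly_Mapping.keys (1 :: 'f::field falg) \<subseteq> lists A"
  by (simp add: zero_list_def)

lemma Uq_rel_carrier:
  fixes x y :: "'f::field falg"
  assumes "Uq_rel m n x y"
  shows "x \<in> carrier (free_alg m n)" "y \<in> carrier (free_alg m n)"
proof -
  have E: "GE i \<in> gens m n" "GF i \<in> gens m n" if "i \<in> E_idx m n" for i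
    using that by (auto simp: gens_def)
  have K: "GK i \<in> gens m n" "GKinv i \<in> gens m n" if "i \<in> K_idx m n" for i
    using that by (auto simp: gens_def)
  have EK: "i \<in> K_idx m n" "i + 1 \<in> K_idx m n" if "i \<in> E_idx m n" for i
    using that by (auto simp: E_idx_def K_idx_def)
  note closed = keys_mult_lists keys_diff_lists keys_add_lists keys_scal_lists keys_letter_lists
    keys_one_lists
  have "x \<in> carrier (free_alg m n) \<and> y \<in> carrier (free_alg m n)"
    using assms
    by (induction rule: Uq_rel.induct; unfold free_alg_simps power2_eq_square;
        intro conjI closed E K; (assumption | simp add: EK[simplified]))
  then show "x \<in> carrier (free_alg m n)" "y \<in> carrier (free_alg m n)"
    by auto
qed

lemma ideal_Uq_ideal: "ideal (Uq_ideal m n) (free_alg m n :: 'f::field falg ring)"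
proof -
  have "{x - y |x y. Uq_rel m n x y} \<subseteq> carrier (free_alg m n :: 'f falg ring)"
  proof
    fix z :: "'f falg" assume "z \<in> {x - y |x y. Uq_rel m n x y}"
    then obtain x y where z: "z = x - y" and r: "Uq_rel m n x y" by blast
    show "z \<in> carrier (free_alg m n)"
      using Uq_rel_carrier[OF r] unfolding z free_alg_simps by (rule keys_diff_lists)
  qed
  then show ?thesis
    unfolding Uq_ideal_def by (rule ring.genideal_ideal[OF ring_free_alg])
qed

lemma ring_Uq_even: "ring (Uq_even m n :: 'f::field falg set ring)"
  unfolding Uq_even_def by (rule ideal.quotient_is_ring[OF ideal_Uq_ideal])

end

theory Submission
  imports Defs "HOL-Library.Product_Lexorder" "HOL-Library.Product_Plus"
begin

text \<open>Straightening with the Serre relations shows that the algebra is spanned by ordered monomials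
  \<open>F\<^sup>f K\<^sup>\<mu> E\<^sup>e\<close> in root vectors.  A homomorphism into matrices over a vector space with a lexicographically ordered
  basis sends different monomials to matrices with different leading exponents.  Hence it is injective,
  and since leading exponents add up under multiplication, no product of nonzero elements vanishes.

  The homomorphism is an iterated coproduct followed by \<open>q\<close>-oscillator representations.  If the relations
  with \<open>[E\<^sub>i, F\<^sub>i] = a\<^sub>i K - b\<^sub>i K\<^sup>-\<^sup>1\<close>, where \<open>K = K\<^sub>i K\<^sub>i\<^sub>+\<^sub>1\<^sup>-\<^sup>1\<close>, are said to have type \<open>(a, b)\<close>, then the coproduct
  of types \<open>(c, b)\<close> and \<open>(a, c)\<close> has type \<open>(a, b)\<close>, so that oscillators of simpler types can be
  chained.  In type \<open>(0, 0)\<close> the \<open>E\<^sub>i\<close> commute with the \<open>F\<^sub>j\<close>, and sums of \<open>q\<close>-commuting copies, as in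
  the homomorphisms of Feigin, produce the leading exponents.\<close>

section \<open>Root vectors and Serre relations\<close>

text \<open>The even part is handled as quantum \<open>gl\<close> of rank m + n with node m removed:
  on the algebra side the generators at m are zero, while the matrices represent every node, so the
  study of leading exponents never sees the gap. The obstacle is that one oscillator copy of type
  \<open>(0, 0)\<close> is too small: its E's q-commute, so all longer root vectors vanish. In a sum
  of q-commuting copies, the root vector of an interval acquires a mixed product that uses a
  different copy for each node, with a nonzero factor that is a power of 1 - q^2. This diagonal
  choice of copies records where the interval starts, and counting the intervals with a given start
  that reach a given node recovers all exponents. The copies sit where the type is
  \<open>(0, 0)\<close>, because there each of them may drop its E or its F half and the two kinds
  of exponents occupy separate coordinates. The K's of oscillators are diagonal and leave no
  exponent, so one extra factor lets them shift coordinates of their own. The oscillators at both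
  ends restore the true commutator of E and F and stay away from the coordinates that rank root
  vectors.\<close>

locale qalg = vector_space scale
  for scale :: "'k::field \<Rightarrow> 'r::ring_1 \<Rightarrow> 'r" (infixr "*s" 75) +
  fixes q :: 'k
  assumes scale_mult_left: "(c *s x) * y = c *s (x * y)"
    and scale_mult_right: "x * (c *s y) = c *s (x * y)"
    and q_nz: "q \<noteq> 0" and q2_neq_1: "q * q \<noteq> 1" and q2_neq_m1: "1 + q * q \<noteq> 0"
begin

lemmas scale_assoc = scale_mult_left scale_mult_right scale_scale
lemmas scale_distrib = scale_left_distrib scale_right_distrib scale_left_diff_distrib
  scale_right_diff_distrib

lemma qcomm_assoc:
  assumes "x * y = c *s (y * x)"
  shows "x * (y * z) = c *s (y * (x * z))"
  by (metis assms mult.assoc scale_mult_left)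

lemma q_cancel: "q * (inverse q * c) = c" "inverse q * (q * c) = c"
  by (simp_all add: q_nz flip: mult.assoc)

definition serre :: "'r \<Rightarrow> 'r \<Rightarrow> 'r" where
  "serre x y = x * x * y - (q + inverse q) *s (x * y * x) + y * x * x"

text \<open>Expand by degree in the four letters: the pure parts vanish by assumption. In each of
  the four mixed parts the q-commutation rules bring all terms to a common order, where the
  coefficients cancel; for \<open>a\<close>, \<open>a\<close>, \<open>b'\<close> this is q^2 - (q +
  1/q) q + 1 = 0.\<close>

lemma serre_add:
  assumes "serre a a' = 0" "serre b b' = 0"
    and ab: "a * b = (inverse q * inverse q) *s (b * a)"
    and ab': "a * b' = q *s (b' * a)"
    and a'b: "a' * b = q *s (b * a')"
    and a'b': "a' * b' = (inverse q * inverse q) *s (b' * a')"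
  shows "serre (a + b) (a' + b') = 0"
proof -
  note r = ab ab' a'b a'b' ab[THEN qcomm_assoc] ab'[THEN qcomm_assoc] a'b[THEN qcomm_assoc]
    a'b'[THEN qcomm_assoc]
  have 1: "a * a * b' - (q + inverse q) *s (a * b' * a) + b' * a * a = 0"
    by (simp add: r mult.assoc scale_assoc scale_distrib q_nz)
      (simp add: scale_distrib[symmetric] algebra_simps q_nz)
  have 2: "b * b * a' - (q + inverse q) *s (b * a' * b) + a' * b * b = 0"
    by (simp add: r mult.assoc scale_assoc scale_distrib q_nz)
      (simp add: scale_distrib[symmetric] algebra_simps q_nz)
  have 3: "(a * b + b * a) * a' - (q + inverse q) *s (a * a' * b + b * a' * a) + a' * (a * b + b * a) = 0"
    by (simp add: r mult.assoc scale_assoc scale_distrib q_nz q_cancel distrib_left distrib_right)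
  have 4: "(a * b + b * a) * b' - (q + inverse q) *s (a * b' * b + b * b' * a) + b' * (a * b + b * a) = 0"
    by (simp add: r mult.assoc scale_assoc scale_distrib q_nz q_cancel distrib_left distrib_right)
  have "serre (a + b) (a' + b') = serre a a' + serre b b'
    + (a * a * b' - (q + inverse q) *s (a * b' * a) + b' * a * a)
    + (b * b * a' - (q + inverse q) *s (b * a' * b) + a' * b * b)
    + ((a * b + b * a) * a' - (q + inverse q) *s (a * a' * b + b * a' * a) + a' * (a * b + b * a))
    + ((a * b + b * a) * b' - (q + inverse q) *s (a * b' * b + b * b' * a) + b' * (a * b + b * a))"
    unfolding serre_def by (simp add: algebra_simps)
  then show ?thesis
    using assms(1,2) 1 2 3 4 by simp
qed

text \<open>The quantum root vector of type A for the sum of the simple roots i, ..., i + k, as an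
  iterated q-commutator. Thus \<open>k\<close> is one less than the number of nodes.\<close>

primrec root_vec :: "(nat \<Rightarrow> 'r) \<Rightarrow> nat \<Rightarrow> nat \<Rightarrow> 'r" where
  "root_vec x i 0 = x i"
| "root_vec x i (Suc k) = x i * root_vec x (Suc i) k - q *s (root_vec x (Suc i) k * x i)"

lemma root_vec_commute:
  assumes "\<And>j. i \<le> j \<Longrightarrow> j \<le> i + k \<Longrightarrow> z * x j = x j * z"
  shows "z * root_vec x i k = root_vec x i k * z"
  using assms
proof (induction k arbitrary: i)
  case (Suc k)
  have 1: "z * root_vec x (Suc i) k = root_vec x (Suc i) k * z"
    by (rule Suc.IH) (use Suc.prems in auto)
  have 2: "z * x i = x i * z" using Suc.prems[of i] by simp
  have "z * (x i * y) = x i * (z * y)" for y by (metis 2 mult.assoc)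
  moreover have "z * (root_vec x (Suc i) k * y) = root_vec x (Suc i) k * (z * y)" for y by (metis 1 mult.assoc)
  ultimately show ?case using 1 2
    by (simp add: algebra_simps scale_assoc)
qed simp

lemma root_vec_qcomm:
  assumes "z * x i = c *s (x i * z)" and "\<And>j. i < j \<Longrightarrow> j \<le> i + k \<Longrightarrow> z * x j = x j * z"
  shows "z * root_vec x i k = c *s (root_vec x i k * z)"
proof (cases k)
  case (Suc k')
  have 1: "z * root_vec x (Suc i) k' = root_vec x (Suc i) k' * z"
    by (rule root_vec_commute) (use assms Suc in auto)
  have 3: "z * (root_vec x (Suc i) k' * y) = root_vec x (Suc i) k' * (z * y)" for y by (metis 1 mult.assoc)
  show ?thesis using qcomm_assoc[OF assms(1)] 1 assms(1) 3
    by (simp add: Suc algebra_simps scale_assoc)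
qed (simp add: assms)

lemma root_vec_eq_0: "x j = 0 \<Longrightarrow> i \<le> j \<Longrightarrow> j \<le> i + k \<Longrightarrow> root_vec x i k = 0"
proof (induction k arbitrary: i)
  case (Suc k)
  show ?case
  proof (cases "i = j")
    case False
    then have "root_vec x (Suc i) k = 0" using Suc by auto
    then show ?thesis by simp
  qed (use Suc.prems in simp)
qed simp

text \<open>The coproduct multiplies one summand by torus elements of the other tensor factor. These
  are the \<open>g\<close> here; they contribute only an outer torus factor to the root
  vector.\<close>

lemma root_vec_twist:
  assumes "\<And>j l. g j * g l = g l * g j" and "\<And>j l. g j * x l = x l * g j"
  shows "root_vec (\<lambda>j. g j * x j) i k = prod_list (map g [i..<Suc (i + k)]) * root_vec x i k"
proof (induction k arbitrary: i)
  case (Suc k)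
  define G where "G = prod_list (map g [Suc i..<Suc (Suc (i + k))])"
  have comm: "z * prod_list (map g js) = prod_list (map g js) * z" if "\<And>j. z * g j = g j * z" for z js
    by (induction js) (simp, metis (no_types, lifting) list.simps(9) mult.assoc prod_list.Cons that)
  have G1: "x i * G = G * x i" unfolding G_def by (rule comm) (simp add: assms)
  have G2: "g i * G = G * g i" unfolding G_def by (rule comm) (simp add: assms)
  have G3: "g i * root_vec x (Suc i) k = root_vec x (Suc i) k * g i" by (rule root_vec_commute) (simp add: assms)
  have up: "[i..<Suc (i + Suc k)] = i # [Suc i..<Suc (Suc (i + k))]"
    by (simp add: upt_rec)
  have GP: "prod_list (map g [i..<Suc (i + Suc k)]) = g i * G"
    unfolding up G_def by simp
  have E: "root_vec (\<lambda>j. g j * x j) (Suc i) k = G * root_vec x (Suc i) k"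
    using Suc.IH[of "Suc i"] by (simp add: G_def)
  have "g i * x i * (G * root_vec x (Suc i) k) = g i * G * (x i * root_vec x (Suc i) k)"
    by (metis G1 mult.assoc)
  moreover have "G * root_vec x (Suc i) k * (g i * x i) = g i * G * (root_vec x (Suc i) k * x i)"
    by (metis G2 G3 mult.assoc)
  ultimately show ?case
    unfolding root_vec.simps GP E by (simp add: algebra_simps scale_assoc)
qed simp

end

definition cartan :: "nat \<Rightarrow> nat \<Rightarrow> int" where
  "cartan i j = (if i = j then 2 else if i = Suc j \<or> j = Suc i then -1 else 0)"

context qalg
begin

text \<open>This is the coproduct of a root vector in the guise of a sum of two families that
  commute up to powers of \<open>q\<close>.\<close>

lemma root_vec_add:
  assumes AB: "\<And>i j. A i * B j = (q powi (- cartan i j)) *s (B j * A i)"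
    and AA: "\<And>i j. Suc i < j \<Longrightarrow> A i * A j = A j * A i"
  shows "root_vec (\<lambda>i. A i + B i) i k = root_vec A i k + root_vec B i k
    + (1 - q * q) *s (\<Sum>l<k. root_vec B i l * root_vec A (Suc (i + l)) (k - Suc l))"
proof (induction k arbitrary: i)
  case (Suc k)
  let ?i = "Suc i"
  define S where "S = (\<Sum>l<k. root_vec B ?i l * root_vec A (Suc (?i + l)) (k - Suc l))"
  have AB0: "A i * root_vec B ?i l = q *s (root_vec B ?i l * A i)" for l
    by (rule root_vec_qcomm) (auto simp: AB cartan_def)
  have AA0: "A i * root_vec A (Suc (?i + l)) k' = root_vec A (Suc (?i + l)) k' * A i" for l k'
    by (rule root_vec_commute) (auto simp: AA)
  have BA0: "B i * root_vec A (Suc (?i + l)) k' = root_vec A (Suc (?i + l)) k' * B i" for l k'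
    by (rule root_vec_commute) (auto simp: AB cartan_def)
  have "B i * A (Suc i) = inverse q *s (A (Suc i) * B i)"
    by (simp add: AB cartan_def q_nz)
  then have BA1: "B i * root_vec A ?i k = inverse q *s (root_vec A ?i k * B i)"
    by (rule root_vec_qcomm) (auto simp: AB cartan_def)
  then have BA1: "root_vec A ?i k * B i = q *s (B i * root_vec A ?i k)" by (simp add: q_nz)
  have AS: "A i * S = q *s (S * A i)"
  proof -
    have "A i * (root_vec B ?i l * root_vec A (Suc (?i + l)) (k - Suc l))
        = q *s (root_vec B ?i l * root_vec A (Suc (?i + l)) (k - Suc l) * A i)" for l
      by (metis AA0 qcomm_assoc[OF AB0] mult.assoc scale_mult_left)
    then show ?thesis
      by (simp add: S_def sum_distrib_left sum_distrib_right scale_sum_right)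
  qed
  \<comment> \<open>Bracketing with \<open>B i\<close> lengthens the \<open>B\<close> root vector by
    one node on the left, because \<open>B i\<close> commutes with the \<open>A\<close>
    factor.\<close>
  have BS: "B i * S - q *s (S * B i)
      = (\<Sum>l<k. root_vec B i (Suc l) * root_vec A (Suc (?i + l)) (k - Suc l))"
  proof -
    have "B i * (root_vec B ?i l * root_vec A (Suc (?i + l)) (k - Suc l))
        - q *s (root_vec B ?i l * root_vec A (Suc (?i + l)) (k - Suc l) * B i)
        = root_vec B i (Suc l) * root_vec A (Suc (?i + l)) (k - Suc l)" for l
      by (simp add: left_diff_distrib scale_mult_left mult.assoc BA0[simplified, symmetric])
    then show ?thesis
      by (simp add: S_def sum_distrib_left sum_distrib_right scale_sum_right
          flip: sum_subtractf)
  qed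
  \<comment> \<open>The term l = 0 is new: the bracket of \<open>B i\<close> with the
    \<open>A\<close> root vector is 1 - q * q times their product. Brackets with \<open>A i\<close>
    kill both the \<open>B\<close> root vector and the sum \<open>S\<close>.\<close>
  have S': "(\<Sum>l<Suc k. root_vec B i l * root_vec A (Suc (i + l)) (Suc k - Suc l))
     = B i * root_vec A ?i k + (B i * S - q *s (S * B i))"
    by (subst sum.lessThan_Suc_shift) (simp add: BS)
  have "root_vec (\<lambda>i. A i + B i) i (Suc k)
    = (A i + B i) * (root_vec A ?i k + root_vec B ?i k + (1 - q * q) *s S)
     - q *s ((root_vec A ?i k + root_vec B ?i k + (1 - q * q) *s S) * (A i + B i))"
    by (simp add: Suc.IH S_def)
  also have "\<dots> = root_vec A i (Suc k) + root_vec B i (Suc k)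
     + (1 - q * q) *s (B i * root_vec A ?i k + (B i * S - q *s (S * B i)))"
    by (simp add: algebra_simps scale_assoc AB0 AS BA1)
  finally show ?case unfolding S' .
qed simp

text \<open>Neighbours that q-commute with the very \<open>q\<close> of the bracket make each
  bracket vanish. So a single copy has no longer root vectors, and in a sum only mixed terms can
  produce them.\<close>

lemma root_vec_qcommuting:
  assumes "\<And>i. x i * x (Suc i) = q *s (x (Suc i) * x i)"
    and "\<And>i j. Suc i < j \<Longrightarrow> x i * x j = x j * x i"
  shows "root_vec x i (Suc k) = 0"
  using root_vec_qcomm[of "x i" x "Suc i" q k] assms by simp

end

section \<open>Straightening modulo an ideal\<close>

text \<open>Relations are congruences modulo a two-sided ideal, so that the quotient algebra is
  studied inside the ring type of its representatives.\<close>

locale qalg_ideal = qalg scale q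
  for scale :: "'k::field \<Rightarrow> 'r::ring_1 \<Rightarrow> 'r" (infixr "*s" 75) and q :: 'k +
  fixes I :: "'r set"
  assumes I_sub: "subspace I"
    and I_left: "x \<in> I \<Longrightarrow> y * x \<in> I"
    and I_right: "x \<in> I \<Longrightarrow> x * y \<in> I"
begin

lemmas I_closed = subspace_add[OF I_sub] subspace_diff[OF I_sub] subspace_neg[OF I_sub]
  subspace_scale[OF I_sub] subspace_0[OF I_sub] I_left I_right

definition cong :: "'r \<Rightarrow> 'r \<Rightarrow> bool" (infix "\<approx>" 50) where
  "x \<approx> y \<longleftrightarrow> x - y \<in> I"

lemma cong_refl [simp]: "x \<approx> x"
  by (simp add: cong_def I_closed)

lemma cong_sym: "x \<approx> y \<Longrightarrow> y \<approx> x"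
  unfolding cong_def by (metis I_closed(3) minus_diff_eq)

lemma cong_trans [trans]: "x \<approx> y \<Longrightarrow> y \<approx> z \<Longrightarrow> x \<approx> z"
  unfolding cong_def by (metis I_closed(1) diff_add_cancel add_diff_eq)

lemma cong_mult:
  assumes "x \<approx> x'" "y \<approx> y'"
  shows "x * y \<approx> x' * y'"
proof -
  have "x * y - x' * y' = (x - x') * y + x' * (y - y')" by (simp add: algebra_simps)
  then show ?thesis using assms unfolding cong_def by (simp add: I_closed)
qed

lemma cong_add: "x \<approx> x' \<Longrightarrow> y \<approx> y' \<Longrightarrow> x + y \<approx> x' + y'"
  unfolding cong_def by (metis I_closed(1) add_diff_add)

lemma cong_diff: "x \<approx> x' \<Longrightarrow> y \<approx> y' \<Longrightarrow> x - y \<approx> x' - y'"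
  unfolding cong_def by (metis I_closed(2) diff_diff_eq2 diff_add_eq add_diff_eq diff_diff_eq)

lemma cong_scale: "x \<approx> x' \<Longrightarrow> c *s x \<approx> c *s x'"
  unfolding cong_def by (metis I_closed(4) scale_right_diff_distrib)

definition q_comm :: "'k \<Rightarrow> 'r \<Rightarrow> 'r \<Rightarrow> bool" where
  "q_comm c x y \<longleftrightarrow> x * y \<approx> c *s (y * x)"

lemma q_comm_mult_right:
  assumes "q_comm c z x" "q_comm d z y"
  shows "q_comm (c * d) z (x * y)"
proof -
  have "z * (x * y) = z * x * y" by (simp add: mult.assoc)
  also have "\<dots> \<approx> (c *s (x * z)) * y"
    using assms(1) unfolding q_comm_def by (intro cong_mult) auto
  also have "\<dots> = c *s (x * (z * y))" by (simp add: scale_assoc mult.assoc)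
  also have "\<dots> \<approx> c *s (x * (d *s (y * z)))"
    using assms(2) unfolding q_comm_def by (intro cong_scale cong_mult) auto
  also have "\<dots> = (c * d) *s ((x * y) * z)" by (simp add: scale_assoc mult.assoc)
  finally show ?thesis unfolding q_comm_def .
qed

lemma q_comm_mult_left:
  assumes "q_comm c x z" "q_comm d y z"
  shows "q_comm (c * d) (x * y) z"
proof -
  have "(x * y) * z = x * (y * z)" by (simp add: mult.assoc)
  also have "\<dots> \<approx> x * (d *s (z * y))"
    using assms(2) unfolding q_comm_def by (intro cong_mult) auto
  also have "\<dots> = d *s ((x * z) * y)" by (simp add: scale_assoc mult.assoc)
  also have "\<dots> \<approx> d *s ((c *s (z * x)) * y)"
    using assms(1) unfolding q_comm_def by (intro cong_scale cong_mult) auto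
  also have "\<dots> = (c * d) *s (z * (x * y))" by (simp add: scale_assoc mult.assoc mult.commute)
  finally show ?thesis unfolding q_comm_def .
qed

lemma q_comm_diff_right: "q_comm c z x \<Longrightarrow> q_comm c z y \<Longrightarrow> q_comm c z (x - y)"
  unfolding q_comm_def using cong_diff[of "z * x" _ "z * y"] by (simp add: algebra_simps)

lemma q_comm_diff_left: "q_comm c x z \<Longrightarrow> q_comm c y z \<Longrightarrow> q_comm c (x - y) z"
  unfolding q_comm_def using cong_diff[of "x * z" _ "y * z"] by (simp add: algebra_simps)

lemma q_comm_scale_right: "q_comm c z x \<Longrightarrow> q_comm c z (d *s x)"
  unfolding q_comm_def using cong_scale[of "z * x" "c *s (x * z)" d] by (simp add: scale_assoc mult.commute[of d c])

lemma q_comm_scale_left: "q_comm c x z \<Longrightarrow> q_comm c (d *s x) z"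
  unfolding q_comm_def using cong_scale[of "x * z" "c *s (z * x)" d] by (simp add: scale_assoc mult.commute[of d c])

lemma q_comm_sym:
  assumes "q_comm c x y" "c \<noteq> 0"
  shows "q_comm (inverse c) y x"
  using cong_scale[of "x * y" "c *s (y * x)" "inverse c"] assms
  unfolding q_comm_def by (simp add: cong_sym)

lemma q_comm_1_sym: "q_comm 1 x y \<Longrightarrow> q_comm 1 y x"
  using q_comm_sym[of 1 x y] by simp

lemma q_comm_power_left: "q_comm c x z \<Longrightarrow> q_comm (c ^ e) (x ^ e) z"
proof (induction e)
  case (Suc e)
  then show ?case using q_comm_mult_left[of c x z "c ^ e" "x ^ e"] by simp
qed (simp add: q_comm_def)

lemma q_comm_root_vec_right:
  assumes "q_comm c z (x i)" and "\<And>j. i < j \<Longrightarrow> j \<le> i + k \<Longrightarrow> q_comm 1 z (x j)"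
  shows "q_comm c z (root_vec x i k)"
  using assms
proof (induction k arbitrary: i c)
  case (Suc k)
  have 1: "q_comm 1 z (root_vec x (Suc i) k)" by (rule Suc.IH) (use Suc.prems in auto)
  show ?case unfolding root_vec.simps
    using q_comm_mult_right[OF Suc.prems(1) 1] q_comm_mult_right[OF 1 Suc.prems(1)]
    by (intro q_comm_diff_right q_comm_scale_right) simp_all
qed simp

text \<open>\<open>serre z\<close> is linear in its second argument and respects multiplication by
  elements that commute with \<open>z\<close>, so it passes from \<open>x i\<close> to its brackets
  with later vectors. The commutator \<open>e\<close> collects the error inside
  \<open>I\<close>.\<close>

lemma serre_root_vec:
  assumes "serre z (x i) \<in> I" and "\<And>j. i < j \<Longrightarrow> j \<le> i + k \<Longrightarrow> q_comm 1 z (x j)"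
  shows "serre z (root_vec x i k) \<in> I"
proof (cases k)
  case (Suc k')
  let ?a = "x i" and ?w = "root_vec x (Suc i) k'"
  define e where "e = ?w * z - z * ?w"
  have "q_comm 1 z ?w" by (rule q_comm_root_vec_right) (use assms Suc in auto)
  then have e: "e \<in> I" using q_comm_1_sym[of z ?w] unfolding q_comm_def e_def cong_def by simp
  have wz: "?w * z = z * ?w + e" by (simp add: e_def)
  have wz': "?w * (z * y) = z * (?w * y) + e * y" for y
    by (metis wz mult.assoc distrib_right)
  have 1: "serre z (?a * ?w)
    = serre z ?a * ?w - (q + inverse q) *s (z * ?a * e) + ?a * e * z + ?a * z * e"
    unfolding serre_def by (simp add: wz wz' algebra_simps scale_assoc scale_distrib)
  have 2: "serre z (?w * ?a) = ?w * serre z ?a - (e * z + z * e) * ?a + (q + inverse q) *s (e * ?a * z)"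
    unfolding serre_def by (simp add: wz wz' algebra_simps scale_assoc scale_distrib)
  have "serre z (root_vec x i k) = serre z (?a * ?w) - q *s serre z (?w * ?a)"
    unfolding serre_def Suc root_vec.simps
    by (simp add: algebra_simps scale_assoc)
  then show ?thesis using assms(1) e by (simp add: 1 2 I_closed)
qed (use assms in simp)

text \<open>Both ways to evaluate the bracket express \<open>b * X\<close> and \<open>X * b\<close> in terms of each other and of one
  and the same commutator \<open>u * v - v * u\<close>.\<close>

lemma q_comm_middle:
  assumes "serre b a \<in> I" "serre b c \<in> I" "q_comm 1 a c"
  defines "v \<equiv> b * c - q *s (c * b)"
  defines "X \<equiv> a * v - q *s (v * a)"
  shows "q_comm 1 b X"
proof -
  define u where "u = a * b - q *s (b * a)"
  \<comment> \<open>The other bracketing of the triple; it differs from \<open>X\<close> only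
    through the commutator \<open>e3\<close> of the outer elements.\<close>
  define X' where "X' = u * c - q *s (c * u)"
  define e1 where "e1 = u * b - inverse q *s (b * u)"
  define e2 where "e2 = b * v - inverse q *s (v * b)"
  define e3 where "e3 = a * c - c * a"
  have e3: "e3 \<in> I" using assms(3) by (simp add: q_comm_def cong_def e3_def)
  have "e1 = serre b a"
    unfolding e1_def u_def serre_def by (simp add: algebra_simps scale_assoc scale_distrib q_nz)
  then have e1: "e1 \<in> I" using assms by simp
  have "e2 = serre b c"
    unfolding e2_def v_def serre_def by (simp add: algebra_simps scale_assoc scale_distrib q_nz)
  then have e2: "e2 \<in> I" using assms by simp
  have X: "X = X' - q *s (e3 * b) + q *s (b * e3)"
    unfolding X_def X'_def e3_def u_def v_def by (simp add: algebra_simps scale_assoc)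
  have ba: "b * a = inverse q *s (a * b - u)" and ba': "b * (a * y) = inverse q *s (a * (b * y) - u * y)" for y
    by (simp_all add: u_def algebra_simps scale_assoc q_nz)
  have cb: "c * b = inverse q *s (b * c - v)" and cb': "c * (b * y) = inverse q *s (b * (c * y) - v * y)" for y
    by (simp_all add: v_def algebra_simps scale_assoc q_nz)
  have ub: "u * b = inverse q *s (b * u) + e1" and ub': "u * (b * y) = inverse q *s (b * (u * y)) + e1 * y" for y
    by (simp_all add: e1_def algebra_simps scale_assoc)
  have bv: "b * v = inverse q *s (v * b) + e2" and bv': "b * (v * y) = inverse q *s (v * (b * y)) + e2 * y" for y
    by (simp_all add: e2_def algebra_simps scale_assoc)
  have 2: "b * X = (inverse q * inverse q) *s (X * b) - inverse q *s (u * v - v * u)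
      + inverse q *s (a * e2) - q *s (e2 * a)"
    unfolding X_def
    by (simp add: algebra_simps scale_assoc q_nz q_cancel ba ba' bv bv')
  have 1: "X' * b = (inverse q * inverse q) *s (b * X') - inverse q *s (u * v - v * u)
      + inverse q *s (e1 * c) - q *s (c * e1)"
    unfolding X'_def
    by (simp add: algebra_simps scale_assoc q_nz q_cancel cb cb' ub ub')
  define w where "w = X * b - b * X"
  \<comment> \<open>The difference of the two expressions loses the commutator of \<open>u\<close>
    and \<open>v\<close> and leaves 1 + q^-2 times the commutator of \<open>X\<close> and
    \<open>b\<close>. This scalar is invertible because 1 + q^2 is nonzero.\<close>
  have "(1 + inverse q * inverse q) *s w =
     (X' * b - (inverse q * inverse q) *s (b * X') + inverse q *s (u * v - v * u))
   - (b * X - (inverse q * inverse q) *s (X * b) + inverse q *s (u * v - v * u))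
   + (X - X') * b - (inverse q * inverse q) *s (b * (X - X'))"
    unfolding w_def by (simp add: algebra_simps scale_assoc)
  also have "X' * b - (inverse q * inverse q) *s (b * X') + inverse q *s (u * v - v * u)
      = inverse q *s (e1 * c) - q *s (c * e1)"
    by (simp add: 1)
  also have "b * X - (inverse q * inverse q) *s (X * b) + inverse q *s (u * v - v * u)
      = inverse q *s (a * e2) - q *s (e2 * a)"
    by (simp add: 2)
  also have "X - X' = q *s (b * e3) - q *s (e3 * b)"
    by (simp add: X)
  also have "inverse q *s (e1 * c) - q *s (c * e1) - (inverse q *s (a * e2) - q *s (e2 * a))
    + (q *s (b * e3) - q *s (e3 * b)) * b
    - (inverse q * inverse q) *s (b * (q *s (b * e3) - q *s (e3 * b))) \<in> I"
    using e1 e2 e3 by (intro I_closed; assumption?)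
  finally have "(1 + inverse q * inverse q) *s w \<in> I" .
  moreover have "1 + inverse q * inverse q \<noteq> 0"
    using q2_neq_m1 q_nz by (auto simp: field_simps)
  ultimately have "w \<in> I"
    using I_closed(4)[of "(1 + inverse q * inverse q) *s w" "inverse (1 + inverse q * inverse q)"] by simp
  then have "X * b \<approx> b * X" by (simp add: w_def cong_def)
  then show ?thesis unfolding q_comm_def by (simp add: cong_sym)
qed

text \<open>The Serre relations of type A modulo \<open>I\<close>, for a family indexed by all
  natural numbers. Finite or disconnected diagrams arise by putting zero at the missing
  nodes.\<close>

definition braided :: "(nat \<Rightarrow> 'r) \<Rightarrow> bool" where
  "braided x \<longleftrightarrow> (\<forall>i j. Suc i < j \<longrightarrow> q_comm 1 (x i) (x j))
     \<and> (\<forall>i. serre (x i) (x (Suc i)) \<in> I \<and> serre (x (Suc i)) (x i) \<in> I)"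

section \<open>Commutation of root vectors modulo the Serre relations\<close>

context
  fixes x :: "nat \<Rightarrow> 'r"
  assumes br: "braided x"
begin

lemma braided_far: "Suc i < j \<or> Suc j < i \<Longrightarrow> q_comm 1 (x i) (x j)"
  using br q_comm_1_sym unfolding braided_def by blast

text \<open>Rewritten, the Serre relation for x and y says that x commutes up to q^-1 with the
  bracket of x and y; \<open>serre_root_vec\<close> supplies it for the remaining root vector as
  y.\<close>

lemma root_vec_first: "q_comm (inverse q) (x i) (root_vec x i (Suc k))"
proof -
  let ?y = "root_vec x (Suc i) k"
  have s: "serre (x i) ?y \<in> I"
    by (rule serre_root_vec) (use br braided_far in \<open>auto simp: braided_def\<close>)
  have "x i * root_vec x i (Suc k) - inverse q *s (root_vec x i (Suc k) * x i) = serre (x i) ?y"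
    unfolding serre_def by (simp add: algebra_simps scale_assoc scale_distrib q_nz)
  then show ?thesis using s by (simp add: q_comm_def cong_def)
qed

text \<open>The node next to the left end is the case of \<open>q_comm_middle\<close> in which
  \<open>a\<close>, \<open>b\<close>, \<open>c\<close> are \<open>x i\<close>,
  \<open>x (Suc i)\<close> and the rest of the interval. Nodes further right commute with
  \<open>x i\<close> and, by induction, with the shorter root vector.\<close>

lemma root_vec_inner:
  assumes "i < j" "j < i + k"
  shows "q_comm 1 (x j) (root_vec x i k)"
  using assms
proof (induction k arbitrary: i)
  case (Suc k)
  show ?case
  proof (cases "j = Suc i")
    case True
    then obtain k' where k: "k = Suc k'" using Suc.prems by (cases k) auto
    show ?thesis unfolding True k root_vec.simps
    proof (rule q_comm_middle)
      show "serre (x (Suc i)) (x i) \<in> I" using br by (simp add: braided_def)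
      show "serre (x (Suc i)) (root_vec x (Suc (Suc i)) k') \<in> I"
        by (rule serre_root_vec) (use br braided_far in \<open>auto simp: braided_def\<close>)
      show "q_comm 1 (x i) (root_vec x (Suc (Suc i)) k')"
        by (rule q_comm_root_vec_right) (use braided_far in auto)
    qed
  next
    case False
    then have j: "Suc i < j" using Suc.prems by simp
    have 1: "q_comm 1 (x j) (root_vec x (Suc i) k)" by (rule Suc.IH) (use Suc.prems j in auto)
    have 2: "q_comm 1 (x j) (x i)" using j braided_far by simp
    show ?thesis unfolding root_vec.simps
      using q_comm_mult_right[OF 1 2] q_comm_mult_right[OF 2 1]
      by (intro q_comm_diff_right q_comm_scale_right) simp_all
  qed
qed simp

text \<open>Both intervals end at the same node. The longer vector q-commutes, by induction, with
  the part beyond \<open>Suc i\<close> and commutes with the inner node \<open>x (Suc i)\<close>,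
  hence it passes through the bracket defining the shorter vector.\<close>

lemma root_vec_neighbours: "q_comm (inverse q) (root_vec x i (Suc k)) (root_vec x (Suc i) k)"
proof (induction k arbitrary: i)
  case 0
  have "root_vec x i (Suc 0) * x (Suc i) - inverse q *s (x (Suc i) * root_vec x i (Suc 0))
    = serre (x (Suc i)) (x i)"
    unfolding serre_def by (simp add: algebra_simps scale_assoc scale_distrib q_nz)
  then show ?case using br by (simp add: q_comm_def cong_def braided_def)
next
  case (Suc k)
  let ?y0 = "root_vec x i (Suc (Suc k))" and ?y1 = "root_vec x (Suc i) (Suc k)" and ?y2 = "root_vec x (Suc (Suc i)) k"
  have 1: "q_comm 1 (x i) ?y2"
    by (rule q_comm_root_vec_right) (use braided_far in auto)
  have 2: "q_comm (inverse q) ?y1 ?y2" by (rule Suc.IH)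
  have 3: "q_comm (inverse q) ?y0 ?y2"
    unfolding root_vec.simps(2)[of x i "Suc k"]
    using q_comm_mult_left[OF 1 2] q_comm_mult_left[OF 2 1]
    by (intro q_comm_diff_left q_comm_scale_left) simp_all
  have 4: "q_comm 1 ?y0 (x (Suc i))"
    by (rule q_comm_1_sym, rule root_vec_inner) simp_all
  show ?case
    unfolding root_vec.simps(2)[of x "Suc i" k]
    using q_comm_mult_right[OF 3 4] q_comm_mult_right[OF 4 3]
    by (intro q_comm_diff_right q_comm_scale_right) simp_all
qed

end

end

section \<open>Ordered monomials in root vectors and their span\<close>

context qalg_ideal
begin

definition mon :: "('a \<Rightarrow> 'r) \<Rightarrow> 'a list \<Rightarrow> ('a \<Rightarrow> nat) \<Rightarrow> 'r" where
  "mon z L e = prod_list (map (\<lambda>r. z r ^ e r) L)"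

lemma mon_Nil [simp]: "mon z [] e = 1"
  and mon_snoc: "mon z (L @ [r]) e = mon z L e * z r ^ e r"
  by (simp_all add: mon_def)

lemma mon_cong: "(\<And>r. r \<in> set L \<Longrightarrow> e r = e' r) \<Longrightarrow> mon z L e = mon z L e'"
  unfolding mon_def by (simp cong: map_cong)

definition spanI :: "'r set \<Rightarrow> 'r set" where
  "spanI B = span (B \<union> I)"

lemma spanI_base: "b \<in> B \<Longrightarrow> b \<in> spanI B"
  unfolding spanI_def by (rule span_base) simp

lemma spanI_closed:
  "x \<in> I \<Longrightarrow> x \<in> spanI B" "0 \<in> spanI B"
  "x \<in> spanI B \<Longrightarrow> y \<in> spanI B \<Longrightarrow> x + y \<in> spanI B"
  "x \<in> spanI B \<Longrightarrow> y \<in> spanI B \<Longrightarrow> x - y \<in> spanI B"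
  "x \<in> spanI B \<Longrightarrow> c *s x \<in> spanI B"
  unfolding spanI_def by (auto intro: span_base span_zero span_add span_diff span_scale)

lemma spanI_cong: "y \<in> spanI B \<Longrightarrow> x \<approx> y \<Longrightarrow> x \<in> spanI B"
  using spanI_closed(3)[of "x - y" B y] spanI_closed(1)[of "x - y" B] by (simp add: cong_def)

lemma spanI_mult_right:
  assumes "u \<in> spanI B" and "\<And>b. b \<in> B \<Longrightarrow> b * w \<in> spanI B'"
  shows "u * w \<in> spanI B'"
  using assms(1) unfolding spanI_def
proof (induction rule: span_induct_alt)
  case (step c x y)
  have "x * w \<in> spanI B'"
    using step assms(2) I_right spanI_closed(1) by auto
  then have "c *s (x * w) + y * w \<in> spanI B'"
    using step.IH unfolding spanI_def[symmetric] by (intro spanI_closed(3,5))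
  then show ?case by (simp add: distrib_right scale_assoc spanI_def)
qed (simp add: span_zero)

lemma spanI_mult_left:
  assumes "u \<in> spanI B" and "\<And>b. b \<in> B \<Longrightarrow> w * b \<in> spanI B'"
  shows "w * u \<in> spanI B'"
  using assms(1) unfolding spanI_def
proof (induction rule: span_induct_alt)
  case (step c x y)
  have "w * x \<in> spanI B'"
    using step assms(2) I_left spanI_closed(1) by auto
  then have "c *s (w * x) + w * y \<in> spanI B'"
    using step.IH unfolding spanI_def[symmetric] by (intro spanI_closed(3,5))
  then show ?case by (simp add: distrib_left scale_assoc spanI_def)
qed (simp add: span_zero)

definition right_closed :: "'r set \<Rightarrow> 'r \<Rightarrow> bool" where
  "right_closed S y \<longleftrightarrow> (\<forall>u\<in>S. u * y \<in> S)"

text \<open>The left coefficients \<open>B\<close> are arbitrary so that one straightening argument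
  serves twice: with \<open>{1}\<close> for the F part, and with products of F and torus monomials
  for the E part.\<close>

definition mons :: "'r set \<Rightarrow> ('a \<Rightarrow> 'r) \<Rightarrow> 'a list \<Rightarrow> 'r set" where
  "mons B z L = {b * mon z L e | b e. b \<in> B}"

lemma mons_snoc_power:
  assumes "u \<in> spanI (mons B z L)" "r \<notin> set L"
  shows "u * z r ^ k \<in> spanI (mons B z (L @ [r]))"
  using assms(1)
proof (rule spanI_mult_right)
  fix b assume "b \<in> mons B z L"
  then obtain b' e where b: "b = b' * mon z L e" "b' \<in> B" by (auto simp: mons_def)
  have "mon z L (e(r := k)) = mon z L e"
    by (rule mon_cong) (use assms(2) in auto)
  then have "b * z r ^ k = b' * mon z (L @ [r]) (e(r := k))"
    by (simp add: b mon_snoc mult.assoc)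
  then show "b * z r ^ k \<in> spanI (mons B z (L @ [r]))"
    using b by (intro spanI_base) (auto simp: mons_def)
qed

lemma mons_snoc_closedI:
  assumes "\<And>u k. u \<in> spanI (mons B z L) \<Longrightarrow> u * (z r ^ k * y) \<in> spanI (mons B z (L @ [r]))"
  shows "right_closed (spanI (mons B z (L @ [r]))) y"
  unfolding right_closed_def
proof
  fix u assume "u \<in> spanI (mons B z (L @ [r]))"
  then show "u * y \<in> spanI (mons B z (L @ [r]))"
  proof (rule spanI_mult_right)
    fix b assume "b \<in> mons B z (L @ [r])"
    then obtain b' e where b: "b = b' * mon z L e * z r ^ e r" "b' \<in> B"
      by (auto simp: mons_def mon_snoc mult.assoc)
    have "b' * mon z L e \<in> spanI (mons B z L)"
      using b by (intro spanI_base) (auto simp: mons_def)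
    from assms[OF this] show "b * y \<in> spanI (mons B z (L @ [r]))"
      by (simp add: b mult.assoc)
  qed
qed

lemma mons_last_closed:
  assumes "r \<notin> set L"
  shows "right_closed (spanI (mons B z (L @ [r]))) (z r)"
  using mons_snoc_power[OF _ assms, where k = "Suc k" for k]
  by (intro mons_snoc_closedI) (simp add: power_commutes)

definition root_elem :: "(nat \<Rightarrow> 'r) \<Rightarrow> nat \<times> nat \<Rightarrow> 'r" where
  "root_elem x = (\<lambda>(i, t). root_vec x i (t - i))"

definition root_column :: "nat \<Rightarrow> nat \<Rightarrow> (nat \<times> nat) list" where
  "root_column t i = map (\<lambda>i. (i, t)) [0..<i]"

text \<open>Intervals \<open>(i, t)\<close> ordered by right end and, within a column, by left end.
  The root vector created by straightening past \<open>(Suc j, t)\<close> then belongs to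
  \<open>(j, t)\<close>, the entry directly before it.\<close>

primrec root_columns :: "nat \<Rightarrow> (nat \<times> nat) list" where
  "root_columns 0 = []"
| "root_columns (Suc t) = root_columns t @ root_column t (Suc t)"

lemma root_column_0 [simp]: "root_column t 0 = []" and root_column_Suc: "root_column t (Suc i) = root_column t i @ [(i, t)]"
  by (simp_all add: root_column_def)

lemma set_root_columns: "set (root_columns t) = {(i, s). i \<le> s \<and> s < t}"
  by (induction t) (auto simp: root_column_def less_Suc_eq)

lemma not_in_root_columns: "(i, t) \<notin> set (root_columns t @ root_column t i)"
  by (auto simp: set_root_columns root_column_def)

lemma distinct_root_columns: "distinct (root_columns t)"
  by (induction t) (auto simp: root_column_def distinct_map inj_on_def set_root_columns)

text \<open>Coming from the right, \<open>x j\<close> commutes up to a scalar with the root vector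
  of \<open>(i, t)\<close> unless i = Suc j. In that case the bracket creates the root vector of
  \<open>(j, t)\<close>, which already has its place further left.\<close>

lemma column_closed:
  assumes br: "braided x" and "j < t" and "i \<le> Suc t"
    and base: "right_closed (spanI (mons B (root_elem x) (root_columns t))) (x j)"
  shows "right_closed (spanI (mons B (root_elem x) (root_columns t @ root_column t i))) (x j)"
  using \<open>i \<le> Suc t\<close>
proof (induction i)
  case (Suc i)
  let ?W = "\<lambda>i. spanI (mons B (root_elem x) (root_columns t @ root_column t i))"
  define y where "y = root_vec x i (t - i)"
  have W: "?W (Suc i) = spanI (mons B (root_elem x) ((root_columns t @ root_column t i) @ [(i, t)]))"
    by (simp add: root_column_Suc)
  have y: "root_elem x (i, t) = y" by (simp add: root_elem_def y_def)
  have IH: "u * x j \<in> ?W i" if "u \<in> ?W i" for u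
    using Suc that by (auto simp: right_closed_def)
  have pow: "u * y ^ k \<in> ?W (Suc i)" if "u \<in> ?W i" for u k
    using mons_snoc_power[OF that not_in_root_columns, of k] by (simp add: y W)
  show ?case unfolding W
  proof (rule mons_snoc_closedI, unfold y W[symmetric])
    fix u k assume u: "u \<in> ?W i"
    show "u * (y ^ k * x j) \<in> ?W (Suc i)"
    proof (cases "i = Suc j")
      case False
      have "\<exists>c. q_comm c y (x j)"
      proof -
        consider "i < j" | "i = j" | "Suc j < i" using False by linarith
        then show ?thesis
        proof cases
          case 1
          then have "q_comm 1 (x j) y"
            unfolding y_def using \<open>j < t\<close> by (intro root_vec_inner[OF br]) auto
          then show ?thesis using q_comm_1_sym by blast
        next
          case 2
          obtain k where "t - j = Suc k" using \<open>j < t\<close> by (metis Suc_diff_Suc)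
          then have "q_comm (inverse q) (x j) y" unfolding y_def 2 using root_vec_first[OF br] by simp
          then show ?thesis using q_comm_sym q_nz by fastforce
        next
          case 3
          then have "q_comm 1 (x j) y"
            unfolding y_def using braided_far[OF br] by (intro q_comm_root_vec_right) auto
          then show ?thesis using q_comm_1_sym by blast
        qed
      qed
      then obtain c where "q_comm (c ^ k) (y ^ k) (x j)" using q_comm_power_left by blast
      then have "u * (y ^ k * x j) \<approx> u * (c ^ k *s (x j * y ^ k))"
        unfolding q_comm_def by (intro cong_mult) auto
      also have "\<dots> = c ^ k *s (u * x j * y ^ k)" by (simp add: scale_assoc mult.assoc)
      finally show ?thesis
        using spanI_cong spanI_closed(5)[OF pow[OF IH[OF u]]] by blast
    next
      case True
      obtain k' where k': "t - j = Suc k'" using \<open>j < t\<close> by (metis Suc_diff_Suc)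
      then have "t - i = k'" using True by simp
      then have y': "y = root_vec x (Suc j) k'" by (simp add: y_def True)
      define p where "p = root_elem x (j, t)"
      have p': "p = root_vec x j (Suc k')" by (simp add: p_def root_elem_def k')
      have yx: "y * x j = inverse q *s (x j * y - p)"
        by (simp add: p' y' q_nz)
      have "q_comm (inverse q) p y" unfolding p' y' by (rule root_vec_neighbours[OF br])
      then have yp: "y * p \<approx> q *s (p * y)" using q_comm_sym q_nz unfolding q_comm_def by fastforce
      \<comment> \<open>A \<open>p\<close> is created for each \<open>y\<close> that is passed; as
        \<open>p\<close> q-commutes with \<open>y\<close>, these contributions collapse to one
        multiple of \<open>p * y ^ k\<close>.\<close>
      have "\<exists>\<alpha> \<beta>. y ^ Suc k * x j \<approx> \<alpha> *s (x j * y ^ Suc k) + \<beta> *s (p * y ^ k)" for k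
      proof (induction k)
        case 0
        show ?case
          by (rule exI[of _ "inverse q"], rule exI[of _ "- inverse q"])
            (simp add: yx scale_right_diff_distrib)
      next
        case (Suc k)
        then obtain \<alpha> \<beta> where IH: "y ^ Suc k * x j \<approx> \<alpha> *s (x j * y ^ Suc k) + \<beta> *s (p * y ^ k)"
          by blast
        have "y ^ Suc (Suc k) * x j = y * (y ^ Suc k * x j)" by (simp add: mult.assoc)
        also have "\<dots> \<approx> y * (\<alpha> *s (x j * y ^ Suc k) + \<beta> *s (p * y ^ k))"
          using IH by (intro cong_mult) auto
        also have "\<dots> = \<alpha> *s ((y * x j) * y ^ Suc k) + \<beta> *s ((y * p) * y ^ k)"
          by (simp add: algebra_simps scale_assoc)
        also have "\<dots> \<approx> \<alpha> *s ((y * x j) * y ^ Suc k) + \<beta> *s ((q *s (p * y)) * y ^ k)"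
          using yp by (intro cong_add cong_scale cong_mult) auto
        also have "\<dots> = (\<alpha> * inverse q) *s (x j * y ^ Suc (Suc k))
            + (\<beta> * q - \<alpha> * inverse q) *s (p * y ^ Suc k)"
          by (simp add: yx algebra_simps scale_assoc scale_distrib)
        finally show ?case by blast
      qed
      note ex = this
      show ?thesis
      proof (cases k)
        case 0
        then show ?thesis using pow[OF IH[OF u], of 0] by simp
      next
        case (Suc l)
        obtain \<alpha> \<beta> where "y ^ k * x j \<approx> \<alpha> *s (x j * y ^ k) + \<beta> *s (p * y ^ l)"
          using ex[of l] Suc by blast
        then have "u * (y ^ k * x j) \<approx> u * (\<alpha> *s (x j * y ^ k) + \<beta> *s (p * y ^ l))"
          by (intro cong_mult) auto
        also have "\<dots> = \<alpha> *s (u * x j * y ^ k) + \<beta> *s (u * p * y ^ l)"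
          by (simp add: algebra_simps scale_assoc)
        finally have 1: "u * (y ^ k * x j) \<approx> \<alpha> *s (u * x j * y ^ k) + \<beta> *s (u * p * y ^ l)" .
        \<comment> \<open>Since i = Suc j, the last root treated so far is \<open>(j, t)\<close>, so
          \<open>p\<close> only raises the last exponent.\<close>
        have "right_closed (spanI (mons B (root_elem x) ((root_columns t @ root_column t j) @ [(j, t)]))) p"
          unfolding p_def by (rule mons_last_closed[OF not_in_root_columns])
        then have "u * p \<in> ?W i"
          using u by (simp add: right_closed_def True root_column_Suc)
        then show ?thesis
          using pow[OF IH[OF u], of k] pow[of "u * p" l] 1
          by (meson spanI_cong spanI_closed(3,5))
      qed
    qed
  qed
qed (use base in simp)

text \<open>The newest letter is itself the last root vector and raises the last exponent; smaller
  letters pass through the last column into the previous stage.\<close>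

theorem root_columns_closed:
  assumes br: "braided x" and "j < t"
  shows "right_closed (spanI (mons B (root_elem x) (root_columns t))) (x j)"
  using \<open>j < t\<close>
proof (induction t)
  case (Suc t)
  show ?case
  proof (cases "j = t")
    case False
    then have "j < t" using Suc.prems by simp
    then show ?thesis using column_closed[OF br \<open>j < t\<close> le_refl Suc.IH] by simp
  next
    case True
    have "right_closed (spanI (mons B (root_elem x) ((root_columns t @ root_column t t) @ [(t, t)]))) (root_elem x (t, t))"
      by (rule mons_last_closed[OF not_in_root_columns])
    then show ?thesis by (simp add: True root_column_Suc root_elem_def)
  qed
qed simp

section \<open>Words, torus letters and triangular decomposition\<close>

definition left_closed :: "'r set \<Rightarrow> 'r \<Rightarrow> bool" where
  "left_closed S y \<longleftrightarrow> (\<forall>u\<in>S. y * u \<in> S)"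

definition words :: "'r set \<Rightarrow> 'r set" where
  "words G = {prod_list l | l. set l \<subseteq> G}"

lemma one_in_words: "1 \<in> words G"
  unfolding words_def by (rule CollectI, rule exI[of _ "[]"]) simp

lemma words_Cons: "g \<in> G \<Longrightarrow> w \<in> words G \<Longrightarrow> g * w \<in> words G"
  unfolding words_def by (clarify, rule_tac x = "g # l" in exI) simp

lemma words_induct [consumes 1, case_names one Cons]:
  assumes "w \<in> words G" "P 1" "\<And>g w. g \<in> G \<Longrightarrow> w \<in> words G \<Longrightarrow> P w \<Longrightarrow> P (g * w)"
  shows "P w"
proof -
  obtain l where l: "w = prod_list l" "set l \<subseteq> G" using assms(1) by (auto simp: words_def)
  show ?thesis unfolding l(1) using l(2)
  proof (induction l)
    case (Cons g l)
    then have "prod_list l \<in> words G" by (auto simp: words_def)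
    then show ?case using Cons assms(3) by simp
  qed (simp add: assms(2))
qed

lemma right_closed_words:
  assumes "\<And>g. g \<in> G \<Longrightarrow> right_closed S g" "w \<in> words G" "u \<in> S"
  shows "u * w \<in> S"
  using assms(2,3)
proof (induction arbitrary: u rule: words_induct)
  case (Cons g w)
  then have "u * g \<in> S" using assms(1) by (simp add: right_closed_def)
  from Cons.IH[OF this] show ?case by (simp add: mult.assoc)
qed simp

lemma left_closed_words:
  assumes "\<And>g. g \<in> G \<Longrightarrow> left_closed S g" "w \<in> words G" "u \<in> S"
  shows "w * u \<in> S"
  using assms(2)
proof (induction rule: words_induct)
  case (Cons g w)
  then show ?case using assms(1) by (simp add: left_closed_def mult.assoc)
qed (simp add: assms(3))

lemma q_comm_words:
  assumes "\<And>g. g \<in> G \<Longrightarrow> \<exists>c. q_comm c z g" "w \<in> words G"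
  shows "\<exists>c. q_comm c z w"
  using assms(2)
proof (induction rule: words_induct)
  case one
  have "q_comm 1 z 1" by (simp add: q_comm_def)
  then show ?case by blast
qed (use assms(1) q_comm_mult_right in blast)

lemma q_comm_inverse:
  assumes "k * k' \<approx> 1" "k' * k \<approx> 1" "q_comm c k y" "c \<noteq> 0"
  shows "q_comm (inverse c) k' y"
proof -
  have yk: "y * k \<approx> inverse c *s (k * y)" using q_comm_sym[OF assms(3,4)] by (simp add: q_comm_def)
  have "k' * y = k' * y * 1" by simp
  also have "\<dots> \<approx> k' * y * (k * k')" using assms(1) by (intro cong_mult) (auto intro: cong_sym)
  also have "\<dots> = k' * (y * k) * k'" by (simp add: mult.assoc)
  also have "\<dots> \<approx> k' * (inverse c *s (k * y)) * k'" using yk by (intro cong_mult) auto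
  also have "\<dots> = inverse c *s ((k' * k) * (y * k'))" by (simp add: scale_assoc mult.assoc)
  also have "\<dots> \<approx> inverse c *s (1 * (y * k'))"
    using assms(2) by (intro cong_scale cong_mult) auto
  finally show ?thesis by (simp add: q_comm_def)
qed

lemma q_comm_1_prod_list: "(\<And>y. y \<in> set ys \<Longrightarrow> q_comm 1 y x) \<Longrightarrow> q_comm 1 (prod_list ys) x"
proof (induction ys)
  case (Cons y ys)
  then show ?case using q_comm_mult_left[of 1 y x 1 "prod_list ys"] by simp
qed (simp add: q_comm_def)

end

text \<open>The input of straightening: Serre relations, torus letters that q-commute with
  \<open>E\<close> and \<open>F\<close>, and commutators of \<open>E\<close> with \<open>F\<close>
  in the torus. The scalars stay unspecified, so the different q_i of the two blocks need no
  separate treatment.\<close>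

locale triangular = qalg_ideal +
  fixes E F K K' :: "nat \<Rightarrow> 'b" and N :: nat and ks :: "nat list"
  assumes brE: "braided E" and brF: "braided F"
    and E_out: "j \<ge> N \<Longrightarrow> E j = 0" and F_out: "j \<ge> N \<Longrightarrow> F j = 0"
    and dist: "distinct ks"
    and KK: "k \<in> set ks \<Longrightarrow> l \<in> set ks \<Longrightarrow> q_comm 1 (K k) (K l)"
    and KK': "k \<in> set ks \<Longrightarrow> K k * K' k \<approx> 1" and K'K: "k \<in> set ks \<Longrightarrow> K' k * K k \<approx> 1"
    and KE: "k \<in> set ks \<Longrightarrow> \<exists>c. c \<noteq> 0 \<and> q_comm c (K k) (E j)"
    and KF: "k \<in> set ks \<Longrightarrow> \<exists>c. c \<noteq> 0 \<and> q_comm c (K k) (F j)"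
    and EF: "\<exists>c. \<exists>k\<in>set ks. \<exists>l\<in>set ks.
      E i * F j - F j * E i \<approx> scale c (K k * K' l - K' k * K l)"
begin

definition K_power :: "nat \<Rightarrow> int \<Rightarrow> 'b" where
  "K_power k z = (if 0 \<le> z then K k ^ nat z else K' k ^ nat (- z))"

definition K_mon :: "nat list \<Rightarrow> (nat \<Rightarrow> int) \<Rightarrow> 'b" where
  "K_mon L \<mu> = prod_list (map (\<lambda>k. K_power k (\<mu> k)) L)"

lemma KK_all:
  assumes "k \<in> set ks" "l \<in> set ks"
  shows "q_comm 1 (K' k) (K l)" "q_comm 1 (K k) (K' l)" "q_comm 1 (K' k) (K' l)"
proof -
  have 1: "q_comm 1 (K' k) (K l)" if "k \<in> set ks" "l \<in> set ks" for k l
    using q_comm_inverse[OF KK' K'K KK] that by fastforce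
  show 2: "q_comm 1 (K k) (K' l)" using 1[of l k] assms by (simp add: q_comm_1_sym)
  show "q_comm 1 (K' k) (K l)" using 1 assms by blast
  show "q_comm 1 (K' k) (K' l)" using q_comm_inverse[OF KK' K'K 2] assms by fastforce
qed

lemma q_comm_K_power:
  assumes "k \<in> set ks" "l \<in> set ks"
  shows "q_comm 1 (K_power l z) (K k)" "q_comm 1 (K_power l z) (K' k)"
  using KK KK_all assms q_comm_power_left[of 1] unfolding K_power_def by fastforce+

lemma K_power_step:
  assumes "k \<in> set ks"
  shows "K_power k z * K k \<approx> K_power k (z + 1)" and "K_power k z * K' k \<approx> K_power k (z - 1)"
proof -
  show "K_power k z * K k \<approx> K_power k (z + 1)"
  proof (cases "0 \<le> z")
    case True
    then have "nat (z + 1) = Suc (nat z)" by simp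
    then show ?thesis using True by (simp add: K_power_def power_commutes)
  next
    case False
    define w where "w = nat (- (z + 1))"
    have w: "nat (- z) = Suc w" using False by (simp add: w_def)
    have "K_power k z * K k = K' k ^ w * (K' k * K k)"
      using False by (simp add: K_power_def w mult.assoc flip: power_Suc2 del: power_Suc)
        (metis mult.assoc power_Suc2)
    also have "\<dots> \<approx> K' k ^ w * 1" using K'K[OF assms] by (intro cong_mult) auto
    also have "K' k ^ w * 1 = K_power k (z + 1)"
      using False by (cases "z + 1 = 0") (auto simp: K_power_def w_def)
    finally show ?thesis .
  qed
  show "K_power k z * K' k \<approx> K_power k (z - 1)"
  proof (cases "0 < z")
    case True
    define w where "w = nat (z - 1)"
    have w: "nat z = Suc w" using True by (simp add: w_def)
    have "K_power k z * K' k = K k ^ w * (K k * K' k)"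
      using True by (simp add: K_power_def w mult.assoc flip: power_Suc2 del: power_Suc)
        (metis mult.assoc power_Suc2)
    also have "\<dots> \<approx> K k ^ w * 1" using KK'[OF assms] by (intro cong_mult) auto
    also have "K k ^ w * 1 = K_power k (z - 1)"
      using True by (auto simp: K_power_def w_def)
    finally show ?thesis .
  next
    case False
    then have "nat (- (z - 1)) = Suc (nat (- z))" by simp
    then show ?thesis using False
      by (cases "z = 0") (auto simp: K_power_def power_commutes)
  qed
qed

text \<open>The letter \<open>g\<close> changes exponents by \<open>f\<close>, so \<open>K k\<close>
  with + 1 and \<open>K' k\<close> with - 1 are one argument: \<open>g\<close> commutes past the
  other powers and is absorbed by its own.\<close>

lemma K_mon_step:
  assumes "k \<in> set ks" "\<And>z. K_power k z * g \<approx> K_power k (f z)"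
    and "\<And>l z. l \<in> set ks \<Longrightarrow> q_comm 1 (K_power l z) g"
    and "set L \<subseteq> set ks" "k \<in> set L" "distinct L"
  shows "K_mon L \<mu> * g \<approx> K_mon L (\<mu>(k := f (\<mu> k)))"
  using assms(4-6)
proof (induction L)
  case (Cons a L)
  show ?case
  proof (cases "a = k")
    case True
    have same: "K_mon L (\<mu>(k := f (\<mu> k))) = K_mon L \<mu>"
      unfolding K_mon_def using Cons.prems True by (auto intro!: arg_cong[of _ _ prod_list])
    have "q_comm 1 (K_mon L \<mu>) g"
      unfolding K_mon_def using Cons.prems assms(3) by (intro q_comm_1_prod_list) auto
    then have c: "K_mon L \<mu> * g \<approx> g * K_mon L \<mu>" by (simp add: q_comm_def)
    have "K_mon (a # L) \<mu> * g = K_power k (\<mu> k) * (K_mon L \<mu> * g)"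
      by (simp add: K_mon_def True mult.assoc)
    also have "\<dots> \<approx> K_power k (\<mu> k) * (g * K_mon L \<mu>)" by (rule cong_mult[OF cong_refl c])
    also have "\<dots> = (K_power k (\<mu> k) * g) * K_mon L \<mu>" by (simp add: mult.assoc)
    also have "\<dots> \<approx> K_power k (f (\<mu> k)) * K_mon L \<mu>" using assms(2) by (intro cong_mult) auto
    also have "\<dots> = K_mon (a # L) (\<mu>(k := f (\<mu> k)))"
      using same by (simp add: K_mon_def True)
    finally show ?thesis .
  next
    case False
    have "K_mon (a # L) \<mu> * g = K_power a (\<mu> a) * (K_mon L \<mu> * g)"
      by (simp add: K_mon_def mult.assoc)
    also have "\<dots> \<approx> K_power a (\<mu> a) * K_mon L (\<mu>(k := f (\<mu> k)))"
      using Cons.prems False by (intro cong_mult[OF cong_refl] Cons.IH) auto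
    also have "\<dots> = K_mon (a # L) (\<mu>(k := f (\<mu> k)))"
      using False by (simp add: K_mon_def)
    finally show ?thesis .
  qed
qed simp

definition pbw :: "(nat \<times> nat \<Rightarrow> nat) \<times> (nat \<Rightarrow> int) \<times> (nat \<times> nat \<Rightarrow> nat) \<Rightarrow> 'b" where
  "pbw = (\<lambda>(f, \<mu>, e). mon (root_elem F) (root_columns N) f * K_mon ks \<mu> * mon (root_elem E) (root_columns N) e)"

abbreviation "Kgens \<equiv> K ` set ks \<union> K' ` set ks"

text \<open>Each stage takes the monomials already produced as left coefficients of the next: words
  in \<open>F\<close>, torus letters, words in \<open>E\<close>.\<close>

lemma triangular_products:
  assumes "f \<in> words (range F)" "k \<in> words Kgens" "e \<in> words (range E)"
  shows "f * k * e \<in> spanI (range pbw)"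
proof -
  define S1 where "S1 = spanI (mons {1} (root_elem F) (root_columns N))"
  define B where "B = {m * K_mon ks \<mu> | m \<mu>. m \<in> mons {1} (root_elem F) (root_columns N)}"
  define S3 where "S3 = spanI (mons B (root_elem E) (root_columns N))"
  have zero: "right_closed (spanI A) 0" for A by (simp add: right_closed_def spanI_closed)
  have mon1: "mon z L (\<lambda>_. 0) = 1" for z :: "'c \<Rightarrow> 'b" and L
    unfolding mon_def by (induction L) auto
  have "1 \<in> mons {1} (root_elem F) (root_columns N)"
    unfolding mons_def using mon1[of "root_elem F" "root_columns N"] by (auto intro!: exI[of _ "\<lambda>_. 0"])
  then have "1 \<in> S1" unfolding S1_def by (rule spanI_base)
  moreover have "right_closed S1 (F j)" for j
    unfolding S1_def using root_columns_closed[OF brF, of j N] F_out[of j] zero by (cases "j < N") auto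
  ultimately have "1 * f \<in> S1" using assms(1) by (intro right_closed_words[of "range F"]) auto
  then have f: "f \<in> S1" by simp
  have rc: "right_closed (spanI B) g"
    if g: "k \<in> set ks" "\<And>z. K_power k z * g \<approx> K_power k (h z)" "\<And>l z. l \<in> set ks \<Longrightarrow> q_comm 1 (K_power l z) g" for k g h
    unfolding right_closed_def
  proof
    fix u assume "u \<in> spanI B"
    then show "u * g \<in> spanI B"
    proof (rule spanI_mult_right)
      fix b assume "b \<in> B"
      then obtain m \<mu> where b: "b = m * K_mon ks \<mu>" "m \<in> mons {1} (root_elem F) (root_columns N)"
        by (auto simp: B_def)
      have "b * g \<approx> m * K_mon ks (\<mu>(k := h (\<mu> k)))"
        unfolding b mult.assoc using K_mon_step[OF g, where L = ks] g dist by (intro cong_mult) auto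
      moreover have "m * K_mon ks (\<mu>(k := h (\<mu> k))) \<in> spanI B"
        using b by (intro spanI_base) (auto simp: B_def)
      ultimately show "b * g \<in> spanI B" using spanI_cong by blast
    qed
  qed
  have "K_mon ks (\<lambda>_. 0) = 1"
  proof -
    have "K_mon L (\<lambda>_. 0) = 1" for L by (induction L) (auto simp: K_mon_def K_power_def)
    then show ?thesis .
  qed
  then have "m \<in> B" if "m \<in> mons {1} (root_elem F) (root_columns N)" for m
    unfolding B_def using that by (intro CollectI exI[of _ m] exI[of _ "\<lambda>_. 0"]) simp
  then have "f * 1 \<in> spanI B"
    using f unfolding S1_def by (elim spanI_mult_right) (simp add: spanI_base)
  moreover have "right_closed (spanI B) g" if "g \<in> Kgens" for g
    using that rc[of _ "K k" "\<lambda>z. z + 1" for k] rc[of _ "K' k" "\<lambda>z. z - 1" for k] K_power_step q_comm_K_power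
    by blast
  ultimately have fk: "f * k \<in> spanI B"
    using assms(2) right_closed_words[of Kgens] by simp
  have "b \<in> mons B (root_elem E) (root_columns N)" if "b \<in> B" for b
    unfolding mons_def using that mon1[of "root_elem E" "root_columns N"]
    by (intro CollectI exI[of _ b] exI[of _ "\<lambda>_. 0"]) simp
  then have "f * k * 1 \<in> S3"
    using fk unfolding S3_def by (elim spanI_mult_right) (simp add: spanI_base)
  moreover have "right_closed S3 (E j)" for j
    unfolding S3_def using root_columns_closed[OF brE, of j N] E_out[of j] zero by (cases "j < N") auto
  ultimately have "f * k * e \<in> S3"
    using assms(3) right_closed_words[of "range E" S3 e "f * k"] by auto
  moreover have "mons B (root_elem E) (root_columns N) \<subseteq> range pbw"
    by (auto simp: mons_def B_def pbw_def image_iff) blast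
  ultimately show ?thesis
    using span_mono[of "mons B (root_elem E) (root_columns N) \<union> I" "range pbw \<union> I"]
    unfolding S3_def spanI_def by blast
qed

text \<open>Left multiplication by generators preserves the span of products of an \<open>F\<close>
  word, a torus word and an \<open>E\<close> word. The critical letter is \<open>E i\<close>:
  passing \<open>F j\<close> leaves a commutator in the torus, and torus letters are already known
  to preserve the span.\<close>

theorem pbw_spanning:
  assumes "w \<in> words (range E \<union> range F \<union> Kgens)"
  shows "w \<in> spanI (range pbw)"
proof -
  define T0 where "T0 = {f * k * e | f k e. f \<in> words (range F) \<and> k \<in> words Kgens \<and> e \<in> words (range E)}"
  define T where "T = spanI T0"
  have T0I: "f * k * e \<in> T" if "f \<in> words (range F)" "k \<in> words Kgens" "e \<in> words (range E)" for f k e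
    unfolding T_def using that by (intro spanI_base) (auto simp: T0_def)
  have TI: "left_closed T g"
    if "\<And>f k e. f \<in> words (range F) \<Longrightarrow> k \<in> words Kgens \<Longrightarrow> e \<in> words (range E) \<Longrightarrow> g * (f * k * e) \<in> T" for g
    unfolding left_closed_def T_def
    using spanI_mult_left[of _ T0 g T0] that unfolding T_def T0_def by blast
  have F: "left_closed T (F j)" for j
  proof (rule TI)
    fix f k e assume "f \<in> words (range F)" "k \<in> words Kgens" "e \<in> words (range E)"
    then show "F j * (f * k * e) \<in> T"
      using T0I[OF words_Cons[of "F j"]] by (simp add: mult.assoc)
  qed
  have K: "left_closed T g" if g: "g \<in> Kgens" for g
  proof (rule TI)
    fix f k e assume fke: "f \<in> words (range F)" "k \<in> words Kgens" "e \<in> words (range E)"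
    have "\<exists>c. q_comm c g y" if "y \<in> range F" for y
      using g that KF q_comm_inverse[OF KK' K'K] by blast
    then obtain c where c: "q_comm c g f" using q_comm_words[OF _ fke(1)] by blast
    have "g * (f * k * e) = (g * f) * (k * e)" by (simp add: mult.assoc)
    also have "\<dots> \<approx> (c *s (f * g)) * (k * e)"
      using c unfolding q_comm_def by (intro cong_mult) auto
    also have "\<dots> = c *s (f * (g * k) * e)" by (simp add: scale_assoc mult.assoc)
    finally show "g * (f * k * e) \<in> T"
      using T0I[OF fke(1) words_Cons[OF g fke(2)] fke(3)] spanI_cong spanI_closed(5)
      unfolding T_def by blast
  qed
  have E: "left_closed T (E i)" for i
  proof (rule TI)
    fix f k e assume fke: "f \<in> words (range F)" "k \<in> words Kgens" "e \<in> words (range E)"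
    show "E i * (f * k * e) \<in> T" using fke(1)
    proof (induction rule: words_induct)
      case one
      have "\<exists>c. q_comm c (E i) y" if "y \<in> Kgens" for y
      proof -
        have "\<exists>c. c \<noteq> 0 \<and> q_comm c y (E i)"
          using that KE q_comm_inverse[OF KK' K'K] nonzero_imp_inverse_nonzero by blast
        then show ?thesis using q_comm_sym by blast
      qed
      then obtain c where c: "q_comm c (E i) k" using q_comm_words[OF _ fke(2)] by blast
      have "E i * (1 * k * e) = (E i * k) * e" by (simp add: mult.assoc)
      also have "\<dots> \<approx> (c *s (k * E i)) * e"
        using c unfolding q_comm_def by (intro cong_mult) auto
      also have "\<dots> = c *s (1 * k * (E i * e))" by (simp add: scale_assoc mult.assoc)
      finally show ?case
        using T0I[OF one_in_words fke(2) words_Cons[OF _ fke(3), of "E i"]] spanI_cong spanI_closed(5)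
        unfolding T_def by blast
    next
      case (Cons g f)
      then obtain j where g: "g = F j" by blast
      define X where "X = f * k * e"
      have X: "X \<in> T" unfolding X_def using Cons fke by (intro T0I)
      obtain c a b where kl: "a \<in> set ks" "b \<in> set ks"
        and c: "E i * F j - F j * E i \<approx> c *s (K a * K' b - K' a * K b)"
        using EF by blast
      have "K a * (K' b * X) \<in> T" "K' a * (K b * X) \<in> T"
        using K X kl unfolding left_closed_def by auto
      then have 1: "c *s (K a * (K' b * X) - K' a * (K b * X)) \<in> T"
        unfolding T_def by (intro spanI_closed(4,5))
      have 2: "F j * (E i * X) \<in> T"
        using F Cons.IH unfolding X_def left_closed_def by blast
      have "E i * (g * f * k * e) = F j * (E i * X) + (E i * F j - F j * E i) * X"
        by (simp add: g X_def algebra_simps)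
      also have "\<dots> \<approx> F j * (E i * X) + (c *s (K a * K' b - K' a * K b)) * X"
        using c by (intro cong_add cong_mult) auto
      also have "\<dots> = F j * (E i * X) + c *s (K a * (K' b * X) - K' a * (K b * X))"
        by (simp add: algebra_simps scale_assoc)
      finally show ?case
        using spanI_cong spanI_closed(3) 1 2 unfolding T_def by blast
    qed
  qed
  have "1 * 1 * 1 \<in> T" using one_in_words by (intro T0I)
  then have "w * 1 \<in> T"
    using E F K assms by (intro left_closed_words[where S = T]) auto
  moreover have "T0 \<subseteq> spanI (range pbw)"
    using triangular_products by (auto simp: T0_def)
  then have "T0 \<union> I \<subseteq> spanI (range pbw)" using spanI_closed(1) by auto
  then have "T \<subseteq> spanI (range pbw)"
    unfolding T_def spanI_def using span_minimal subspace_span by blast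
  ultimately show ?thesis by auto
qed

end

section \<open>Degenerate families and their combination\<close>

datatype 'r family = Family (fE: "nat \<Rightarrow> 'r") (fF: "nat \<Rightarrow> 'r") (fK: "nat \<Rightarrow> 'r") (fK': "nat \<Rightarrow> 'r")

text \<open>The coefficient of the i-th coordinate weight in the j-th simple root of
  \<open>gl\<close>; differences of consecutive rows give the Cartan matrix.\<close>

definition pairing :: "nat \<Rightarrow> nat \<Rightarrow> int" where
  "pairing i j = of_bool (i = j) - of_bool (i = Suc j)"

lemma pairing_cartan: "pairing i j - pairing (Suc i) j = cartan i j"
  by (auto simp: pairing_def cartan_def)

lemma cartan_sym: "cartan i j = cartan j i"
  by (auto simp: cartan_def)

context qalg
begin

text \<open>The relations of \<open>braided\<close> as equations instead of congruences, which is
  the form they take for matrices.\<close>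

definition braided0 :: "(nat \<Rightarrow> 'r) \<Rightarrow> bool" where
  "braided0 x \<longleftrightarrow> (\<forall>i j. Suc i < j \<longrightarrow> x i * x j = x j * x i)
     \<and> (\<forall>i. serre (x i) (x (Suc i)) = 0 \<and> serre (x (Suc i)) (x i) = 0)"

definition Kalpha :: "'r family \<Rightarrow> nat \<Rightarrow> 'r" where
  "Kalpha X i = fK X i * fK' X (Suc i)"

definition Kalpha_inv :: "'r family \<Rightarrow> nat \<Rightarrow> 'r" where
  "Kalpha_inv X i = fK' X i * fK X (Suc i)"

text \<open>With \<open>a = b = 1 / (q - 1 / q)\<close> these are the relations of the quantum algebra.  Other values
  of \<open>a\<close> and \<open>b\<close> give degenerations of it, which are easier to represent.\<close>

definition qfamily :: "(nat \<Rightarrow> 'k) \<Rightarrow> (nat \<Rightarrow> 'k) \<Rightarrow> 'r family \<Rightarrow> bool" where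
  "qfamily a b X \<longleftrightarrow>
     (\<forall>i j. fK X i * fK X j = fK X j * fK X i) \<and>
     (\<forall>i. fK X i * fK' X i = 1 \<and> fK' X i * fK X i = 1) \<and>
     (\<forall>i j. fK X i * fE X j = (q powi pairing i j) *s (fE X j * fK X i)) \<and>
     (\<forall>i j. fK X i * fF X j = (q powi - pairing i j) *s (fF X j * fK X i)) \<and>
     (\<forall>i j. fE X i * fF X j - fF X j * fE X i =
        (if i = j then a i *s Kalpha X i - b i *s Kalpha_inv X i else 0)) \<and>
     braided0 (fE X) \<and> braided0 (fF X)"

lemma inverse_commute:
  assumes "k * k' = 1" "k' * k = 1" "k * y = c *s (y * k)" "c \<noteq> 0"
  shows "k' * y = inverse c *s (y * k')"
proof -
  have "k * (k' * y) = k * (inverse c *s (y * k'))"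
    using assms by (simp add: scale_assoc flip: mult.assoc)
      (simp add: assms(1) mult.assoc scale_assoc)
  then have "k' * k * (k' * y) = k' * k * (inverse c *s (y * k'))" by (simp only: mult.assoc)
  then show ?thesis by (simp add: assms)
qed

lemma qpow_simps: "q powi (a + b) = q powi a * q powi b" "q powi - a = inverse (q powi a)"
  "q powi a \<noteq> 0" "q powi (a - b) = q powi a * inverse (q powi b)"
  using q_nz by (auto simp: power_int_add power_int_minus power_int_diff field_simps)

lemma qfamilyD:
  assumes "qfamily a b X"
  shows "fK X i * fK X j = fK X j * fK X i" "fK X i * fK' X i = 1" "fK' X i * fK X i = 1"
    "fK X i * fE X j = (q powi pairing i j) *s (fE X j * fK X i)"
    "fK X i * fF X j = (q powi - pairing i j) *s (fF X j * fK X i)"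
    "fE X i * fF X j - fF X j * fE X i = (if i = j then a i *s Kalpha X i - b i *s Kalpha_inv X i else 0)"
    "braided0 (fE X)" "braided0 (fF X)"
    "fK' X i * fE X j = (q powi - pairing i j) *s (fE X j * fK' X i)"
    "fK' X i * fF X j = (q powi pairing i j) *s (fF X j * fK' X i)"
    "fK' X i * fK X j = fK X j * fK' X i" "fK' X i * fK' X j = fK' X j * fK' X i"
proof -
  show 1: "fK X i * fK X j = fK X j * fK X i" "fK X i * fK' X i = 1" "fK' X i * fK X i = 1"
    "fK X i * fE X j = (q powi pairing i j) *s (fE X j * fK X i)"
    "fK X i * fF X j = (q powi - pairing i j) *s (fF X j * fK X i)"
    "fE X i * fF X j - fF X j * fE X i = (if i = j then a i *s Kalpha X i - b i *s Kalpha_inv X i else 0)"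
    "braided0 (fE X)" "braided0 (fF X)" for i j
    using assms unfolding qfamily_def by blast+
  show "fK' X i * fE X j = (q powi - pairing i j) *s (fE X j * fK' X i)"
    using inverse_commute[OF 1(2)[of i] 1(3)[of i] 1(4)[of i j] qpow_simps(3)] by (simp add: qpow_simps(2))
  show "fK' X i * fF X j = (q powi pairing i j) *s (fF X j * fK' X i)"
    using inverse_commute[OF 1(2)[of i] 1(3)[of i] 1(5)[of i j] qpow_simps(3)] by (simp add: qpow_simps(2))
  show 2: "fK' X i * fK X j = fK X j * fK' X i" for i j
    using inverse_commute[OF 1(2,3), of i "fK X j" 1] 1(1) by simp
  show "fK' X i * fK' X j = fK' X j * fK' X i"
    using inverse_commute[OF 1(2,3), of i "fK' X j" 1] 2[of j i] by simp
qed

lemma qcomm_mult_left: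
  assumes "x * z = c *s (z * x)" "y * z = d *s (z * y)"
  shows "(x * y) * z = (c * d) *s (z * (x * y))"
  by (metis assms mult.assoc mult.commute scale_mult_left scale_mult_right scale_scale)

lemma Kalpha_commute:
  assumes "qfamily a b X"
  shows "Kalpha X i * fE X j = (q powi cartan i j) *s (fE X j * Kalpha X i)"
    "Kalpha X i * fF X j = (q powi - cartan i j) *s (fF X j * Kalpha X i)"
    "Kalpha_inv X i * fE X j = (q powi - cartan i j) *s (fE X j * Kalpha_inv X i)"
    "Kalpha_inv X i * fF X j = (q powi cartan i j) *s (fF X j * Kalpha_inv X i)"
proof -
  note D = qfamilyD[OF assms]
  show "Kalpha X i * fE X j = (q powi cartan i j) *s (fE X j * Kalpha X i)"
    unfolding Kalpha_def qcomm_mult_left[OF D(4,9)]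
    by (simp add: pairing_cartan[symmetric] qpow_simps)
  show "Kalpha X i * fF X j = (q powi - cartan i j) *s (fF X j * Kalpha X i)"
    unfolding Kalpha_def qcomm_mult_left[OF D(5,10)]
    by (simp add: pairing_cartan[symmetric] qpow_simps)
  show "Kalpha_inv X i * fE X j = (q powi - cartan i j) *s (fE X j * Kalpha_inv X i)"
    unfolding Kalpha_inv_def qcomm_mult_left[OF D(9,4)]
    by (simp add: pairing_cartan[symmetric] qpow_simps)
  show "Kalpha_inv X i * fF X j = (q powi cartan i j) *s (fF X j * Kalpha_inv X i)"
    unfolding Kalpha_inv_def qcomm_mult_left[OF D(10,5)]
    by (simp add: pairing_cartan[symmetric] qpow_simps)
qed

lemma commute_mult: "x * z = z * x \<Longrightarrow> y * z = z * y \<Longrightarrow> (x * y) * z = z * (x * (y :: 'r))"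
  by (metis mult.assoc)

lemma k_commute:
  assumes "qfamily a b X"
  shows "Kalpha X i * Kalpha X j = Kalpha X j * Kalpha X i" "Kalpha_inv X i * Kalpha_inv X j = Kalpha_inv X j * Kalpha_inv X i"
  unfolding Kalpha_def Kalpha_inv_def
  by (intro commute_mult commute_mult[symmetric] qfamilyD(1,11,12)[OF assms]
      qfamilyD(11)[OF assms, symmetric])+

section \<open>Commuting families and their coproduct\<close>

definition gens_of :: "'r family \<Rightarrow> 'r set" where
  "gens_of X = range (fE X) \<union> range (fF X) \<union> range (fK X) \<union> range (fK' X)"

definition commuting :: "'r family \<Rightarrow> 'r family \<Rightarrow> bool" where
  "commuting X Y \<longleftrightarrow> (\<forall>x\<in>gens_of X. \<forall>y\<in>gens_of Y. x * y = y * x)"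

lemma commuting_sym: "commuting X Y \<Longrightarrow> commuting Y X"
  unfolding commuting_def by metis

text \<open>The coproduct sending E to E x 1 + Kalpha x E and F to 1 x F + F x Kalpha^-1, where two
  commuting families of one ring play the tensor factors.\<close>

definition combine :: "'r family \<Rightarrow> 'r family \<Rightarrow> 'r family" where
  "combine X Y = Family (\<lambda>i. fE X i + Kalpha X i * fE Y i) (\<lambda>i. fF Y i + fF X i * Kalpha_inv Y i)
     (\<lambda>i. fK X i * fK Y i) (\<lambda>i. fK' X i * fK' Y i)"

lemma combine_simps [simp]:
  "fE (combine X Y) i = fE X i + Kalpha X i * fE Y i"
  "fF (combine X Y) i = fF Y i + fF X i * Kalpha_inv Y i"
  "fK (combine X Y) i = fK X i * fK Y i"
  "fK' (combine X Y) i = fK' X i * fK' Y i"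
  by (simp_all add: combine_def)

lemma commuting_combine:
  assumes "commuting X Z" "commuting Y Z"
  shows "commuting (combine X Y) Z"
proof -
  have "x * z = z * x" if "x \<in> gens_of (combine X Y)" "z \<in> gens_of Z" for x z
  proof -
    have "x * z = z * x" if "x \<in> gens_of X \<union> gens_of Y" for x
      using that \<open>z \<in> gens_of Z\<close> assms unfolding commuting_def by blast
    then have c: "fE X i * z = z * fE X i" "fE Y i * z = z * fE Y i" "fF X i * z = z * fF X i"
      "fF Y i * z = z * fF Y i" "fK X i * z = z * fK X i" "fK Y i * z = z * fK Y i"
      "fK' X i * z = z * fK' X i" "fK' Y i * z = z * fK' Y i" for i
      by (auto simp: gens_of_def)
    then have "Kalpha X i * z = z * Kalpha X i" "Kalpha_inv Y i * z = z * Kalpha_inv Y i" for i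
      by (auto simp: Kalpha_def Kalpha_inv_def intro!: commute_mult)
    with c have "fE (combine X Y) i * z = z * fE (combine X Y) i" "fF (combine X Y) i * z = z * fF (combine X Y) i"
      "fK (combine X Y) i * z = z * fK (combine X Y) i" "fK' (combine X Y) i * z = z * fK' (combine X Y) i" for i
      by (auto simp: distrib_left distrib_right commute_mult)
    then show ?thesis using that(1) by (auto simp: gens_of_def)
  qed
  then show ?thesis by (auto simp: commuting_def)
qed

lemma commuting_comb': "commuting Z X \<Longrightarrow> commuting Z Y \<Longrightarrow> commuting Z (combine X Y)"
  using commuting_combine commuting_sym by blast

text \<open>The powers of q with exponent - cartan are the scalars q^-2, q and 1 that
  \<open>serre_add\<close> and commutation of distant nodes ask for.\<close>

lemma braided0_add:
  assumes A: "braided0 A" and B: "braided0 B"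
    and AB: "\<And>i j. A i * B j = (q powi - cartan i j) *s (B j * A i)"
  shows "braided0 (\<lambda>i. A i + B i)"
proof -
  have far: "(A i + B i) * (A j + B j) = (A j + B j) * (A i + B i)" if "Suc i < j" for i j
  proof -
    have "A i * A j = A j * A i" "B i * B j = B j * B i"
      using that A B unfolding braided0_def by blast+
    then show ?thesis
      using that AB[of i j] AB[of j i] by (simp add: cartan_def distrib_left distrib_right)
  qed
  have d: "q powi - cartan i i = inverse q * inverse q"
    and o: "q powi - cartan i (Suc i) = q" "q powi - cartan (Suc i) i = q" for i
    by (simp_all add: cartan_def power_int_minus power2_eq_square)
  have "serre (A i + B i) (A (Suc i) + B (Suc i)) = 0" for i
    by (rule serre_add) (use A B AB in \<open>auto simp: braided0_def d o\<close>)
  moreover have "serre (A (Suc i) + B (Suc i)) (A i + B i) = 0" for i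
    by (rule serre_add) (use A B AB in \<open>auto simp: braided0_def d o\<close>)
  ultimately show ?thesis using far by (auto simp: braided0_def)
qed

lemma braided0_twist:
  assumes x: "braided0 x" and gg: "\<And>i j. g i * g j = g j * g i" and gx: "\<And>i j. g i * x j = x j * g i"
  shows "braided0 (\<lambda>i. g i * x i)"
proof -
  have gx': "x j * (g i * y) = g i * (x j * y)" for i j y by (metis gx mult.assoc)
  have gg': "g i * (g j * y) = g j * (g i * y)" for i j y by (metis gg mult.assoc)
  have "serre (g i * x i) (g j * x j) = g i * (g i * (g j * serre (x i) (x j)))" for i j
    unfolding serre_def
    by (simp add: mult.assoc gx' gg' gg[of j i] gg'[of j i] scale_assoc distrib_left right_diff_distrib)
  moreover have "g i * x i * (g j * x j) = g j * x j * (g i * x i)" if "x i * x j = x j * x i" for i j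
    using that by (simp add: mult.assoc gx' gg'[of i j])
  ultimately show ?thesis using x unfolding braided0_def by (metis mult_zero_right)
qed

context
  fixes X Y :: "'r family" and a b c :: "nat \<Rightarrow> 'k"
  assumes X: "qfamily c b X" and Y: "qfamily a c Y" and XY: "commuting X Y"
begin

lemma XY_commute: "x \<in> gens_of X \<Longrightarrow> y \<in> gens_of Y \<Longrightarrow> x * y = y * x"
  using XY by (auto simp: commuting_def)

lemma XY_commutes:
  "fE X i * fE Y j = fE Y j * fE X i" "fE X i * fF Y j = fF Y j * fE X i"
  "fE X i * fK Y j = fK Y j * fE X i" "fE X i * fK' Y j = fK' Y j * fE X i"
  "fF X i * fE Y j = fE Y j * fF X i" "fF X i * fF Y j = fF Y j * fF X i"
  "fF X i * fK Y j = fK Y j * fF X i" "fF X i * fK' Y j = fK' Y j * fF X i"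
  "fK X i * fE Y j = fE Y j * fK X i" "fK X i * fF Y j = fF Y j * fK X i"
  "fK X i * fK Y j = fK Y j * fK X i" "fK X i * fK' Y j = fK' Y j * fK X i"
  "fK' X i * fE Y j = fE Y j * fK' X i" "fK' X i * fF Y j = fF Y j * fK' X i"
  "fK' X i * fK Y j = fK Y j * fK' X i" "fK' X i * fK' Y j = fK' Y j * fK' X i"
  by (rule XY_commute; simp add: gens_of_def)+

lemma XY_Kalpha:
  "Kalpha X i * fE Y j = fE Y j * Kalpha X i" "Kalpha X i * fF Y j = fF Y j * Kalpha X i"
  "Kalpha X i * fK Y j = fK Y j * Kalpha X i" "Kalpha X i * fK' Y j = fK' Y j * Kalpha X i"
  "fE X i * Kalpha_inv Y j = Kalpha_inv Y j * fE X i" "fF X i * Kalpha_inv Y j = Kalpha_inv Y j * fF X i"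
  "fK X i * Kalpha_inv Y j = Kalpha_inv Y j * fK X i" "fK' X i * Kalpha_inv Y j = Kalpha_inv Y j * fK' X i"
  unfolding Kalpha_def Kalpha_inv_def
  by (intro commute_mult commute_mult[symmetric] XY_commutes XY_commutes[symmetric])+

lemma XY_Kalpha_Kalpha_inv: "Kalpha X i * Kalpha_inv Y j = Kalpha_inv Y j * Kalpha X i"
  unfolding Kalpha_def by (intro commute_mult XY_Kalpha)

lemma combine_E_cross:
  "fE X i * (Kalpha X j * fE Y j) = (q powi - cartan i j) *s (Kalpha X j * fE Y j * fE X i)"
proof -
  have 1: "fE X i * Kalpha X j = (q powi - cartan i j) *s (Kalpha X j * fE X i)"
    unfolding Kalpha_commute(1)[OF X] by (simp add: cartan_sym[of j i] qpow_simps q_nz)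
  show ?thesis unfolding qcomm_assoc[OF 1] by (simp add: mult.assoc XY_commutes)
qed

lemma combine_F_cross:
  "fF Y i * (fF X j * Kalpha_inv Y j) = (q powi - cartan i j) *s (fF X j * Kalpha_inv Y j * fF Y i)"
proof -
  have 1: "fF Y i * Kalpha_inv Y j = (q powi - cartan i j) *s (Kalpha_inv Y j * fF Y i)"
    unfolding Kalpha_commute(4)[OF Y] by (simp add: cartan_sym[of j i] qpow_simps q_nz)
  have "fF Y i * (fF X j * Kalpha_inv Y j) = fF X j * (fF Y i * Kalpha_inv Y j)"
    by (metis XY_commutes(6) mult.assoc)
  then show ?thesis by (simp add: 1 scale_assoc mult.assoc)
qed

text \<open>In the mixed terms the powers of q from the two torus factors are inverse to each other
  and cancel. In the others the inner parameter \<open>c\<close> occurs once with each sign in front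
  of \<open>Kalpha X i * Kalpha_inv Y i\<close>; this is why types compose.\<close>

lemma combine_EF:
  "fE (combine X Y) i * fF (combine X Y) j - fF (combine X Y) j * fE (combine X Y) i =
     (if i = j then a i *s Kalpha (combine X Y) i - b i *s Kalpha_inv (combine X Y) i else 0)"
proof -
  have kk: "Kalpha (combine X Y) i = Kalpha X i * Kalpha Y i" "Kalpha_inv (combine X Y) i = Kalpha_inv X i * Kalpha_inv Y i"
    unfolding Kalpha_def Kalpha_inv_def combine_simps by (metis XY_commutes(15,12) mult.assoc)+
  have 1: "fE X i * (fF X j * Kalpha_inv Y j) - fF X j * Kalpha_inv Y j * fE X i
      = (fE X i * fF X j - fF X j * fE X i) * Kalpha_inv Y j"
    by (metis XY_Kalpha(5) mult.assoc left_diff_distrib)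
  have 2: "Kalpha X i * fE Y i * fF Y j - fF Y j * (Kalpha X i * fE Y i)
      = Kalpha X i * (fE Y i * fF Y j - fF Y j * fE Y i)"
    by (metis XY_Kalpha(2) mult.assoc right_diff_distrib)
  have 3: "Kalpha X i * fE Y i * (fF X j * Kalpha_inv Y j) = fF X j * Kalpha_inv Y j * (Kalpha X i * fE Y i)"
  proof -
    have e: "fE Y i * Kalpha_inv Y j = (q powi cartan i j) *s (Kalpha_inv Y j * fE Y i)"
      unfolding Kalpha_commute(3)[OF Y] by (simp add: cartan_sym[of j i] qpow_simps q_nz)
    have "Kalpha X i * fE Y i * (fF X j * Kalpha_inv Y j) = Kalpha X i * fF X j * (fE Y i * Kalpha_inv Y j)"
      by (metis XY_commutes(5) mult.assoc)
    also have "\<dots> = (fF X j * Kalpha X i) * (Kalpha_inv Y j * fE Y i)"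
      unfolding Kalpha_commute(2)[OF X] e by (simp add: scale_assoc qpow_simps q_nz)
    also have "\<dots> = fF X j * Kalpha_inv Y j * (Kalpha X i * fE Y i)"
      by (metis XY_Kalpha_Kalpha_inv mult.assoc)
    finally show ?thesis .
  qed
  have "fE (combine X Y) i * fF (combine X Y) j - fF (combine X Y) j * fE (combine X Y) i
    = (fE X i * (fF X j * Kalpha_inv Y j) - fF X j * Kalpha_inv Y j * fE X i)
     + (Kalpha X i * fE Y i * fF Y j - fF Y j * (Kalpha X i * fE Y i))
     + (Kalpha X i * fE Y i * (fF X j * Kalpha_inv Y j) - fF X j * Kalpha_inv Y j * (Kalpha X i * fE Y i))
     + (fE X i * fF Y j - fF Y j * fE X i)"
    by (simp add: algebra_simps)
  also have "\<dots> = (fE X i * fF X j - fF X j * fE X i) * Kalpha_inv Y j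
     + Kalpha X i * (fE Y i * fF Y j - fF Y j * fE Y i)"
    unfolding 1 2 3 by (simp add: XY_commutes)
  also have "\<dots> = (if i = j then a i *s Kalpha (combine X Y) i - b i *s Kalpha_inv (combine X Y) i else 0)"
    unfolding qfamilyD(6)[OF X] qfamilyD(6)[OF Y] kk
    by (simp add: algebra_simps scale_assoc)
  finally show ?thesis .
qed

lemma qfamily_combine: "qfamily a b (combine X Y)"
  unfolding qfamily_def
proof (intro conjI allI)
  note DX = qfamilyD[OF X] and DY = qfamilyD[OF Y]
  show "fK (combine X Y) i * fK (combine X Y) j = fK (combine X Y) j * fK (combine X Y) i" for i j
    unfolding combine_simps
    by (intro commute_mult commute_mult[symmetric] DX(1) DY(1) XY_commutes XY_commutes[symmetric])
  show "fK (combine X Y) i * fK' (combine X Y) i = 1" for i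
    by (metis DX(2) DY(2) XY_commutes(15) combine_simps(3,4) mult.assoc mult_1)
  show "fK' (combine X Y) i * fK (combine X Y) i = 1" for i
    by (metis DX(3) DY(3) XY_commutes(12) combine_simps(3,4) mult.assoc mult_1)
  show "fK (combine X Y) i * fE (combine X Y) j = (q powi pairing i j) *s (fE (combine X Y) j * fK (combine X Y) i)" for i j
  proof -
    have 1: "fK X i * fK Y i * fE X j = (q powi pairing i j * 1) *s (fE X j * (fK X i * fK Y i))"
      by (rule qcomm_mult_left) (simp_all add: DX XY_commutes)
    have "fK X i * Kalpha X j = Kalpha X j * fK X i"
      unfolding Kalpha_def by (intro commute_mult[symmetric] DX(1,11))
    then have 2: "fK X i * fK Y i * Kalpha X j = 1 *s (Kalpha X j * (fK X i * fK Y i))"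
      by (simp add: commute_mult XY_Kalpha)
    have 3: "fK X i * fK Y i * fE Y j = (1 * q powi pairing i j) *s (fE Y j * (fK X i * fK Y i))"
      by (rule qcomm_mult_left) (simp_all add: DY XY_commutes)
    show ?thesis
      using 1 qcomm_assoc[OF 2, of "fE Y j"] 3
      by (simp add: distrib_left distrib_right scale_assoc scale_right_distrib mult.assoc)
  qed
  show "fK (combine X Y) i * fF (combine X Y) j = (q powi - pairing i j) *s (fF (combine X Y) j * fK (combine X Y) i)" for i j
  proof -
    have 1: "fK X i * fK Y i * fF X j = (q powi - pairing i j * 1) *s (fF X j * (fK X i * fK Y i))"
      by (rule qcomm_mult_left) (simp_all add: DX XY_commutes)
    have "fK Y i * Kalpha_inv Y j = Kalpha_inv Y j * fK Y i"
      unfolding Kalpha_inv_def by (intro commute_mult[symmetric] DY(1,11))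
    then have 2: "fK X i * fK Y i * Kalpha_inv Y j = 1 *s (Kalpha_inv Y j * (fK X i * fK Y i))"
      by (simp add: commute_mult XY_Kalpha)
    have 3: "fK X i * fK Y i * fF Y j = (1 * q powi - pairing i j) *s (fF Y j * (fK X i * fK Y i))"
      by (rule qcomm_mult_left) (simp_all add: DY XY_commutes)
    show ?thesis
      using qcomm_assoc[OF 1, of "Kalpha_inv Y j"] 2 3
      by (simp add: distrib_left distrib_right scale_assoc scale_right_distrib mult.assoc)
  qed
  show "fE (combine X Y) i * fF (combine X Y) j - fF (combine X Y) j * fE (combine X Y) i =
     (if i = j then a i *s Kalpha (combine X Y) i - b i *s Kalpha_inv (combine X Y) i else 0)" for i j
    by (rule combine_EF)
  show "braided0 (fE (combine X Y))"
    using braided0_add[OF DX(7) braided0_twist[OF DY(7) k_commute(1)[OF X] XY_Kalpha(1)] combine_E_cross]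
    by (simp add: combine_def)
  have "braided0 (\<lambda>i. Kalpha_inv Y i * fF X i)"
    by (rule braided0_twist[OF DX(8)]) (simp_all add: k_commute(2)[OF Y] XY_Kalpha(6))
  then have "braided0 (\<lambda>i. fF X i * Kalpha_inv Y i)" by (simp add: XY_Kalpha(6))
  from braided0_add[OF DY(8) this combine_F_cross] show "braided0 (fF (combine X Y))"
    by (simp add: combine_def)
qed

end

end

section \<open>Matrix representations\<close>

locale linear_extension = vector_space scale
  for scale :: "'a::field \<Rightarrow> 'b::ab_group_add \<Rightarrow> 'b" (infixr "*s" 75)
begin

definition lext :: "('x \<Rightarrow> 'b) \<Rightarrow> ('x \<Rightarrow>\<^sub>0 'a) \<Rightarrow> 'b" where
  "lext f p = (\<Sum>k\<in>Poly_Mapping.keys p. Poly_Mapping.lookup p k *s f k)"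

lemma lext_superset:
  fixes p :: "'x \<Rightarrow>\<^sub>0 'a" and f :: "'x \<Rightarrow> 'b"
  assumes "finite S" "Poly_Mapping.keys p \<subseteq> S"
  shows "lext f p = (\<Sum>k\<in>S. Poly_Mapping.lookup p k *s f k)"
  unfolding lext_def using assms
  by (intro sum.mono_neutral_left) (auto simp: in_keys_iff)

lemma lext_0 [simp]: "lext f 0 = 0"
  by (simp add: lext_def)

lemma lext_single [simp]: "lext f (Poly_Mapping.single k c) = c *s f k"
  by (subst lext_superset[where S = "{k}"]) auto

lemma lext_add: "lext f (p + p') = lext f p + lext f p'"
proof -
  let ?S = "Poly_Mapping.keys p \<union> Poly_Mapping.keys p'"
  have "lext f (p + p') = (\<Sum>k\<in>?S. Poly_Mapping.lookup (p + p') k *s f k)"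
    by (rule lext_superset) (simp_all add: Poly_Mapping.keys_add)
  also have "\<dots> = lext f p + lext f p'"
    unfolding lookup_add scale_left_distrib sum.distrib
    by (simp add: lext_superset[where S = ?S])
  finally show ?thesis .
qed

lemma lext_uminus: "lext f (- p) = - lext f p"
  unfolding lext_def by (simp add: keys_minus sum_negf)

lemma lext_diff: "lext f (p - p') = lext f p - lext f p'"
  using lext_add[of f p "- p'"] by (simp add: lext_uminus)

lemma lext_sum: "lext f (\<Sum>i\<in>A. g i) = (\<Sum>i\<in>A. lext f (g i))"
  by (induction A rule: infinite_finite_induct) (auto simp: lext_add)

lemma lext_fun_add: "lext (\<lambda>k. f k + g k) p = lext f p + lext g p"
  by (simp add: lext_def scale_right_distrib sum.distrib)

end

section \<open>Vectors and matrices with finitely supported columns\<close>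

definition vscale :: "'k::field \<Rightarrow> ('b \<Rightarrow>\<^sub>0 'k) \<Rightarrow> ('b \<Rightarrow>\<^sub>0 'k)" where
  "vscale c p = Poly_Mapping.map ((*) c) p"

lemma lookup_vscale [simp]: "Poly_Mapping.lookup (vscale c p) k = c * Poly_Mapping.lookup p k"
  by (simp add: vscale_def map.rep_eq when_def)

lemma vscale_single [simp]: "vscale c (Poly_Mapping.single k d) = Poly_Mapping.single k (c * d)"
  by (rule poly_mapping_eqI) (simp add: lookup_single when_def)

global_interpretation vscale: linear_extension vscale
  by unfold_locales (auto intro!: poly_mapping_eqI simp: lookup_add algebra_simps)

lemma keys_vscale: "Poly_Mapping.keys (vscale c p) \<subseteq> Poly_Mapping.keys p"
  by (auto simp: in_keys_iff)

lemma lext_vscale: "vscale.lext f (vscale c p) = vscale c (vscale.lext f p)"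
  by (subst vscale.lext_superset[OF _ keys_vscale])
    (auto simp: vscale.lext_def vscale.scale_sum_right)

lemma lext_lext: "vscale.lext f (vscale.lext g p) = vscale.lext (\<lambda>b. vscale.lext f (g b)) p"
  by (simp add: vscale.lext_def[of g] vscale.lext_def[of "\<lambda>b. vscale.lext f (g b)"] vscale.lext_sum lext_vscale)

lemma lext_single_id: "vscale.lext (\<lambda>b. Poly_Mapping.single b 1) p = p"
  by (rule poly_mapping_eqI)
    (simp add: vscale.lext_def lookup_sum lookup_single when_def sum.delta in_keys_iff)

text \<open>Square matrices with finitely supported columns; \<open>col T b\<close> is the image of the basis
  vector \<open>b\<close>.\<close>

typedef (overloaded) ('b, 'k :: field) cmat = "UNIV :: ('b \<Rightarrow> 'b \<Rightarrow>\<^sub>0 'k) set"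
  morphisms col Cmat ..

lemma col_Cmat [simp]: "col (Cmat f) = f"
  by (simp add: Cmat_inverse)

lemma cmat_eqI: "(\<And>b. col S b = col T b) \<Longrightarrow> S = T"
  by (metis col_inject ext)

instantiation cmat :: (type, field) ring_1
begin

definition "0 = Cmat (\<lambda>b. 0)"
definition "1 = Cmat (\<lambda>b. Poly_Mapping.single b 1)"
definition "S + T = Cmat (\<lambda>b. col S b + col T b)"
definition "S - T = Cmat (\<lambda>b. col S b - col T b)"
definition "- T = Cmat (\<lambda>b. - col T b)"
definition "S * T = Cmat (\<lambda>b. vscale.lext (col S) (col T b))"

lemma col_simps [simp]:
  "col 0 b = 0" "col 1 b = Poly_Mapping.single b 1" "col (S + T) b = col S b + col T b"
  "col (S - T) b = col S b - col T b" "col (- T) b = - col T b"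
  "col (S * T) b = vscale.lext (col S) (col T b)"
  by (simp_all add: zero_cmat_def one_cmat_def plus_cmat_def minus_cmat_def uminus_cmat_def
      times_cmat_def)

instance
proof
  fix S T U :: "('a, 'b) cmat"
  show "S * T * U = S * (T * U)"
    by (rule cmat_eqI) (simp add: lext_lext times_cmat_def)
  show "(S + T) * U = S * U + T * U"
    by (rule cmat_eqI) (simp add: vscale.lext_fun_add[symmetric] plus_cmat_def)
  show "S * (T + U) = S * T + S * U"
    by (rule cmat_eqI) (simp add: vscale.lext_add)
  show "1 * S = S"
    by (rule cmat_eqI) (simp add: one_cmat_def lext_single_id)
  show "S * 1 = S"
    by (rule cmat_eqI) simp
  show "S + T + U = S + (T + U)" "S + T = T + S" "0 + S = S" "- S + S = 0" "S - T = S + - T"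
    by (rule cmat_eqI, simp add: algebra_simps)+
  have "col (0 :: ('a, 'b) cmat) undefined \<noteq> col 1 undefined"
    by (simp del: single_one) (metis lookup_single_eq lookup_zero zero_neq_one)
  then show "(0 :: ('a, 'b) cmat) \<noteq> 1" by metis
qed

end

definition mscale :: "'k::field \<Rightarrow> ('b, 'k) cmat \<Rightarrow> ('b, 'k) cmat" where
  "mscale c T = Cmat (\<lambda>b. vscale c (col T b))"

lemma col_mscale [simp]: "col (mscale c T) b = vscale c (col T b)"
  by (simp add: mscale_def)

locale qmat =
  fixes q :: "'k::field" and basis :: "'b::ab_group_add itself"
  assumes "q \<noteq> 0" "q * q \<noteq> 1" "1 + q * q \<noteq> 0"

sublocale qmat \<subseteq> qalg "mscale :: 'k \<Rightarrow> ('b, 'k) cmat \<Rightarrow> _" q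
proof
  show "mscale c S * T = mscale c (S * T)" for c and S T :: "('b, 'k) cmat"
    by (rule cmat_eqI)
      (simp add: mscale_def vscale.lext_def vscale.scale_sum_right mult.commute)
  show "S * mscale c T = mscale c (S * T)" for c and S T :: "('b, 'k) cmat"
    by (rule cmat_eqI) (simp add: lext_vscale)
qed (use qmat_axioms in \<open>auto simp: qmat_def vscale.scale_right_distrib vscale.scale_left_distrib intro!: cmat_eqI\<close>)

section \<open>Weighted shifts of a basis indexed by a group\<close>

definition shift_op :: "'b::ab_group_add \<Rightarrow> ('b \<Rightarrow> 'k::field) \<Rightarrow> ('b, 'k) cmat" where
  "shift_op s c = Cmat (\<lambda>b. Poly_Mapping.single (b + s) (c b))"

lemma col_mono [simp]: "col (shift_op s c) b = Poly_Mapping.single (b + s) (c b)"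
  by (simp add: shift_op_def)

lemma shift_op_mult: "shift_op s c * shift_op t d = shift_op (s + t) (\<lambda>b. c (b + t) * d b)"
  by (rule cmat_eqI) (simp add: ac_simps)

lemma shift_op_add: "shift_op s c + shift_op s d = shift_op s (\<lambda>b. c b + d b)"
  by (rule cmat_eqI) (simp add: single_add)

lemma shift_op_diff: "shift_op s c - shift_op s d = shift_op s (\<lambda>b. c b - d b)"
  by (rule cmat_eqI) (simp add: single_diff)

lemma mscale_shift_op: "mscale a (shift_op s c) = shift_op s (\<lambda>b. a * c b)"
  by (rule cmat_eqI) simp

lemma one_shift_op: "1 = shift_op 0 (\<lambda>_. 1)" and zero_shift_op: "0 = shift_op s (\<lambda>_. 0)"
  by (rule cmat_eqI; simp del: single_one)+

lemma shift_op_commute: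
  assumes "\<And>b. c (b + t) = c b" "\<And>b. d (b + s) = d b"
  shows "shift_op s c * shift_op t d = shift_op t d * shift_op s c"
  by (simp add: shift_op_mult assms add.commute mult.commute)

text \<open>A site \<open>(kind, label)\<close> owns one coordinate for each node.  Only the first component of a
  basis element, which holds the sites of kind 0 and 1, matters for leading terms of products of
  root vectors; the sign makes the lowering operators increase it.\<close>

type_synonym coords = "nat \<times> nat \<times> nat \<Rightarrow>\<^sub>0 int"
type_synonym idx = "coords \<times> coords"
type_synonym site = "nat \<times> nat"

text \<open>Kinds 0 and 1 are the copies that carry E and F, kind 2 is the torus, kinds 3 and 4 are
  the left and right chains. The sign of kind 1 occurs here and again in \<open>coord\<close>, so
  \<open>coord\<close> still counts units positively.\<close>

definition unit_vec :: "site \<Rightarrow> nat \<Rightarrow> idx" where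
  "unit_vec \<sigma> i = (let e = Poly_Mapping.single (fst \<sigma>, i, snd \<sigma>) (if fst \<sigma> = 1 then - 1 else 1) in if fst \<sigma> < 2 then (e, 0) else (0, e))"

definition coord :: "site \<Rightarrow> nat \<Rightarrow> idx \<Rightarrow> int" where
  "coord \<sigma> i b = (if fst \<sigma> = 1 then - 1 else 1) * Poly_Mapping.lookup (if fst \<sigma> < 2 then fst b else snd b) (fst \<sigma>, i, snd \<sigma>)"

text \<open>\<open>coord\<close> is a partial sum of occupation numbers; the consecutive difference
  recovers the occupation number of node j, the exponent of q by which K_j acts in an
  oscillator.\<close>

definition weight :: "site \<Rightarrow> nat \<Rightarrow> idx \<Rightarrow> int" where
  "weight \<sigma> j b = coord \<sigma> j b - (case j of 0 \<Rightarrow> 0 | Suc i \<Rightarrow> coord \<sigma> i b)"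

lemma coord_unit_vec: "coord \<sigma> i (unit_vec \<tau> j) = of_bool (\<sigma> = \<tau> \<and> i = j)"
  by (cases \<sigma>; cases \<tau>) (auto simp: coord_def unit_vec_def Let_def lookup_single when_def)

lemma coord_add: "coord \<sigma> i (b + b') = coord \<sigma> i b + coord \<sigma> i b'"
  and coord_diff: "coord \<sigma> i (b - b') = coord \<sigma> i b - coord \<sigma> i b'"
  and coord_uminus: "coord \<sigma> i (- b) = - coord \<sigma> i b"
  by (simp_all add: coord_def lookup_add lookup_minus)

lemma weight_add: "weight \<sigma> i (b + b') = weight \<sigma> i b + weight \<sigma> i b'"
  and weight_diff: "weight \<sigma> i (b - b') = weight \<sigma> i b - weight \<sigma> i b'"
  and weight_uminus: "weight \<sigma> i (- b) = - weight \<sigma> i b"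
  by (auto simp: weight_def coord_add coord_diff coord_uminus split: nat.split)

lemma weight_unit_vec: "weight \<sigma> i (unit_vec \<tau> j) = (if \<sigma> = \<tau> then pairing i j else 0)"
  by (auto simp: weight_def coord_unit_vec pairing_def split: nat.split)

section \<open>Oscillator representations with free parameters\<close>

locale qrep = qmat q "TYPE(idx)" for q :: "'k::field"
begin

text \<open>For u = v = 1 / (q - 1 / q) this is the quantum integer of w. Independent u and v give
  the degenerate oscillators and still satisfy the three-term recurrence with roots q and 1 /
  q.\<close>

definition qlin :: "'k \<Rightarrow> 'k \<Rightarrow> int \<Rightarrow> 'k" where
  "qlin u v w = u * q powi w - v * q powi - w"

lemma qlin_step: "qlin u v (1 + w) = (q + inverse q) * qlin u v w - qlin u v (w - 1)"
  by (simp add: qlin_def qpow_simps algebra_simps q_nz q_cancel)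

lemma qlin_step2: "qlin u v (2 + w) = (q + inverse q) * qlin u v (1 + w) - qlin u v w"
  using qlin_step[of u v "1 + w"] by (simp add: add.assoc[symmetric])

text \<open>The \<open>q\<close>-oscillator representation \<open>E\<^sub>i = x\<^sub>i x\<^sub>i\<^sub>+\<^sub>1\<^sup>-\<^sup>1 (u Q - v Q\<^sup>-\<^sup>1)\<close> with \<open>Q = q\<^sup>N\<close> for the number
  operator \<open>N\<close> of \<open>x\<^sub>i\<^sub>+\<^sub>1\<close>, in coordinates in which \<open>x\<^sub>i x\<^sub>i\<^sub>+\<^sub>1\<^sup>-\<^sup>1\<close> shifts only the coordinate \<open>i\<close>.\<close>

definition osc :: "site \<Rightarrow> (nat \<Rightarrow> 'k) \<Rightarrow> (nat \<Rightarrow> 'k) \<Rightarrow> (idx, 'k) cmat family" where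
  "osc \<sigma> u v = Family
     (\<lambda>i. shift_op (unit_vec \<sigma> i) (\<lambda>b. qlin (u (Suc i)) (v (Suc i)) (weight \<sigma> (Suc i) b)))
     (\<lambda>i. shift_op (- unit_vec \<sigma> i) (\<lambda>b. qlin (u i) (v i) (weight \<sigma> i b)))
     (\<lambda>j. shift_op 0 (\<lambda>b. q powi weight \<sigma> j b)) (\<lambda>j. shift_op 0 (\<lambda>b. q powi - weight \<sigma> j b))"

lemmas weight_simps = weight_add weight_diff weight_uminus weight_unit_vec pairing_def

text \<open>All terms of a Serre expression shift by the same vector, so only coefficients are
  compared. Once common factors are removed, the three-term recurrence of \<open>qlin\<close> is
  left.\<close>

lemma braided0_osc_E: "braided0 (fE (osc \<sigma> u v))"
  unfolding braided0_def
proof (intro conjI allI impI)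
  fix i j :: nat
  assume "Suc i < j"
  then show "fE (osc \<sigma> u v) i * fE (osc \<sigma> u v) j = fE (osc \<sigma> u v) j * fE (osc \<sigma> u v) i"
    unfolding osc_def family.sel by (intro shift_op_commute) (simp_all add: weight_simps)
next
  fix i
  show "serre (fE (osc \<sigma> u v) i) (fE (osc \<sigma> u v) (Suc i)) = 0"
    unfolding osc_def family.sel serre_def shift_op_mult mscale_shift_op zero_shift_op[of "unit_vec \<sigma> i + unit_vec \<sigma> i + unit_vec \<sigma> (Suc i)"]
    by (simp add: weight_simps shift_op_add shift_op_diff add_ac qlin_step algebra_simps)
  show "serre (fE (osc \<sigma> u v) (Suc i)) (fE (osc \<sigma> u v) i) = 0"
    unfolding osc_def family.sel serre_def shift_op_mult mscale_shift_op zero_shift_op[of "unit_vec \<sigma> (Suc i) + unit_vec \<sigma> (Suc i) + unit_vec \<sigma> i"]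
    by (simp add: weight_simps shift_op_add shift_op_diff add_ac qlin_step2 algebra_simps)
qed

lemma braided0_osc_F: "braided0 (fF (osc \<sigma> u v))"
  unfolding braided0_def
proof (intro conjI allI impI)
  fix i j :: nat
  assume "Suc i < j"
  then show "fF (osc \<sigma> u v) i * fF (osc \<sigma> u v) j = fF (osc \<sigma> u v) j * fF (osc \<sigma> u v) i"
    unfolding osc_def family.sel by (intro shift_op_commute) (simp_all add: weight_simps)
next
  fix i
  show "serre (fF (osc \<sigma> u v) i) (fF (osc \<sigma> u v) (Suc i)) = 0"
    unfolding osc_def family.sel serre_def shift_op_mult mscale_shift_op
      zero_shift_op[of "- unit_vec \<sigma> i + - unit_vec \<sigma> i + - unit_vec \<sigma> (Suc i)"]
    by (simp add: weight_simps shift_op_add shift_op_diff add_ac qlin_step2 algebra_simps)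
  show "serre (fF (osc \<sigma> u v) (Suc i)) (fF (osc \<sigma> u v) i) = 0"
    unfolding osc_def family.sel serre_def shift_op_mult mscale_shift_op
      zero_shift_op[of "- unit_vec \<sigma> (Suc i) + - unit_vec \<sigma> (Suc i) + - unit_vec \<sigma> i"]
    by (simp add: weight_simps shift_op_add shift_op_diff add_ac qlin_step algebra_simps)
qed

lemma qlin_commutator:
  "qlin u' v' (1 + w') * qlin u v w - qlin u v (1 + w) * qlin u' v' w'
    = (q - inverse q) * u * v' * q powi (w - w') - (q - inverse q) * u' * v * q powi (w' - w)"
  by (simp add: qlin_def qpow_simps algebra_simps q_nz q_cancel)

text \<open>The commutator of E_i and F_i is diagonal. In its products of \<open>qlin\<close> at two
  neighbouring weights, the terms in the sum of the weights cancel, and those in the difference are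
  \<open>Kalpha\<close> and its inverse; their coefficients are the two parameters.\<close>

lemma qfamily_osc:
  "qfamily (\<lambda>i. (q - inverse q) * u i * v (Suc i)) (\<lambda>i. (q - inverse q) * u (Suc i) * v i) (osc \<sigma> u v)"
  unfolding qfamily_def
proof (intro conjI allI)
  let ?X = "osc \<sigma> u v"
  fix i j
  show "fK ?X i * fK ?X j = fK ?X j * fK ?X i"
    unfolding osc_def family.sel by (intro shift_op_commute) auto
  show "fK ?X i * fK' ?X i = 1" "fK' ?X i * fK ?X i = 1"
    unfolding osc_def family.sel shift_op_mult one_shift_op by (simp_all add: qpow_simps q_nz)
  show "fK ?X i * fE ?X j = mscale (q powi pairing i j) (fE ?X j * fK ?X i)"
    unfolding osc_def family.sel shift_op_mult mscale_shift_op
    by (simp add: weight_add weight_unit_vec qpow_simps mult_ac)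
  show "fK ?X i * fF ?X j = mscale (q powi - pairing i j) (fF ?X j * fK ?X i)"
    unfolding osc_def family.sel shift_op_mult mscale_shift_op
    by (simp add: weight_diff weight_unit_vec qpow_simps mult_ac flip: diff_conv_add_uminus)
  show "fE ?X i * fF ?X j - fF ?X j * fE ?X i =
     (if i = j then mscale ((q - inverse q) * u i * v (Suc i)) (Kalpha ?X i)
        - mscale ((q - inverse q) * u (Suc i) * v i) (Kalpha_inv ?X i) else 0)"
  proof (cases "i = j")
    case True
    have "qlin (u (Suc i)) (v (Suc i)) (weight \<sigma> (Suc i) b + 1) * qlin (u i) (v i) (weight \<sigma> i b)
      - qlin (u i) (v i) (weight \<sigma> i b + 1) * qlin (u (Suc i)) (v (Suc i)) (weight \<sigma> (Suc i) b)
      = (q - inverse q) * u i * v (Suc i) * (q powi weight \<sigma> i b * q powi - weight \<sigma> (Suc i) b)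
      - (q - inverse q) * u (Suc i) * v i * (q powi - weight \<sigma> i b * q powi weight \<sigma> (Suc i) b)" for b
      using qlin_commutator[of "u (Suc i)" "v (Suc i)" "weight \<sigma> (Suc i) b" "u i" "v i" "weight \<sigma> i b"]
      by (simp add: qpow_simps ac_simps)
    then show ?thesis
      unfolding osc_def family.sel Kalpha_def Kalpha_inv_def shift_op_mult mscale_shift_op
      by (simp add: True weight_simps shift_op_diff)
  next
    case False
    then show ?thesis
      unfolding osc_def family.sel shift_op_mult
      by (auto simp: weight_simps shift_op_diff add_ac mult.commute zero_shift_op[of "unit_vec \<sigma> i - unit_vec \<sigma> j"])
  qed
qed (rule braided0_osc_E braided0_osc_F)+

definition noF :: "(idx, 'k) cmat family \<Rightarrow> (idx, 'k) cmat family" where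
  "noF X = Family (fE X) (\<lambda>_. 0) (fK X) (fK' X)"

definition noE :: "(idx, 'k) cmat family \<Rightarrow> (idx, 'k) cmat family" where
  "noE X = Family (\<lambda>_. 0) (fF X) (fK X) (fK' X)"

lemma braided0_zero: "braided0 (\<lambda>_. 0)"
  by (simp add: braided0_def serre_def)

lemma qfamily_noF: "qfamily (\<lambda>_. 0) (\<lambda>_. 0) X \<Longrightarrow> qfamily (\<lambda>_. 0) (\<lambda>_. 0) (noF X)"
  and qfamily_noE: "qfamily (\<lambda>_. 0) (\<lambda>_. 0) X \<Longrightarrow> qfamily (\<lambda>_. 0) (\<lambda>_. 0) (noE X)"
  by (simp_all add: qfamily_def noF_def noE_def braided0_zero)

definition triv :: "(idx, 'k) cmat family" where
  "triv = Family (\<lambda>_. 0) (\<lambda>_. 0) (\<lambda>_. 1) (\<lambda>_. 1)"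

text \<open>Makes the torus part of a monomial visible: K_j shifts a coordinate of its own. The site
  has kind 2 and so lies in the second component, where it does not disturb leading terms of root
  vectors.\<close>

definition kshift :: "(idx, 'k) cmat family" where
  "kshift = Family (\<lambda>_. 0) (\<lambda>_. 0) (\<lambda>j. shift_op (unit_vec (2, 0) j) (\<lambda>_. 1)) (\<lambda>j. shift_op (- unit_vec (2, 0) j) (\<lambda>_. 1))"

lemma qfamily_triv: "qfamily (\<lambda>_. 0) (\<lambda>_. 0) triv"
  by (simp add: qfamily_def triv_def braided0_zero)

lemma qfamily_kshift: "qfamily (\<lambda>_. 0) (\<lambda>_. 0) kshift"
  by (simp add: qfamily_def kshift_def braided0_zero shift_op_mult one_shift_op add.commute)

text \<open>Stands for acting on one tensor factor: the shift moves only coordinates of the site and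
  its coefficient depends only on these, so operators at different sites commute.\<close>

definition located :: "site \<Rightarrow> (idx, 'k) cmat \<Rightarrow> bool" where
  "located \<sigma> x \<longleftrightarrow> (\<exists>s c. x = shift_op s c \<and> (\<forall>\<tau> i. \<tau> \<noteq> \<sigma> \<longrightarrow> coord \<tau> i s = 0)
     \<and> (\<forall>b t. (\<forall>i. coord \<sigma> i t = 0) \<longrightarrow> c (b + t) = c b))"

lemma located_commute:
  assumes "located \<sigma> x" "located \<tau> y" "\<sigma> \<noteq> \<tau>"
  shows "x * y = y * x"
proof -
  obtain s c where x: "x = shift_op s c" "\<And>\<tau> i. \<tau> \<noteq> \<sigma> \<Longrightarrow> coord \<tau> i s = 0"
    "\<And>b t. (\<forall>i. coord \<sigma> i t = 0) \<Longrightarrow> c (b + t) = c b"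
    using assms(1) unfolding located_def by metis
  obtain t d where y: "y = shift_op t d" "\<And>\<sigma> i. \<sigma> \<noteq> \<tau> \<Longrightarrow> coord \<sigma> i t = 0"
    "\<And>b s. (\<forall>i. coord \<tau> i s = 0) \<Longrightarrow> d (b + s) = d b"
    using assms(2) unfolding located_def by metis
  show ?thesis unfolding x(1) y(1)
    by (rule shift_op_commute) (use x(2,3) y(2,3) assms(3) in auto)
qed

lemma located_0 [simp]: "located \<sigma> 0"
  unfolding located_def
  by (intro exI[of _ 0] exI[of _ "\<lambda>_. 0"]) (simp add: zero_shift_op[of 0] coord_def)

lemma located_shift_op:
  assumes "s \<in> {0, unit_vec \<sigma> i, - unit_vec \<sigma> i}"
  shows "located \<sigma> (shift_op s (\<lambda>b. f (weight \<sigma> j b)))"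
  unfolding located_def
proof (intro exI conjI allI impI)
  show "coord \<tau> k s = 0" if "\<tau> \<noteq> \<sigma>" for \<tau> k
    using assms that by (auto simp: coord_unit_vec coord_uminus) (simp add: coord_def)
  show "f (weight \<sigma> j (b + t)) = f (weight \<sigma> j b)" if "\<forall>i. coord \<sigma> i t = 0" for b t
  proof -
    have "weight \<sigma> j t = 0" using that by (auto simp: weight_def split: nat.split)
    then show ?thesis by (simp add: weight_add)
  qed
qed (rule refl)

lemma located_osc: "x \<in> gens_of (osc \<sigma> u v) \<Longrightarrow> located \<sigma> x"
  by (auto simp: gens_of_def osc_def intro!: located_shift_op)

lemma located_noF: "(\<And>x. x \<in> gens_of X \<Longrightarrow> located \<sigma> x) \<Longrightarrow> x \<in> gens_of (noF X) \<Longrightarrow> located \<sigma> x"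
  and located_noE: "(\<And>x. x \<in> gens_of X \<Longrightarrow> located \<sigma> x) \<Longrightarrow> x \<in> gens_of (noE X) \<Longrightarrow> located \<sigma> x"
  by (auto simp: gens_of_def noF_def noE_def)

lemma located_Ecopy: "x \<in> gens_of (noF (osc \<sigma> u v)) \<Longrightarrow> located \<sigma> x"
  and located_Fcopy: "x \<in> gens_of (noE (osc \<sigma> u v)) \<Longrightarrow> located \<sigma> x"
  using located_noF located_noE located_osc by blast+

lemma located_kshift: "x \<in> gens_of kshift \<Longrightarrow> located (2, 0) x"
  by (auto simp: gens_of_def kshift_def
      intro!: located_shift_op[where \<sigma> = "(2, 0)" and f = "\<lambda>_. 1"])

text \<open>Keeps track of the sites on which a combination acts, so that commutation of large
  combinations reduces to disjointness of site sets.\<close>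

inductive built :: "site set \<Rightarrow> (idx, 'k) cmat family \<Rightarrow> bool" where
  built_triv: "built {} triv"
| built_located: "(\<And>x. x \<in> gens_of X \<Longrightarrow> located \<sigma> x) \<Longrightarrow> built {\<sigma>} X"
| built_combine: "built S X \<Longrightarrow> built T Y \<Longrightarrow> built (S \<union> T) (combine X Y)"

lemma commuting_triv: "commuting triv X"
  by (auto simp: commuting_def gens_of_def triv_def)

lemma built_commuting: "built S X \<Longrightarrow> built T Y \<Longrightarrow> S \<inter> T = {} \<Longrightarrow> commuting X Y"
proof (induction rule: built.induct)
  case (built_located X \<sigma>)
  from built_located.prems built_located.hyps show ?case
  proof (induction rule: built.induct)
    case (built_located Y \<tau>)
    then show ?case unfolding commuting_def using located_commute[of \<sigma> _ \<tau>] by auto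
  qed (auto intro: commuting_comb' commuting_sym[OF commuting_triv])
qed (auto intro: commuting_combine commuting_triv)

text \<open>The parameters \<open>u\<^sub>i v\<^sub>i\<^sub>+\<^sub>1\<close> and \<open>u\<^sub>i\<^sub>+\<^sub>1 v\<^sub>i\<close> of an oscillator family can differ at one node, so chains of
  such families lead from the parameters of the quantum algebra to zero and back.  In between, where the
  parameters vanish, a family may lose its \<open>E\<close> or its \<open>F\<close> part; only these families contribute to leading
  terms of root vectors.\<close>

definition kappa :: "nat \<Rightarrow> nat \<Rightarrow> 'k" where
  "kappa k i = (if i < k then inverse (q - inverse q) else 0)"

text \<open>Chosen so that the factor q - 1 / q in the oscillator parameters turns it into the
  structure constant 1 / (q - 1 / q).\<close>

definition c0 :: 'k where
  "c0 = inverse (q - inverse q) * inverse (q - inverse q)"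

lemma q_diff_nz: "q - inverse q \<noteq> 0"
  using q2_neq_1 q_nz by (auto simp: field_simps)

lemma c0: "(q - inverse q) * c0 = inverse (q - inverse q)"
  using q_diff_nz by (simp add: c0_def flip: mult.assoc)

text \<open>For u constant and v the indicator of i \<le> k the two parameters are
  \<open>kappa k\<close> and \<open>kappa (Suc k)\<close>. They differ at node k only, so each
  factor switches on one more node.\<close>

primrec left_chain :: "nat \<Rightarrow> (idx, 'k) cmat family" where
  "left_chain 0 = triv"
| "left_chain (Suc k) = combine (osc (3, k) (\<lambda>_. c0) (\<lambda>i. of_bool (i \<le> k))) (left_chain k)"

primrec right_chain :: "nat \<Rightarrow> (idx, 'k) cmat family" where
  "right_chain 0 = triv"
| "right_chain (Suc k) = combine (right_chain k) (osc (4, k) (\<lambda>i. if i \<le> k then c0 else 0) (\<lambda>_. 1))"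

text \<open>Taking v = 0 makes both parameters zero and leaves as coefficient of E_i a power of q,
  which vanishes nowhere. The smallest label is in the rightmost factor and will dominate the
  order.\<close>

primrec E_copies :: "nat \<Rightarrow> nat \<Rightarrow> (idx, 'k) cmat family" where
  "E_copies s 0 = triv"
| "E_copies s (Suc r) = combine (E_copies (Suc s) r) (noF (osc (0, s) (\<lambda>_. 1) (\<lambda>_. 0)))"

text \<open>Mirror image of \<open>E_copies\<close>, because in the coproduct of F the left factor
  receives the torus multiplier. Taking u = 0 leaves a power of q with a sign.\<close>

primrec F_copies :: "nat \<Rightarrow> nat \<Rightarrow> (idx, 'k) cmat family" where
  "F_copies s 0 = triv"
| "F_copies s (Suc r) = combine (noE (osc (1, s) (\<lambda>_. 0) (\<lambda>_. 1))) (F_copies (Suc s) r)"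

lemma built_left_chain: "built ({3} \<times> {..<k}) (left_chain k)"
proof (induction k)
  case (Suc k)
  have "built ({(3, k)} \<union> {3} \<times> {..<k}) (left_chain (Suc k))"
    unfolding left_chain.simps by (intro built_combine Suc built_located located_osc)
  moreover have "{(3, k)} \<union> {3} \<times> {..<k} = {3 :: nat} \<times> {..<Suc k}" by auto
  ultimately show ?case by simp
qed (simp add: built_triv)

lemma built_right_chain: "built ({4} \<times> {..<k}) (right_chain k)"
proof (induction k)
  case (Suc k)
  have "built ({4} \<times> {..<k} \<union> {(4, k)}) (right_chain (Suc k))"
    unfolding right_chain.simps by (intro built_combine Suc built_located located_osc)
  moreover have "{4} \<times> {..<k} \<union> {(4, k)} = {4 :: nat} \<times> {..<Suc k}" by auto
  ultimately show ?case by simp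
qed (simp add: built_triv)

lemma built_E_copies: "built ({0} \<times> {s..<s + r}) (E_copies s r)"
proof (induction r arbitrary: s)
  case (Suc r)
  have "built ({0} \<times> {Suc s..<Suc s + r} \<union> {(0, s)}) (E_copies s (Suc r))"
    unfolding E_copies.simps by (intro built_combine Suc built_located located_Ecopy)
  moreover have "{0} \<times> {Suc s..<Suc s + r} \<union> {(0, s)} = {0 :: nat} \<times> {s..<s + Suc r}" by auto
  ultimately show ?case by simp
qed (simp add: built_triv)

lemma built_F_copies: "built ({1} \<times> {s..<s + r}) (F_copies s r)"
proof (induction r arbitrary: s)
  case (Suc r)
  have "built ({(1, s)} \<union> {1} \<times> {Suc s..<Suc s + r}) (F_copies s (Suc r))"
    unfolding F_copies.simps by (intro built_combine Suc built_located located_Fcopy)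
  moreover have "{(1, s)} \<union> {1} \<times> {Suc s..<Suc s + r} = {1 :: nat} \<times> {s..<s + Suc r}" by auto
  ultimately show ?case by simp
qed (simp add: built_triv)

lemma qfamily_left_chain: "qfamily (\<lambda>_. 0) (kappa k) (left_chain k)"
proof (induction k)
  case 0
  then show ?case using qfamily_triv by (simp add: kappa_def[abs_def])
next
  case (Suc k)
  have "qfamily (kappa k) (kappa (Suc k)) (osc (3, k) (\<lambda>_. c0) (\<lambda>i. of_bool (i \<le> k)))"
    using qfamily_osc[of "\<lambda>_. c0" "\<lambda>i. of_bool (i \<le> k)" "(3, k)"]
    by (simp add: kappa_def[abs_def] c0 Suc_le_eq less_Suc_eq_le of_bool_def if_distrib cong: if_cong)
  moreover have "commuting (osc (3, k) (\<lambda>_. c0) (\<lambda>i. of_bool (i \<le> k))) (left_chain k)"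
    by (rule built_commuting[OF built_located[OF located_osc] built_left_chain]) auto
  ultimately show ?case using Suc qfamily_combine by simp
qed

lemma qfamily_right_chain: "qfamily (kappa k) (\<lambda>_. 0) (right_chain k)"
proof (induction k)
  case 0
  then show ?case using qfamily_triv by (simp add: kappa_def[abs_def])
next
  case (Suc k)
  have "qfamily (kappa (Suc k)) (kappa k) (osc (4, k) (\<lambda>i. if i \<le> k then c0 else 0) (\<lambda>_. 1))"
  proof -
    have "(\<lambda>i. (q - inverse q) * (if i \<le> k then c0 else 0) * 1) = kappa (Suc k)"
      "(\<lambda>i. (q - inverse q) * (if Suc i \<le> k then c0 else 0) * 1) = kappa k"
      by (auto simp: kappa_def c0)
    then show ?thesis
      using qfamily_osc[of "\<lambda>i. if i \<le> k then c0 else 0" "\<lambda>_. 1" "(4, k)"] by simp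
  qed
  moreover have "commuting (right_chain k) (osc (4, k) (\<lambda>i. if i \<le> k then c0 else 0) (\<lambda>_. 1))"
    by (rule built_commuting[OF built_right_chain built_located[OF located_osc]]) auto
  ultimately show ?case using Suc qfamily_combine by simp
qed

lemma qfamily_Ecopy: "qfamily (\<lambda>_. 0) (\<lambda>_. 0) (noF (osc \<sigma> (\<lambda>_. 1) (\<lambda>_. 0)))"
  using qfamily_osc[of "\<lambda>_. 1" "\<lambda>_. 0" \<sigma>] by (intro qfamily_noF) simp

lemma qfamily_Fcopy: "qfamily (\<lambda>_. 0) (\<lambda>_. 0) (noE (osc \<sigma> (\<lambda>_. 0) (\<lambda>_. 1)))"
  using qfamily_osc[of "\<lambda>_. 0" "\<lambda>_. 1" \<sigma>] by (intro qfamily_noE) simp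

lemma commuting_E_copies: "commuting (E_copies (Suc s) r) (noF (osc (0, s) (\<lambda>_. 1) (\<lambda>_. 0)))"
  by (rule built_commuting[OF built_E_copies built_located[OF located_Ecopy]]) auto

lemma commuting_F_copies: "commuting (noE (osc (1, s) (\<lambda>_. 0) (\<lambda>_. 1))) (F_copies (Suc s) r)"
  by (rule built_commuting[OF built_located[OF located_Fcopy] built_F_copies]) auto

lemma qfamily_E_copies: "qfamily (\<lambda>_. 0) (\<lambda>_. 0) (E_copies s r)"
  by (induction r arbitrary: s)
    (auto simp: qfamily_triv intro: qfamily_combine qfamily_Ecopy commuting_E_copies)

lemma qfamily_F_copies: "qfamily (\<lambda>_. 0) (\<lambda>_. 0) (F_copies s r)"
  by (induction r arbitrary: s)
    (auto simp: qfamily_triv simp del: One_nat_def intro: qfamily_combine qfamily_Fcopy commuting_F_copies)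

abbreviation "partL N \<equiv> combine (left_chain N) (E_copies 0 N)"
abbreviation "partK N \<equiv> combine (partL N) kshift"
abbreviation "partR N \<equiv> combine (F_copies 0 N) (right_chain N)"

definition total :: "nat \<Rightarrow> (idx, 'k) cmat family" where
  "total N = combine (partK N) (partR N)"

lemma commuting_parts:
  "commuting (left_chain N) (E_copies 0 N)" "commuting (partL N) kshift" "commuting (F_copies 0 N) (right_chain N)"
  "commuting (partK N) (partR N)"
proof -
  show "commuting (left_chain N) (E_copies 0 N)"
    by (rule built_commuting[OF built_left_chain built_E_copies]) auto
  show "commuting (partL N) kshift"
    by (rule built_commuting[OF built_combine[OF built_left_chain built_E_copies] built_located[OF located_kshift]]) auto
  show "commuting (F_copies 0 N) (right_chain N)"
    by (rule built_commuting[OF built_F_copies built_right_chain]) auto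
  show "commuting (partK N) (partR N)"
    by (rule built_commuting[OF built_combine[OF built_combine[OF built_left_chain built_E_copies]
            built_located[OF located_kshift]] built_combine[OF built_F_copies built_right_chain]]) auto
qed

lemma qfamily_partL: "qfamily (\<lambda>_. 0) (kappa N) (partL N)"
  by (rule qfamily_combine[OF qfamily_left_chain qfamily_E_copies commuting_parts(1)])

lemma qfamily_partK: "qfamily (\<lambda>_. 0) (kappa N) (partK N)"
  by (rule qfamily_combine[OF qfamily_partL qfamily_kshift commuting_parts(2)])

lemma qfamily_partR: "qfamily (kappa N) (\<lambda>_. 0) (partR N)"
  by (rule qfamily_combine[OF qfamily_F_copies qfamily_right_chain commuting_parts(3)])

lemma qfamily_total: "qfamily (kappa N) (kappa N) (total N)"
  unfolding total_def by (rule qfamily_combine[OF qfamily_partK qfamily_partR commuting_parts(4)])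

section \<open>Leading terms\<close>

definition bounded :: "coords \<Rightarrow> (idx, 'k) cmat \<Rightarrow> bool" where
  "bounded \<gamma> T \<longleftrightarrow> (\<forall>b. \<forall>k\<in>Poly_Mapping.keys (col T b). fst k \<le> fst b + \<gamma>)"

definition below :: "coords \<Rightarrow> (idx, 'k) cmat \<Rightarrow> bool" where
  "below \<gamma> T \<longleftrightarrow> (\<forall>b. \<forall>k\<in>Poly_Mapping.keys (col T b). fst k < fst b + \<gamma>)"

text \<open>The leading part is one weighted shift whose coefficient vanishes nowhere, so leading
  parts multiply without cancellation. The rest is lower already in the first component, while the
  shift itself is recorded in both components.\<close>

definition lead :: "idx \<Rightarrow> (idx, 'k) cmat \<Rightarrow> bool" where
  "lead s T \<longleftrightarrow> (\<exists>c. (\<forall>b. c b \<noteq> 0) \<and> below (fst s) (T - shift_op s c))"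

lemma keys_col_mult:
  assumes "k \<in> Poly_Mapping.keys (col (S * T) b)"
  obtains k' where "k' \<in> Poly_Mapping.keys (col T b)" "k \<in> Poly_Mapping.keys (col S k')"
proof -
  have "k \<in> (\<Union>k'\<in>Poly_Mapping.keys (col T b). Poly_Mapping.keys
      (vscale (Poly_Mapping.lookup (col T b) k') (col S k')))"
  proof -
    have "Poly_Mapping.lookup (\<Sum>k'\<in>Poly_Mapping.keys (col T b).
        vscale (Poly_Mapping.lookup (col T b) k') (col S k')) k \<noteq> 0"
      using assms by (simp add: vscale.lext_def in_keys_iff)
    then show ?thesis
      by (auto simp: lookup_sum in_keys_iff elim!: sum.not_neutral_contains_not_neutral)
  qed
  then show ?thesis using that keys_vscale by fastforce
qed

lemma bounded_mult: "bounded \<gamma> S \<Longrightarrow> bounded \<delta> T \<Longrightarrow> bounded (\<gamma> + \<delta>) (S * T)"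
  unfolding bounded_def
proof (intro allI ballI)
  fix b k
  assume a: "\<forall>b. \<forall>k\<in>Poly_Mapping.keys (col S b). fst k \<le> fst b + \<gamma>"
    "\<forall>b. \<forall>k\<in>Poly_Mapping.keys (col T b). fst k \<le> fst b + \<delta>"
    "k \<in> Poly_Mapping.keys (col (S * T) b)"
  from a(3) obtain k' where "k' \<in> Poly_Mapping.keys (col T b)" "k \<in> Poly_Mapping.keys (col S k')"
    by (rule keys_col_mult)
  with a(1,2) have "fst k' \<le> fst b + \<delta>" "fst k \<le> fst k' + \<gamma>" by blast+
  then have "fst k \<le> fst b + \<delta> + \<gamma>" by (blast intro: order_trans[OF _ add_right_mono])
  then show "fst k \<le> fst b + (\<gamma> + \<delta>)" by (simp add: ac_simps)
qed

lemma below_bounded_mult: "below \<gamma> S \<Longrightarrow> bounded \<delta> T \<Longrightarrow> below (\<gamma> + \<delta>) (S * T)"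
  unfolding bounded_def below_def
proof (intro allI ballI)
  fix b k
  assume a: "\<forall>b. \<forall>k\<in>Poly_Mapping.keys (col S b). fst k < fst b + \<gamma>"
    "\<forall>b. \<forall>k\<in>Poly_Mapping.keys (col T b). fst k \<le> fst b + \<delta>"
    "k \<in> Poly_Mapping.keys (col (S * T) b)"
  from a(3) obtain k' where "k' \<in> Poly_Mapping.keys (col T b)" "k \<in> Poly_Mapping.keys (col S k')"
    by (rule keys_col_mult)
  with a(1,2) have "fst k' \<le> fst b + \<delta>" "fst k < fst k' + \<gamma>" by blast+
  then have "fst k < fst b + \<delta> + \<gamma>" by (blast intro: order.strict_trans2[OF _ add_right_mono])
  then show "fst k < fst b + (\<gamma> + \<delta>)" by (simp add: ac_simps)
qed

lemma bounded_below_mult: "bounded \<gamma> S \<Longrightarrow> below \<delta> T \<Longrightarrow> below (\<gamma> + \<delta>) (S * T)"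
  unfolding bounded_def below_def
proof (intro allI ballI)
  fix b k
  assume a: "\<forall>b. \<forall>k\<in>Poly_Mapping.keys (col S b). fst k \<le> fst b + \<gamma>"
    "\<forall>b. \<forall>k\<in>Poly_Mapping.keys (col T b). fst k < fst b + \<delta>"
    "k \<in> Poly_Mapping.keys (col (S * T) b)"
  from a(3) obtain k' where "k' \<in> Poly_Mapping.keys (col T b)" "k \<in> Poly_Mapping.keys (col S k')"
    by (rule keys_col_mult)
  with a(1,2) have "fst k' < fst b + \<delta>" "fst k \<le> fst k' + \<gamma>" by blast+
  then have "fst k < fst b + \<delta> + \<gamma>" by (blast intro: order.strict_trans1[OF _ add_strict_right_mono])
  then show "fst k < fst b + (\<gamma> + \<delta>)" by (simp add: ac_simps)
qed

lemma bounded_0 [simp]: "bounded \<gamma> 0" and below_0 [simp]: "below \<gamma> 0"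
  by (simp_all add: bounded_def below_def)

lemma bounded_add: "bounded \<gamma> S \<Longrightarrow> bounded \<gamma> T \<Longrightarrow> bounded \<gamma> (S + T)"
  and below_add: "below \<gamma> S \<Longrightarrow> below \<gamma> T \<Longrightarrow> below \<gamma> (S + T)"
  unfolding bounded_def below_def using Poly_Mapping.keys_add by (fastforce, fastforce)

lemma bounded_mscale: "bounded \<gamma> T \<Longrightarrow> bounded \<gamma> (mscale a T)"
  and below_mscale: "below \<gamma> T \<Longrightarrow> below \<gamma> (mscale a T)"
  unfolding bounded_def below_def using keys_vscale by (fastforce, fastforce)

lemma bounded_uminus: "bounded \<gamma> T \<Longrightarrow> bounded \<gamma> (- T)"
  by (simp add: bounded_def keys_minus)

lemma bounded_diff: "bounded \<gamma> S \<Longrightarrow> bounded \<gamma> T \<Longrightarrow> bounded \<gamma> (S - T)"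
  using bounded_add[of \<gamma> S "- T"] bounded_uminus by simp

lemma below_sum: "(\<And>i. i \<in> A \<Longrightarrow> below \<gamma> (f i)) \<Longrightarrow> below \<gamma> (\<Sum>i\<in>A. f i)"
  by (induction A rule: infinite_finite_induct) (auto intro: below_add)

lemma bounded_below: "bounded \<gamma> T \<Longrightarrow> \<gamma> < \<delta> \<Longrightarrow> below \<delta> T"
  unfolding bounded_def below_def by (meson add_strict_left_mono order.strict_trans1)

lemma below_bounded: "below \<gamma> T \<Longrightarrow> bounded \<gamma> T"
  unfolding bounded_def below_def using less_imp_le by blast

lemma bounded_shift_op: "bounded (fst s) (shift_op s c)"
  by (simp add: bounded_def)

lemma lead_shift_op: "(\<And>b. c b \<noteq> 0) \<Longrightarrow> lead s (shift_op s c)"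
  unfolding lead_def by (intro exI[of _ c]) simp

lemma lead_bounded: "lead s T \<Longrightarrow> bounded (fst s) T"
  unfolding lead_def using bounded_add[OF below_bounded bounded_shift_op, of s "T - shift_op s c" c for c] by force

lemma lead_mult:
  assumes "lead s S" "lead t T"
  shows "lead (s + t) (S * T)"
proof -
  obtain c where c: "\<And>b. c b \<noteq> 0" "below (fst s) (S - shift_op s c)"
    using assms(1) by (auto simp: lead_def)
  obtain d where d: "\<And>b. d b \<noteq> 0" "below (fst t) (T - shift_op t d)"
    using assms(2) by (auto simp: lead_def)
  have "S * T - shift_op (s + t) (\<lambda>b. c (b + t) * d b)
    = (S - shift_op s c) * T + shift_op s c * (T - shift_op t d)"
    by (simp add: algebra_simps shift_op_mult)
  also have "below (fst (s + t)) \<dots>"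
    using below_bounded_mult[OF c(2) lead_bounded[OF assms(2)]] bounded_below_mult[OF bounded_shift_op[of s c] d(2)]
    by (auto intro: below_add)
  finally show ?thesis
    unfolding lead_def by (intro exI[of _ "\<lambda>b. c (b + t) * d b"]) (simp add: c d)
qed

lemma lead_add:
  assumes "lead s T" "below (fst s) R"
  shows "lead s (T + R)" "lead s (R + T)"
proof -
  obtain c where c: "\<And>b. c b \<noteq> 0" "below (fst s) (T - shift_op s c)"
    using assms(1) by (auto simp: lead_def)
  have "below (fst s) (T + R - shift_op s c)"
    using below_add[OF c(2) assms(2)] by (simp add: algebra_simps)
  then show "lead s (T + R)" unfolding lead_def using c(1) by blast
  then show "lead s (R + T)" by (simp add: add.commute)
qed

lemma lead_mscale:
  assumes "lead s T" "a \<noteq> 0"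
  shows "lead s (mscale a T)"
proof -
  have "lead 0 (mscale a 1)" using assms(2) by (simp add: one_shift_op mscale_shift_op lead_shift_op)
  from lead_mult[OF this assms(1)] show ?thesis by (simp add: scale_mult_left)
qed

lemma lead_1: "lead 0 1"
  by (simp add: one_shift_op lead_shift_op)

section \<open>Leading exponents of root vectors\<close>

definition diagonal :: "(idx, 'k) cmat \<Rightarrow> bool" where
  "diagonal T \<longleftrightarrow> (\<exists>c. T = shift_op 0 c \<and> (\<forall>b. c b \<noteq> 0))"

lemma diagonal_mult: "diagonal S \<Longrightarrow> diagonal T \<Longrightarrow> diagonal (S * T)"
  unfolding diagonal_def by (auto simp: shift_op_mult)

lemma diagonal_1: "diagonal 1"
  unfolding diagonal_def one_shift_op by force

lemma diagonal_lead: "diagonal T \<Longrightarrow> lead 0 T"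
  unfolding diagonal_def by (auto intro: lead_shift_op)

lemma diagonal_bounded: "diagonal T \<Longrightarrow> bounded 0 T"
  using lead_bounded[of 0 T] diagonal_lead[of T] by simp

lemma diagonal_prod_list: "(\<And>x. x \<in> set xs \<Longrightarrow> diagonal x) \<Longrightarrow> diagonal (prod_list xs)"
  by (induction xs) (auto simp: diagonal_1 diagonal_mult)

text \<open>The leading exponent of the root vector of the interval from \<open>i\<close> to \<open>i + k\<close> in a
  combination of copies with labels \<open>s, s + 1, \<dots>\<close>.\<close>

primrec chain_exp :: "nat \<Rightarrow> nat \<Rightarrow> nat \<Rightarrow> nat \<Rightarrow> coords" where
  "chain_exp \<kappa> s i 0 = Poly_Mapping.single (\<kappa>, i, s) 1"
| "chain_exp \<kappa> s i (Suc k) = Poly_Mapping.single (\<kappa>, i, s) 1 + chain_exp \<kappa> (Suc s) (Suc i) k"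

text \<open>The exponent follows a diagonal: node p of the interval uses the copy with label s + (p
  - i).\<close>

lemma lookup_chain_exp:
  "Poly_Mapping.lookup (chain_exp \<kappa> s i k) (\<kappa>', p, l) = of_bool (\<kappa>' = \<kappa> \<and> i \<le> p \<and> p \<le> i + k \<and> p + s = i + l)"
proof (induction k arbitrary: s i)
  case 0
  then show ?case by (auto simp: lookup_single when_def)
next
  case (Suc k)
  then show ?case by (simp only: chain_exp.simps lookup_add Suc) (auto simp: lookup_single when_def)
qed

lemma less_coordsI:
  assumes "Poly_Mapping.lookup f j < Poly_Mapping.lookup g j"
    "\<And>j'. j' < j \<Longrightarrow> Poly_Mapping.lookup f j' = Poly_Mapping.lookup g j'"
  shows "f < (g :: coords)"
  unfolding less_poly_mapping.rep_eq less_fun_def using assms by blast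

text \<open>The smallest key with different entries decides the order. This inequality and the next
  two rank below the leading exponent, in turn, the same interval in later copies, the interval
  shortened at its right end, and any interval that starts later.\<close>

lemma chain_exp_less_label: "chain_exp \<kappa> (Suc s) i k < chain_exp \<kappa> s i k"
  by (rule less_coordsI[where j = "(\<kappa>, i, s)"]) (auto simp: lookup_chain_exp)

lemma chain_exp_less_right: "l < k \<Longrightarrow> chain_exp \<kappa> s i l < chain_exp \<kappa> s i k"
  by (rule less_coordsI[where j = "(\<kappa>, i + Suc l, s + Suc l)"]) (auto simp: lookup_chain_exp)

lemma chain_exp_less_left: "i < i' \<Longrightarrow> chain_exp \<kappa> s i' l < chain_exp \<kappa> s i k"
  by (rule less_coordsI[where j = "(\<kappa>, i, s)"]) (auto simp: lookup_chain_exp)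

lemma chain_exp_pos: "0 < chain_exp \<kappa> s i k"
  by (rule less_coordsI[where j = "(\<kappa>, i, s)"]) (auto simp: lookup_chain_exp)

lemma bounded_root_vec: "(\<And>j. bounded 0 (x j)) \<Longrightarrow> bounded 0 (root_vec x i k)"
proof (induction k arbitrary: i)
  case (Suc k)
  have "bounded (0 + 0) (x i * root_vec x (Suc i) k)" "bounded (0 + 0) (root_vec x (Suc i) k * x i)"
    using Suc by (blast intro: bounded_mult)+
  then show ?case by (auto intro!: bounded_diff bounded_mscale)
qed simp

text \<open>With r copies only intervals of at most r nodes find a separate copy for each node,
  hence k < r for the leading term; the upper bound is kept for all lengths.\<close>

definition leads :: "nat \<Rightarrow> nat \<Rightarrow> nat \<Rightarrow> (nat \<Rightarrow> (idx, 'k) cmat) \<Rightarrow> bool" where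
  "leads \<kappa> s r x \<longleftrightarrow> (\<forall>i k. bounded (chain_exp \<kappa> s i k) (root_vec x i k) \<and> (k < r \<longrightarrow> lead (chain_exp \<kappa> s i k, 0) (root_vec x i k)))"

abbreviation cross :: "(nat \<Rightarrow> (idx, 'k) cmat) \<Rightarrow> (nat \<Rightarrow> (idx, 'k) cmat) \<Rightarrow> bool" where
  "cross A B \<equiv> \<forall>i j. A i * B j = mscale (q powi - cartan i j) (B j * A i)"

lemma root_vec_add_cross:
  assumes "cross A B" "braided0 A"
  shows "root_vec (\<lambda>i. A i + B i) i k = root_vec A i k + root_vec B i k
    + mscale (1 - q * q) (\<Sum>l<k. root_vec B i l * root_vec A (Suc (i + l)) (k - Suc l))"
  using assms by (intro root_vec_add) (auto simp: braided0_def)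

text \<open>The new copy has no root vectors beyond single nodes, so for longer intervals the sum
  formula keeps \<open>root_vec A i k\<close> and the term where the new copy covers node i and the
  old copies the rest. The latter starts at the smaller label and leads; its factor 1 - q * q is
  nonzero.\<close>

lemma leads_add_copy:
  assumes AB: "cross A (\<lambda>i. g i * x i)" and A: "braided0 A" "leads \<kappa> (Suc s) r A"
    and gg: "\<And>i j. g i * g j = g j * g i" and gx: "\<And>i j. g i * x j = x j * g i"
    and g: "\<And>i. diagonal (g i)" and x: "\<And>i. lead (Poly_Mapping.single (\<kappa>, i, s) 1, 0) (x i)"
    and xx: "\<And>i. x i * x (Suc i) = mscale q (x (Suc i) * x i)"
    and far: "\<And>i j. Suc i < j \<Longrightarrow> x i * x j = x j * x i"
  shows "leads \<kappa> s (Suc r) (\<lambda>i. A i + g i * x i)"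
  unfolding leads_def
proof (intro allI)
  fix i k
  let ?G = "\<lambda>i. A i + g i * x i" and ?B = "\<lambda>i. g i * x i"
  have B0: "lead (Poly_Mapping.single (\<kappa>, i, s) 1, 0) (?B i)"
    using lead_mult[OF diagonal_lead[OF g] x] by simp
  have x0: "root_vec x i (Suc l) = 0" for l
    by (rule root_vec_qcommuting) (use xx far in auto)
  have B: "root_vec ?B i (Suc l) = 0" for l
    unfolding root_vec_twist[of g x, OF gg gx] x0 by simp
  have Abd: "below (chain_exp \<kappa> s i k) (root_vec A i k)"
    using A(2) chain_exp_less_label bounded_below by (fastforce simp: leads_def)
  show "bounded (chain_exp \<kappa> s i k) (root_vec ?G i k) \<and> (k < Suc r \<longrightarrow> lead (chain_exp \<kappa> s i k, 0) (root_vec ?G i k))"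
  proof (cases k)
    case 0
    have "lead (chain_exp \<kappa> s i k, 0) (root_vec ?G i k)"
      using lead_add(2)[OF B0, of "A i"] Abd by (simp add: 0)
    then show ?thesis using lead_bounded by force
  next
    case (Suc k')
    have "root_vec ?G i k = root_vec A i k + mscale (1 - q * q) (?B i * root_vec A (Suc i) k')"
      unfolding root_vec_add_cross[OF AB A(1)] unfolding Suc
      by (subst sum.lessThan_Suc_shift) (simp add: B del: root_vec.simps(2))
    moreover have "bounded (chain_exp \<kappa> s i k) (?B i * root_vec A (Suc i) k')"
      using bounded_mult[OF lead_bounded[OF B0]] A(2) by (force simp: leads_def Suc)
    moreover have "lead (chain_exp \<kappa> s i k, 0) (?B i * root_vec A (Suc i) k')" if "k < Suc r"
    proof -
      have "lead (chain_exp \<kappa> (Suc s) (Suc i) k', 0) (root_vec A (Suc i) k')"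
        using A(2) that by (auto simp: leads_def Suc)
      from lead_mult[OF B0 this] show ?thesis by (simp add: Suc)
    qed
    moreover have nz: "1 - q * q \<noteq> 0" using q2_neq_1 by simp
    ultimately show ?thesis
      using Abd lead_add(2)[of "(chain_exp \<kappa> s i k, 0)" _ "root_vec A i k"]
      by (auto intro: bounded_add below_bounded bounded_mscale lead_mscale[OF _ nz])
  qed
qed

text \<open>\<open>B\<close> does not raise the first component, so its own root vectors are too low
  and each mixed term is bounded by a root vector of \<open>A\<close> that starts later.\<close>

lemma leads_add_right:
  assumes AB: "cross A B" and A: "braided0 A" "leads \<kappa> s r A" and B: "\<And>i. bounded 0 (B i)"
  shows "leads \<kappa> s r (\<lambda>i. A i + B i)"
  unfolding leads_def
proof (intro allI)
  fix i k
  let ?R = "root_vec B i k + mscale (1 - q * q) (\<Sum>l<k. root_vec B i l * root_vec A (Suc (i + l)) (k - Suc l))"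
  have Bb: "bounded 0 (root_vec B i l)" for l by (rule bounded_root_vec) (rule B)
  have "below (chain_exp \<kappa> s i k) (root_vec B i l * root_vec A (Suc (i + l)) (k - Suc l))" for l
  proof -
    have "bounded (0 + chain_exp \<kappa> s (Suc (i + l)) (k - Suc l)) (root_vec B i l * root_vec A (Suc (i + l)) (k - Suc l))"
      by (rule bounded_mult[OF Bb]) (use A(2) in \<open>simp add: leads_def\<close>)
    then show ?thesis using bounded_below chain_exp_less_left[of i "Suc (i + l)"] by simp
  qed
  then have R: "below (chain_exp \<kappa> s i k) ?R"
    by (intro below_add below_mscale below_sum bounded_below[OF Bb chain_exp_pos])
  have G: "root_vec (\<lambda>i. A i + B i) i k = root_vec A i k + ?R"
    unfolding root_vec_add_cross[OF AB A(1)] by (simp add: add.assoc)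
  show "bounded (chain_exp \<kappa> s i k) (root_vec (\<lambda>i. A i + B i) i k) \<and>
      (k < r \<longrightarrow> lead (chain_exp \<kappa> s i k, 0) (root_vec (\<lambda>i. A i + B i) i k))"
    unfolding G using A(2) R by (auto simp: leads_def intro: bounded_add below_bounded lead_add)
qed

text \<open>Here mixed terms are bounded by root vectors of \<open>B\<close> on intervals with the
  same left end but fewer nodes.\<close>

lemma leads_add_left:
  assumes AB: "cross A B" and A: "braided0 A" "\<And>i. bounded 0 (A i)" and B: "leads \<kappa> s r B"
  shows "leads \<kappa> s r (\<lambda>i. A i + B i)"
  unfolding leads_def
proof (intro allI)
  fix i k
  let ?R = "root_vec A i k + mscale (1 - q * q) (\<Sum>l<k. root_vec B i l * root_vec A (Suc (i + l)) (k - Suc l))"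
  have Ab: "bounded 0 (root_vec A i l)" for i l by (rule bounded_root_vec) (rule A)
  have "below (chain_exp \<kappa> s i k) (root_vec B i l * root_vec A (Suc (i + l)) (k - Suc l))" if "l < k" for l
  proof -
    have "bounded (chain_exp \<kappa> s i l + 0) (root_vec B i l * root_vec A (Suc (i + l)) (k - Suc l))"
      by (rule bounded_mult[OF _ Ab]) (use B in \<open>simp add: leads_def\<close>)
    then show ?thesis using bounded_below chain_exp_less_right[OF that] by simp
  qed
  then have R: "below (chain_exp \<kappa> s i k) ?R"
    by (intro below_add below_mscale below_sum bounded_below[OF Ab chain_exp_pos]) simp
  have G: "root_vec (\<lambda>i. A i + B i) i k = root_vec B i k + ?R"
    unfolding root_vec_add_cross[OF AB A(1)] by (simp add: algebra_simps)
  show "bounded (chain_exp \<kappa> s i k) (root_vec (\<lambda>i. A i + B i) i k) \<and>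
      (k < r \<longrightarrow> lead (chain_exp \<kappa> s i k, 0) (root_vec (\<lambda>i. A i + B i) i k))"
    unfolding G using B R by (auto simp: leads_def intro: bounded_add below_bounded lead_add)
qed

lemma leads_twist:
  assumes x: "leads \<kappa> s r x" and g: "\<And>i. diagonal (g i)"
    and gg: "\<And>i j. g i * g j = g j * g i" and gx: "\<And>i j. g i * x j = x j * g i"
  shows "leads \<kappa> s r (\<lambda>i. g i * x i)"
  unfolding leads_def
proof (intro allI)
  fix i k
  let ?P = "prod_list (map g [i..<Suc (i + k)])"
  have P: "diagonal ?P" by (rule diagonal_prod_list) (use g in auto)
  show "bounded (chain_exp \<kappa> s i k) (root_vec (\<lambda>i. g i * x i) i k) \<and>
      (k < r \<longrightarrow> lead (chain_exp \<kappa> s i k, 0) (root_vec (\<lambda>i. g i * x i) i k))"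
    unfolding root_vec_twist[of g x, OF gg gx]
    using x bounded_mult[OF diagonal_bounded[OF P]] lead_mult[OF diagonal_lead[OF P]]
    by (force simp: leads_def simp del: upt.simps)
qed

definition diagonal_K :: "(idx, 'k) cmat family \<Rightarrow> bool" where
  "diagonal_K X \<longleftrightarrow> (\<forall>i. diagonal (fK X i) \<and> diagonal (fK' X i))"

lemma diagonal_Kalpha: "diagonal_K X \<Longrightarrow> diagonal (Kalpha X i)"
  and diagonal_Kalpha_inv: "diagonal_K X \<Longrightarrow> diagonal (Kalpha_inv X i)"
  by (simp_all add: diagonal_K_def Kalpha_def Kalpha_inv_def diagonal_mult)

lemma diagonal_K_combine: "diagonal_K X \<Longrightarrow> diagonal_K Y \<Longrightarrow> diagonal_K (combine X Y)"
  by (simp add: diagonal_K_def diagonal_mult)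

lemma diagonal_K_osc: "diagonal_K (osc \<sigma> u v)"
  unfolding diagonal_K_def diagonal_def osc_def family.sel using qpow_simps(3) by fast

lemma diagonal_K_triv: "diagonal_K triv"
  by (simp add: diagonal_K_def triv_def diagonal_1)

lemma diagonal_K_mask: "diagonal_K X \<Longrightarrow> diagonal_K (noE X)" "diagonal_K X \<Longrightarrow> diagonal_K (noF X)"
  by (simp_all add: diagonal_K_def noE_def noF_def)

lemma diagonal_K_left_chain: "diagonal_K (left_chain k)"
  by (induction k) (simp_all add: diagonal_K_triv diagonal_K_combine diagonal_K_osc)

lemma diagonal_K_right_chain: "diagonal_K (right_chain k)"
  by (induction k) (simp_all add: diagonal_K_triv diagonal_K_combine diagonal_K_osc)

lemma diagonal_K_E_copies: "diagonal_K (E_copies s r)"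
  by (induction r arbitrary: s) (simp_all add: diagonal_K_triv diagonal_K_combine diagonal_K_osc diagonal_K_mask)

lemma diagonal_K_F_copies: "diagonal_K (F_copies s r)"
  by (induction r arbitrary: s) (simp_all add: diagonal_K_triv diagonal_K_combine diagonal_K_osc diagonal_K_mask)

lemma bounded_0_mult: "bounded 0 S \<Longrightarrow> bounded 0 T \<Longrightarrow> bounded 0 (S * T)"
  using bounded_mult[of 0 S 0 T] by simp

lemma bounded_0_Kalpha: "diagonal_K X \<Longrightarrow> bounded 0 (Kalpha X i)"
  and bounded_0_Kalpha_inv: "diagonal_K X \<Longrightarrow> bounded 0 (Kalpha_inv X i)"
  by (simp_all add: diagonal_bounded diagonal_Kalpha diagonal_Kalpha_inv)

lemma bounded_0_osc:
  assumes "fst \<sigma> \<ge> 2"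
  shows "bounded 0 (fE (osc \<sigma> u v) i)" "bounded 0 (fF (osc \<sigma> u v) i)"
proof -
  have "fst (unit_vec \<sigma> i) = 0" "fst (- unit_vec \<sigma> i) = 0" using assms by (simp_all add: unit_vec_def Let_def)
  then show "bounded 0 (fE (osc \<sigma> u v) i)" "bounded 0 (fF (osc \<sigma> u v) i)"
    unfolding osc_def family.sel by (metis bounded_shift_op)+
qed

lemma bounded_0_left_chain: "bounded 0 (fE (left_chain k) i)" "bounded 0 (fF (left_chain k) i)"
  by (induction k) (auto simp: triv_def intro!: bounded_add bounded_0_mult bounded_0_osc
      bounded_0_Kalpha bounded_0_Kalpha_inv diagonal_K_osc diagonal_K_left_chain)

lemma bounded_0_right_chain: "bounded 0 (fE (right_chain k) i)" "bounded 0 (fF (right_chain k) i)"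
  by (induction k) (auto simp: triv_def intro!: bounded_add bounded_0_mult bounded_0_osc
      bounded_0_Kalpha bounded_0_Kalpha_inv diagonal_K_osc diagonal_K_right_chain)

lemma fF_E_copies: "fF (E_copies s r) i = 0"
  by (induction r arbitrary: s) (auto simp: triv_def noF_def)

lemma fE_F_copies: "fE (F_copies s r) i = 0"
  by (induction r arbitrary: s) (auto simp: triv_def noE_def)

lemma root_vec_zero: "root_vec (\<lambda>_. 0) i k = 0"
  by (rule root_vec_eq_0[where j = i]) auto

lemma fE_combine: "fE (combine X Y) = (\<lambda>i. fE X i + Kalpha X i * fE Y i)"
  and fF_combine: "fF (combine X Y) = (\<lambda>i. fF Y i + fF X i * Kalpha_inv Y i)"
  by (simp_all add: combine_def)

lemma leads_E_copies: "leads 0 s r (fE (E_copies s r))"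
proof (induction r arbitrary: s)
  case (Suc r)
  let ?A = "E_copies (Suc s) r" and ?Y = "osc (0, s) (\<lambda>_. 1) (\<lambda>_. 0)"
  let ?X = "noF ?Y"
  note c = qfamily_E_copies[of "Suc s" r] qfamily_Ecopy[of "(0, s)"] commuting_E_copies[of s r]
  have X: "fE ?X i = shift_op (unit_vec (0, s) i) (\<lambda>b. q powi weight (0, s) (Suc i) b)" for i
    by (simp add: noF_def osc_def qlin_def)
  show ?case unfolding E_copies.simps fE_combine
  proof (rule leads_add_copy)
    show "cross (fE ?A) (\<lambda>i. Kalpha ?A i * fE ?X i)" using combine_E_cross[OF c] by blast
    show "braided0 (fE ?A)" by (rule qfamilyD(7)[OF c(1)])
    show "Kalpha ?A i * Kalpha ?A j = Kalpha ?A j * Kalpha ?A i" for i j by (rule k_commute(1)[OF c(1)])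
    show "Kalpha ?A i * fE ?X j = fE ?X j * Kalpha ?A i" for i j by (rule XY_Kalpha(1)[OF c])
    show "diagonal (Kalpha ?A i)" for i by (rule diagonal_Kalpha[OF diagonal_K_E_copies])
    show "lead (Poly_Mapping.single (0, i, s) 1, 0) (fE ?X i)" for i
      unfolding X using lead_shift_op[of "\<lambda>b. q powi weight (0, s) (Suc i) b" "unit_vec (0, s) i"] qpow_simps(3)
      by (simp add: unit_vec_def)
    show "fE ?X i * fE ?X (Suc i) = mscale q (fE ?X (Suc i) * fE ?X i)" for i
      unfolding X shift_op_mult mscale_shift_op by (simp add: weight_simps qpow_simps ac_simps)
    show "fE ?X i * fE ?X j = fE ?X j * fE ?X i" if "Suc i < j" for i j
      using qfamilyD(7)[OF c(2)] that unfolding braided0_def by blast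
  qed (rule Suc)
qed (simp add: leads_def triv_def root_vec_zero)

lemma leads_F_copies: "leads 1 s r (fF (F_copies s r))"
proof (induction r arbitrary: s)
  case (Suc r)
  let ?A = "F_copies (Suc s) r" and ?Y = "osc (1, s) (\<lambda>_. 0) (\<lambda>_. 1)"
  let ?X = "noE ?Y"
  note c = qfamily_Fcopy[of "(1, s)"] qfamily_F_copies[of "Suc s" r] commuting_F_copies[of s r]
  have X: "fF ?X i = shift_op (- unit_vec (1, s) i) (\<lambda>b. - (q powi - weight (1, s) i b))" for i
    by (simp add: noE_def osc_def qlin_def)
  have eq: "(\<lambda>i. fF ?A i + fF ?X i * Kalpha_inv ?A i) = (\<lambda>i. fF ?A i + Kalpha_inv ?A i * fF ?X i)"
    by (simp only: XY_Kalpha(6)[OF c])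
  show ?case unfolding F_copies.simps fF_combine eq
  proof (rule leads_add_copy)
    show "cross (fF ?A) (\<lambda>i. Kalpha_inv ?A i * fF ?X i)"
      using combine_F_cross[OF c] unfolding XY_Kalpha(6)[OF c] by blast
    show "braided0 (fF ?A)" by (rule qfamilyD(8)[OF c(2)])
    show "Kalpha_inv ?A i * Kalpha_inv ?A j = Kalpha_inv ?A j * Kalpha_inv ?A i" for i j by (rule k_commute(2)[OF c(2)])
    show "Kalpha_inv ?A i * fF ?X j = fF ?X j * Kalpha_inv ?A i" for i j by (rule XY_Kalpha(6)[OF c, symmetric])
    show "diagonal (Kalpha_inv ?A i)" for i by (rule diagonal_Kalpha_inv[OF diagonal_K_F_copies])
    show "lead (Poly_Mapping.single (1, i, s) 1, 0) (fF ?X i)" for i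
      unfolding X using lead_shift_op[of "\<lambda>b. - (q powi - weight (1, s) i b)" "- unit_vec (1, s) i"] qpow_simps(3)
      by (simp add: unit_vec_def single_uminus[symmetric])
    show "fF ?X i * fF ?X (Suc i) = mscale q (fF ?X (Suc i) * fF ?X i)" for i
      unfolding X shift_op_mult mscale_shift_op by (simp add: weight_simps qpow_simps ac_simps q_nz q_cancel)
    show "fF ?X i * fF ?X j = fF ?X j * fF ?X i" if "Suc i < j" for i j
      using qfamilyD(8)[OF c(1)] that unfolding braided0_def by blast
  qed (rule Suc)
qed (simp add: leads_def triv_def root_vec_zero)

lemma bounded_0_kshift: "bounded 0 (fK kshift i)" "bounded 0 (fK' kshift i)"
proof -
  have "fst (unit_vec (2, 0) i) = 0" "fst (- unit_vec (2, 0) i) = 0" by (simp_all add: unit_vec_def)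
  then show "bounded 0 (fK kshift i)" "bounded 0 (fK' kshift i)"
    unfolding kshift_def family.sel by (metis bounded_shift_op)+
qed

text \<open>Among the E's only those of \<open>E_copies\<close> move the first component. The chains
  add bounded summands, the torus multipliers are diagonal or move the second component, and
  \<open>kshift\<close> has no E.\<close>

lemma leads_total_E: "leads 0 0 N (fE (total N))"
proof -
  note cL = qfamily_left_chain[of N] qfamily_E_copies[of 0 N] commuting_parts(1)[of N]
  note cT = qfamily_partK[of N] qfamily_partR[of N] commuting_parts(4)[of N]
  have "leads 0 0 N (\<lambda>i. Kalpha (left_chain N) i * fE (E_copies 0 N) i)"
    by (rule leads_twist[OF leads_E_copies diagonal_Kalpha[OF diagonal_K_left_chain] k_commute(1)[OF cL(1)] XY_Kalpha(1)[OF cL]])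
  then have "leads 0 0 N (fE (partL N))"
    unfolding fE_combine using combine_E_cross[OF cL] qfamilyD(7)[OF cL(1)] bounded_0_left_chain(1)
    by (intro leads_add_left) auto
  then have K: "leads 0 0 N (fE (partK N))"
    by (simp add: combine_def kshift_def)
  have "bounded 0 (Kalpha (partK N) i * fE (partR N) i)" for i
    unfolding Kalpha_def combine_simps fE_F_copies
    by (simp only: add_0 flip: Kalpha_def)
      (intro bounded_0_mult bounded_0_kshift bounded_0_right_chain diagonal_bounded diagonal_Kalpha[OF diagonal_K_F_copies];
        use diagonal_K_left_chain[of N] diagonal_K_E_copies[of 0 N] in \<open>simp add: diagonal_K_def\<close>)
  moreover have "cross (fE (partK N)) (\<lambda>i. Kalpha (partK N) i * fE (partR N) i)"
    using combine_E_cross[OF cT] by blast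
  ultimately show ?thesis
    unfolding total_def fE_combine[of "partK N"] by (intro leads_add_right qfamilyD(7)[OF cT(1)] K)
qed

lemma leads_total_F: "leads 1 0 N (fF (total N))"
proof -
  note cR = qfamily_F_copies[of 0 N] qfamily_right_chain[of N] commuting_parts(3)[of N]
  note cT = qfamily_partK[of N] qfamily_partR[of N] commuting_parts(4)[of N]
  have "leads 1 0 N (\<lambda>i. Kalpha_inv (right_chain N) i * fF (F_copies 0 N) i)"
    by (rule leads_twist[OF leads_F_copies diagonal_Kalpha_inv[OF diagonal_K_right_chain] k_commute(2)[OF cR(2)] XY_Kalpha(6)[OF cR, symmetric]])
  then have R: "leads 1 0 N (fF (partR N))"
    unfolding fF_combine using combine_F_cross[OF cR] qfamilyD(8)[OF cR(2)] bounded_0_right_chain(2)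
    by (intro leads_add_left) (auto simp: XY_Kalpha(6)[OF cR])
  have "bounded 0 (Kalpha_inv kshift i)" for i
    unfolding Kalpha_inv_def by (intro bounded_0_mult bounded_0_kshift)
  moreover have "fF kshift i = 0" for i by (simp add: kshift_def)
  ultimately have "bounded 0 (fF (partK N) i * Kalpha_inv (partR N) i)" for i
    using diagonal_Kalpha_inv[OF diagonal_K_E_copies] diagonal_Kalpha_inv[OF diagonal_K_combine[OF diagonal_K_F_copies diagonal_K_right_chain]]
    by (auto simp: fF_E_copies intro!: bounded_0_mult bounded_0_left_chain intro: diagonal_bounded simp del: combine_simps(3,4))
  moreover have "cross (fF (partR N)) (\<lambda>i. fF (partK N) i * Kalpha_inv (partR N) i)"
    using combine_F_cross[OF cT] by blast
  ultimately show ?thesis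
    unfolding total_def fF_combine[of "partK N"] by (intro leads_add_right qfamilyD(8)[OF cT(2)] R)
qed

text \<open>All factors except \<open>kshift\<close> have diagonal K's, which contribute exponent
  zero.\<close>

lemma lead_total_K: "lead (unit_vec (2, 0) j) (fK (total N) j)" "lead (- unit_vec (2, 0) j) (fK' (total N) j)"
proof -
  have D: "lead 0 (fK (partL N) j)" "lead 0 (fK' (partL N) j)" "lead 0 (fK (partR N) j)" "lead 0 (fK' (partR N) j)"
    using diagonal_K_combine[OF diagonal_K_left_chain diagonal_K_E_copies] diagonal_K_combine[OF diagonal_K_F_copies diagonal_K_right_chain]
    unfolding diagonal_K_def by (blast intro: diagonal_lead)+
  have S: "lead (unit_vec (2, 0) j) (fK kshift j)" "lead (- unit_vec (2, 0) j) (fK' kshift j)"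
    by (simp_all add: kshift_def lead_shift_op)
  show "lead (unit_vec (2, 0) j) (fK (total N) j)"
    using lead_mult[OF lead_mult[OF D(1) S(1)] D(3)] by (simp add: total_def)
  show "lead (- unit_vec (2, 0) j) (fK' (total N) j)"
    using lead_mult[OF lead_mult[OF D(2) S(2)] D(4)] by (simp add: total_def)
qed

section \<open>Top terms in the lexicographic order of both components\<close>

lemma lead_power: "lead s T \<Longrightarrow> lead (\<Sum>j<k. s) (T ^ k)"
proof (induction k)
  case (Suc k)
  then show ?case using lead_mult[of s T "\<Sum>j<k. s" "T ^ k"] by (simp add: add.commute)
qed (simp add: lead_1)

lemma lead_prod_list:
  "(\<And>r. r \<in> set L \<Longrightarrow> lead (s r) (T r)) \<Longrightarrow> distinct L \<Longrightarrow> lead (\<Sum>r\<in>set L. s r) (prod_list (map T L))"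
  by (induction L) (auto simp: lead_1 intro: lead_mult)

text \<open>\<open>lead\<close> compares first components only.  The second components separate the monomials that differ
  only in the torus part.\<close>

definition top_term :: "idx \<Rightarrow> (idx, 'k) cmat \<Rightarrow> bool" where
  "top_term s T \<longleftrightarrow> (\<forall>b. Poly_Mapping.lookup (col T b) (b + s) \<noteq> 0 \<and>
     (\<forall>k\<in>Poly_Mapping.keys (col T b). k \<le> b + s))"

lemma top_termD:
  assumes "top_term s T"
  shows "Poly_Mapping.lookup (col T b) (b + s) \<noteq> 0"
    and "k \<in> Poly_Mapping.keys (col T b) \<Longrightarrow> k \<le> b + s"
  using assms unfolding top_term_def by blast+

lemma idx_add_less: "(s :: idx) < t \<Longrightarrow> b + s < b + t"
  unfolding less_prod_def' by auto

lemma lead_top_term: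
  assumes "lead s T"
  shows "top_term s T"
  unfolding top_term_def
proof (intro allI conjI ballI)
  fix b
  obtain c where c: "\<And>b. c b \<noteq> 0" "below (fst s) (T - shift_op s c)"
    using assms by (auto simp: lead_def)
  define D where "D = col (T - shift_op s c) b"
  have T: "col T b = D + Poly_Mapping.single (b + s) (c b)" by (simp add: D_def)
  have D: "fst k < fst (b + s)" if "k \<in> Poly_Mapping.keys D" for k
    using c(2) that unfolding below_def D_def fst_add by blast
  have "b + s \<notin> Poly_Mapping.keys D" using D by blast
  then show "Poly_Mapping.lookup (col T b) (b + s) \<noteq> 0"
    using c(1) by (simp add: T lookup_add in_keys_iff)
  fix k assume "k \<in> Poly_Mapping.keys (col T b)"
  then have "k \<in> Poly_Mapping.keys D \<or> k = b + s"
    unfolding T using Poly_Mapping.keys_add[of D "Poly_Mapping.single (b + s) (c b)"]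
    by (auto split: if_splits)
  then show "k \<le> b + s" using D[of k] by (auto simp: less_prod_def' le_less)
qed

text \<open>At the sum of the exponents the product receives a single contribution, since a lower
  intermediate index stays strictly below under \<open>S\<close>.\<close>

lemma top_term_mult_nz:
  assumes S: "top_term s S" and T: "top_term t T"
  shows "S * T \<noteq> 0"
proof
  assume z: "S * T = 0"
  let ?b = "0 :: idx"
  have "Poly_Mapping.lookup (col (S * T) ?b) (t + s)
    = (\<Sum>k\<in>Poly_Mapping.keys (col T ?b). Poly_Mapping.lookup (col T ?b) k * Poly_Mapping.lookup (col S k) (t + s))"
    by (simp add: vscale.lext_def lookup_sum)
  also have "\<dots> = (\<Sum>k\<in>{t}. Poly_Mapping.lookup (col T ?b) k * Poly_Mapping.lookup (col S k) (t + s))"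
  proof (rule sum.mono_neutral_right)
    show "{t} \<subseteq> Poly_Mapping.keys (col T ?b)"
      using top_termD(1)[OF T, of ?b] by (simp add: in_keys_iff)
    show "\<forall>k\<in>Poly_Mapping.keys (col T ?b) - {t}.
      Poly_Mapping.lookup (col T ?b) k * Poly_Mapping.lookup (col S k) (t + s) = 0"
    proof
      fix k assume k: "k \<in> Poly_Mapping.keys (col T ?b) - {t}"
      then have "k \<le> ?b + t" using T unfolding top_term_def by blast
      then have "k < t" using k by (simp add: order.strict_iff_order)
      then have "k + s < t + s" using idx_add_less[of k t s] by (simp add: add.commute)
      then have "t + s \<notin> Poly_Mapping.keys (col S k)"
        using S unfolding top_term_def by (meson leD)
      then show "Poly_Mapping.lookup (col T ?b) k * Poly_Mapping.lookup (col S k) (t + s) = 0"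
        by (simp add: in_keys_iff)
    qed
  qed simp
  also have "\<dots> = Poly_Mapping.lookup (col T ?b) (?b + t) * Poly_Mapping.lookup (col S t) (t + s)"
    by simp
  also have "\<dots> \<noteq> 0"
    using top_termD(1)[OF S, of t] top_termD(1)[OF T, of ?b] by simp
  finally show False by (simp add: z)
qed

text \<open>The largest of finitely many distinct exponents belongs to one summand only, so its
  coefficient cannot cancel.\<close>

lemma top_term_sum:
  assumes fin: "finite A" "A \<noteq> {}" and inj: "inj_on s A"
    and lead: "\<And>i. i \<in> A \<Longrightarrow> top_term (s i) (T i)" and c: "\<And>i. i \<in> A \<Longrightarrow> c i \<noteq> 0"
  shows "\<exists>i\<in>A. top_term (s i) (\<Sum>i\<in>A. mscale (c i) (T i))"
proof -
  define M where "M = Max (s ` A)"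
  have "M \<in> s ` A" unfolding M_def using fin by (intro Max_in) auto
  then obtain i0 where i0: "i0 \<in> A" "s i0 = M" by auto
  have less: "s i < s i0" if "i \<in> A" "i \<noteq> i0" for i
  proof -
    have "s i \<le> M" unfolding M_def using fin that by (intro Max_ge) auto
    moreover have "s i \<noteq> s i0" using inj that i0(1) by (auto simp: inj_on_def)
    ultimately show ?thesis using i0(2) by simp
  qed
  let ?S = "\<Sum>i\<in>A. mscale (c i) (T i)"
  have lk: "Poly_Mapping.lookup (col ?S b) k = (\<Sum>i\<in>A. c i * Poly_Mapping.lookup (col (T i) b) k)" for b k
    by (induction A rule: infinite_finite_induct) (simp_all add: lookup_add)
  have "top_term (s i0) ?S"
    unfolding top_term_def
  proof (intro allI conjI ballI)
    fix b
    have "Poly_Mapping.lookup (col (T i) b) (b + s i0) = 0" if "i \<in> A" "i \<noteq> i0" for i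
    proof -
      have "b + s i0 \<notin> Poly_Mapping.keys (col (T i) b)"
        using lead[OF that(1)] idx_add_less[OF less[OF that], of b] unfolding top_term_def
        by (meson leD)
      then show ?thesis by (simp add: in_keys_iff)
    qed
    then have "Poly_Mapping.lookup (col ?S b) (b + s i0)
      = (\<Sum>i\<in>{i0}. c i * Poly_Mapping.lookup (col (T i) b) (b + s i0))"
      unfolding lk using fin i0(1) by (intro sum.mono_neutral_right) auto
    then show "Poly_Mapping.lookup (col ?S b) (b + s i0) \<noteq> 0"
      using top_termD(1)[OF lead[OF i0(1)], of b] c[OF i0(1)] by simp
    fix k assume "k \<in> Poly_Mapping.keys (col ?S b)"
    then have "(\<Sum>i\<in>A. c i * Poly_Mapping.lookup (col (T i) b) k) \<noteq> 0"
      by (simp add: in_keys_iff lk)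
    then obtain i where i: "i \<in> A" "Poly_Mapping.lookup (col (T i) b) k \<noteq> 0"
      by (metis (no_types, lifting) mult_zero_right sum.neutral)
    then have "k \<le> b + s i" using top_termD(2)[OF lead[OF i(1)]] by (simp add: in_keys_iff)
    also have "b + s i \<le> b + s i0" using less[OF i(1)] idx_add_less by (cases "i = i0") (auto simp: less_imp_le)
    finally show "k \<le> b + s i0" .
  qed
  then show ?thesis using i0(1) by blast
qed

end

section \<open>The quantum algebra\<close>

lemma poly_mapping_sum_single: "p = (\<Sum>k\<in>Poly_Mapping.keys p. Poly_Mapping.single k (Poly_Mapping.lookup p k))"
  for p :: "'a \<Rightarrow>\<^sub>0 'k::field"
  using lext_single_id[of p] by (simp add: vscale.lext_def)

section \<open>Evaluation homomorphisms from the free algebra\<close>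

sublocale qalg \<subseteq> linear_extension scale ..

context qalg
begin

definition ev :: "('g \<Rightarrow> 'r) \<Rightarrow> ('g list \<Rightarrow>\<^sub>0 'k) \<Rightarrow> 'r" where
  "ev g = lext (\<lambda>w. prod_list (map g w))"

lemma ev_single: "ev g (Poly_Mapping.single w c) = c *s prod_list (map g w)"
  by (simp add: ev_def)

lemma ev_add: "ev g (x + y) = ev g x + ev g y"
  and ev_diff: "ev g (x - y) = ev g x - ev g y"
  and ev_uminus: "ev g (- x) = - ev g x"
  and ev_0 [simp]: "ev g 0 = 0"
  and ev_sum: "ev g (\<Sum>i\<in>A. f i) = (\<Sum>i\<in>A. ev g (f i))"
  by (simp_all add: ev_def lext_add lext_diff lext_uminus lext_sum)

lemma ev_1 [simp]: "ev g 1 = 1"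
  unfolding single_one[symmetric] ev_single by (simp add: zero_list_def)

lemma ev_mult: "ev g (x * y) = ev g x * ev g y"
proof -
  let ?s = "\<lambda>x k. Poly_Mapping.single k (Poly_Mapping.lookup x k)"
  have "x * y = (\<Sum>k\<in>Poly_Mapping.keys x. \<Sum>l\<in>Poly_Mapping.keys y. ?s x k * ?s y l)"
    by (subst (1) poly_mapping_sum_single[of x], subst (1) poly_mapping_sum_single[of y])
      (rule sum_product)
  then have "ev g (x * y) = (\<Sum>k\<in>Poly_Mapping.keys x. \<Sum>l\<in>Poly_Mapping.keys y.
      ev g (?s x k * ?s y l))"
    by (simp only: ev_sum)
  also have "\<dots> = (\<Sum>k\<in>Poly_Mapping.keys x. \<Sum>l\<in>Poly_Mapping.keys y. ev g (?s x k) * ev g (?s y l))"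
    by (simp add: mult_single ev_single plus_list_def scale_assoc mult.commute)
  also have "\<dots> = ev g x * ev g y"
    unfolding ev_def lext_def[of _ x] lext_def[of _ y] by (simp add: sum_product)
  finally show ?thesis .
qed

lemma ev_vscale: "ev g (vscale c x) = c *s ev g x"
proof -
  have "vscale c x = Poly_Mapping.single 0 c * x"
    unfolding vscale_def by (rule mult_map_scale_conv_mult)
  then show ?thesis by (simp add: ev_mult ev_single zero_list_def scale_assoc)
qed

lemma root_vec_cong: "(\<And>j. i \<le> j \<Longrightarrow> j \<le> i + k \<Longrightarrow> x j = y j) \<Longrightarrow> root_vec x i k = root_vec y i k"
proof (induction k arbitrary: i)
  case (Suc k)
  have "root_vec x (Suc i) k = root_vec y (Suc i) k" by (rule Suc.IH) (use Suc.prems in auto)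
  then show ?case using Suc.prems[of i] by simp
qed simp

lemma ev_power: "ev g (x ^ k) = ev g x ^ k"
  by (induction k) (simp_all add: ev_mult)

lemma ev_letter: "ev g (Poly_Mapping.single [a] 1) = g a"
  by (simp add: ev_single)

end

lemma vscale_scal: "vscale c x = scal c * x"
  unfolding vscale_def scal_def zero_list_def[symmetric] by (rule mult_map_scale_conv_mult)

lemma vscale_mult_right: "x * vscale c y = vscale c (x * y :: 'f::field falg)"
proof -
  have "(\<Sum>k\<in>A. Poly_Mapping.single k (f k)) * scal c = scal c * (\<Sum>k\<in>A. Poly_Mapping.single k (f k))"
    for A and f :: "gen list \<Rightarrow> 'f ratfun"
    by (simp add: scal_def mult_single sum_distrib_left sum_distrib_right plus_list_def mult.commute)
  from this[of "Poly_Mapping.lookup x" "Poly_Mapping.keys x"] have "x * scal c = scal c * x"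
    unfolding poly_mapping_sum_single[of x, symmetric] .
  then show ?thesis by (simp add: vscale_scal flip: mult.assoc)
qed

lemma qvar_conditions:
  "(qvar :: 'f::field_char_0 ratfun) \<noteq> 0" "(qvar :: 'f ratfun) * qvar \<noteq> 1" "1 + (qvar :: 'f ratfun) * qvar \<noteq> 0"
  by (simp_all add: qvar_def Zero_fract_def One_fract_def eq_fract one_pCons)

lemma prod_list_zero: "0 \<in> set xs \<Longrightarrow> prod_list xs = (0 :: 'r::semiring_1)"
  by (induction xs) auto

section \<open>The presented algebra as an instance of the straightening theory\<close>

locale uq =
  fixes m n :: nat and field_type :: "'f::field_char_0 itself"
  assumes m_pos: "m \<ge> 1"
begin

sublocale A0: qalg "vscale :: 'f ratfun \<Rightarrow> 'f falg \<Rightarrow> _" qvar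
  by (unfold_locales; (rule vscale_mult_right qvar_conditions)?) (simp add: vscale_scal mult.assoc)

sublocale R: qrep "qvar :: 'f ratfun"
  by unfold_locales (rule qvar_conditions)+

abbreviation "N \<equiv> m + n"

text \<open>The type of the free algebra also contains words with inadmissible letters. This
  endomorphism kills such letters and fixes the carrier, so statements about the whole type restrict
  to the presented algebra.\<close>

definition res :: "'f falg \<Rightarrow> 'f falg" where
  "res = A0.ev (\<lambda>a. if a \<in> gens m n then letter a else 0)"

lemma prod_letters: "prod_list (map letter w) = (Poly_Mapping.single w 1 :: 'f falg)"
proof (induction w)
  case Nil
  show ?case by (simp add: single_one[symmetric] zero_list_def del: single_one)
next
  case (Cons a w)
  then show ?case by (simp add: letter_def mult_single plus_list_def)
qed

lemma res_id:
  assumes "Poly_Mapping.keys x \<subseteq> lists (gens m n)"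
  shows "res x = x"
proof -
  have "prod_list (map (\<lambda>a. if a \<in> gens m n then letter a else 0) w)
      = (Poly_Mapping.single w 1 :: 'f falg)" if "w \<in> Poly_Mapping.keys x" for w
  proof -
    have "map (\<lambda>a. if a \<in> gens m n then letter a else 0) w = (map letter w :: 'f falg list)"
      using that assms by (auto simp: lists_eq_set)
    then show ?thesis by (simp only: prod_letters)
  qed
  then have "res x = vscale.lext (\<lambda>w. Poly_Mapping.single w 1) x"
    unfolding res_def A0.ev_def vscale.lext_def by simp
  then show ?thesis by (simp add: lext_single_id)
qed

lemma res_carrier: "res x \<in> carrier (free_alg m n)"
proof -
  have w: "Poly_Mapping.keys (prod_list (map (\<lambda>a. if a \<in> gens m n then letter a else 0) w) :: 'f falg)
      \<subseteq> lists (gens m n)" for w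
  proof (induction w)
    case (Cons a w)
    have "Poly_Mapping.keys (if a \<in> gens m n then letter a else 0 :: 'f falg) \<subseteq> lists (gens m n)"
      using keys_letter_lists by auto
    from keys_mult_lists[OF this Cons] show ?case by simp
  qed (simp add: zero_list_def)
  have "v \<in> lists (gens m n)" if "v \<in> Poly_Mapping.keys (res x)" for v
  proof -
    have "v \<in> (\<Union>w\<in>Poly_Mapping.keys x. Poly_Mapping.keys (vscale (Poly_Mapping.lookup x w)
        (prod_list (map (\<lambda>a. if a \<in> gens m n then letter a else 0) w) :: 'f falg)))"
      using that keys_sum unfolding res_def A0.ev_def vscale.lext_def by (rule subsetD[rotated])
    then show ?thesis using keys_vscale w by (meson UN_E subsetD)
  qed
  then show ?thesis by auto
qed

text \<open>An ideal of the free algebra on all letters, which meets the algebra on the admissible letters in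
  \<open>Uq_ideal m n\<close>.\<close>

definition full_ideal :: "'f falg set" where
  "full_ideal = {x. res x \<in> Uq_ideal m n}"

lemma res_simps:
  "res (x + y) = res x + res y" "res (x - y) = res x - res y" "res 0 = 0"
  "res (x * y) = res x * res y" "res (vscale c x) = vscale c (res x)"
  by (simp_all add: res_def A0.ev_add A0.ev_diff A0.ev_mult A0.ev_vscale)

interpretation Uid: ideal "Uq_ideal m n" "free_alg m n :: 'f falg ring"
  by (rule ideal_Uq_ideal)

lemma Uq_ideal_closed:
  "x \<in> Uq_ideal m n \<Longrightarrow> y \<in> Uq_ideal m n \<Longrightarrow> x + y \<in> (Uq_ideal m n :: 'f falg set)"
  "x \<in> Uq_ideal m n \<Longrightarrow> y \<in> carrier (free_alg m n) \<Longrightarrow> x * y \<in> (Uq_ideal m n :: 'f falg set)"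
  "x \<in> Uq_ideal m n \<Longrightarrow> y \<in> carrier (free_alg m n) \<Longrightarrow> y * x \<in> (Uq_ideal m n :: 'f falg set)"
  "0 \<in> (Uq_ideal m n :: 'f falg set)"
  using additive_subgroup.a_closed[OF Uid.additive_subgroup_axioms, of x y]
    Uid.I_r_closed[of x y] Uid.I_l_closed[of x y]
    additive_subgroup.zero_closed[OF Uid.additive_subgroup_axioms]
  by simp_all

sublocale A: qalg_ideal "vscale :: 'f ratfun \<Rightarrow> 'f falg \<Rightarrow> _" qvar full_ideal
proof
  have "vscale c (res x) \<in> Uq_ideal m n" if "res x \<in> Uq_ideal m n" for c x
    unfolding vscale_scal by (rule Uq_ideal_closed(3)[OF that]) (simp add: keys_scal_lists)
  then show "vscale.subspace full_ideal"
    by (intro vscale.subspaceI) (auto simp: full_ideal_def res_simps Uq_ideal_closed)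
  show "y * x \<in> full_ideal" "x * y \<in> full_ideal" if "x \<in> full_ideal" for x y
    using that Uq_ideal_closed(2,3) res_carrier by (auto simp: full_ideal_def res_simps)
qed

lemma full_ideal_iff:
  assumes "x \<in> carrier (free_alg m n)"
  shows "x \<in> full_ideal \<longleftrightarrow> x \<in> Uq_ideal m n"
  using res_id assms by (simp add: full_ideal_def)

lemma rel_cong:
  assumes "Uq_rel m n x y"
  shows "A.cong x y"
proof -
  have "x - y \<in> Uq_ideal m n"
    unfolding Uq_ideal_def
  proof (rule subsetD[OF ring.genideal_self[OF ring_free_alg]])
    show "{x - y |x y. Uq_rel m n x y} \<subseteq> carrier (free_alg m n :: 'f falg ring)"
    proof
      fix z :: "'f falg" assume "z \<in> {x - y |x y. Uq_rel m n x y}"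
      then obtain x y where z: "z = x - y" and r: "Uq_rel m n x y" by blast
      show "z \<in> carrier (free_alg m n)"
        using Uq_rel_carrier[OF r] unfolding z free_alg_simps by (rule keys_diff_lists)
    qed
  qed (use assms in blast)
  moreover have "x - y \<in> carrier (free_alg m n)"
    using Uq_rel_carrier[OF assms] keys_diff_lists by simp
  ultimately show ?thesis using full_ideal_iff by (simp add: A.cong_def)
qed

text \<open>With zero generators at the node \<open>m\<close>, the relations are those of the full diagram with nodes
  \<open>1, \<dots>, m + n - 1\<close>.\<close>

definition E_gen :: "nat \<Rightarrow> 'f falg" where "E_gen i = (if i \<in> E_idx m n then EE i else 0)"
definition F_gen :: "nat \<Rightarrow> 'f falg" where "F_gen i = (if i \<in> E_idx m n then FF i else 0)"

lemma A_serre: "A0.serre x y = x ^ 2 * y - scal (qvar + inverse qvar) * (x * y * x) + y * x ^ 2"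
  by (simp add: A0.serre_def vscale_scal power2_eq_square mult.assoc)

lemma serre_zero: "A0.serre 0 y = 0" "A0.serre x 0 = 0"
  by (simp_all add: A0.serre_def)

text \<open>If a node lies outside \<open>E_idx m n\<close>, in particular node m, every term of its
  relations contains a zero; all other relations are defining ones.\<close>

lemma braided_E_gen: "A.braided E_gen"
  unfolding A.braided_def
proof (intro conjI allI impI)
  show "A.q_comm 1 (E_gen i) (E_gen j)" if "Suc i < j" for i j
    using that rel_cong[OF R5_E[of i m n j]] by (auto simp: E_gen_def A.q_comm_def)
  show "A0.serre (E_gen i) (E_gen (Suc i)) \<in> full_ideal" for i
    using rel_cong[OF R6[of i m n "Suc i"]] A.I_closed(5)
    by (auto simp: E_gen_def A_serre[of "EE i"] A.cong_def serre_zero)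
  show "A0.serre (E_gen (Suc i)) (E_gen i) \<in> full_ideal" for i
    using rel_cong[OF R6[of "Suc i" m n i]] A.I_closed(5)
    by (auto simp: E_gen_def A_serre[of "EE (Suc i)"] A.cong_def serre_zero)
qed

lemma braided_F_gen: "A.braided F_gen"
  unfolding A.braided_def
proof (intro conjI allI impI)
  show "A.q_comm 1 (F_gen i) (F_gen j)" if "Suc i < j" for i j
    using that rel_cong[OF R5_F[of i m n j]] by (auto simp: F_gen_def A.q_comm_def)
  show "A0.serre (F_gen i) (F_gen (Suc i)) \<in> full_ideal" for i
    using rel_cong[OF R7[of i m n "Suc i"]] A.I_closed(5)
    by (auto simp: F_gen_def A_serre[of "FF i"] A.cong_def serre_zero)
  show "A0.serre (F_gen (Suc i)) (F_gen i) \<in> full_ideal" for i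
    using rel_cong[OF R7[of "Suc i" m n i]] A.I_closed(5)
    by (auto simp: F_gen_def A_serre[of "FF (Suc i)"] A.cong_def serre_zero)
qed

lemma q_comm_conjugate:
  assumes "A.cong (k' * k) 1" "A.cong (k * x * k') (scal c * x)"
  shows "A.q_comm c k x"
proof -
  have "k * x = k * x * 1" by simp
  also have "A.cong \<dots> (k * x * (k' * k))"
    using assms(1) by (intro A.cong_mult) (auto intro: A.cong_sym)
  also have "\<dots> = (k * x * k') * k" by (simp add: mult.assoc)
  also have "A.cong \<dots> (scal c * x * k)"
    by (rule A.cong_mult[OF assms(2) A.cong_refl])
  finally show ?thesis by (simp add: A.q_comm_def vscale_scal mult.assoc)
qed

lemma qi_nz: "qi m i \<noteq> (0 :: 'f ratfun)"
  by (simp add: qi_def qvar_conditions)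

lemma qi_pow_nz: "qi m i powi z \<noteq> (0 :: 'f ratfun)"
  by (simp add: qi_nz)

lemma K_set: "set [1..<Suc N] = K_idx m n"
  by (auto simp: K_idx_def)

sublocale T: triangular "vscale :: 'f ratfun \<Rightarrow> 'f falg \<Rightarrow> _" qvar full_ideal E_gen F_gen KK KKinv N "[1..<Suc N]"
proof (unfold_locales, unfold K_set)
  show "A.braided E_gen" "A.braided F_gen" by (rule braided_E_gen braided_F_gen)+
  show "E_gen j = 0" "F_gen j = 0" if "N \<le> j" for j
    using that by (auto simp: E_gen_def F_gen_def E_idx_def)
  show "distinct [1..<Suc N]" by simp
  show "A.q_comm 1 (KK k) (KK l)" if "k \<in> K_idx m n" "l \<in> K_idx m n" for k l
    using rel_cong[OF R1_comm[OF that]] by (simp add: A.q_comm_def)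
  show KK': "A.cong (KK k * KKinv k) 1" and K'K: "A.cong (KKinv k * KK k) 1" if "k \<in> K_idx m n" for k
    using rel_cong R1_rinv[OF that] R1_linv[OF that] by blast+
  show "\<exists>c. c \<noteq> 0 \<and> A.q_comm c (KK k) (E_gen j)" if "k \<in> K_idx m n" for k j
  proof (cases "j \<in> E_idx m n")
    case True
    have "A.q_comm (qi m k powi (of_bool (k = j) - of_bool (k = j + 1))) (KK k) (E_gen j)"
      using q_comm_conjugate[OF K'K[OF that] rel_cong[OF R2_E[OF that True]]] True
      by (simp only: E_gen_def if_True)
    with qi_pow_nz show ?thesis by (intro exI conjI)
  next
    case False
    then have "A.q_comm 1 (KK k) (E_gen j)" by (simp add: E_gen_def A.q_comm_def)
    then show ?thesis by (intro exI[of _ 1]) simp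
  qed
  show "\<exists>c. c \<noteq> 0 \<and> A.q_comm c (KK k) (F_gen j)" if "k \<in> K_idx m n" for k j
  proof (cases "j \<in> E_idx m n")
    case True
    have "A.q_comm (qi m k powi (- (of_bool (k = j) - of_bool (k = j + 1)))) (KK k) (F_gen j)"
      using q_comm_conjugate[OF K'K[OF that] rel_cong[OF R2_F[OF that True]]] True
      by (simp only: F_gen_def if_True)
    with qi_pow_nz show ?thesis by (intro exI conjI)
  next
    case False
    then have "A.q_comm 1 (KK k) (F_gen j)" by (simp add: F_gen_def A.q_comm_def)
    then show ?thesis by (intro exI[of _ 1]) simp
  qed
  show "\<exists>c. \<exists>k\<in>K_idx m n. \<exists>l\<in>K_idx m n.
      A.cong (E_gen i * F_gen j - F_gen j * E_gen i) (vscale c (KK k * KKinv l - KKinv k * KK l))" for i j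
  proof (cases "i \<in> E_idx m n \<and> j \<in> E_idx m n")
    case True
    then have "i \<in> K_idx m n" "i + 1 \<in> K_idx m n" by (auto simp: E_idx_def K_idx_def)
    moreover have "A.cong (E_gen i * F_gen j - F_gen j * E_gen i)
        (vscale (of_bool (i = j) / (qi m i - inverse (qi m i))) (KK i * KKinv (i + 1) - KKinv i * KK (i + 1)))"
      using rel_cong[OF R3[of i m n j]] True by (simp add: E_gen_def F_gen_def vscale_scal)
    ultimately show ?thesis by blast
  next
    case False
    then have "E_gen i * F_gen j - F_gen j * E_gen i = 0" by (auto simp: E_gen_def F_gen_def)
    \<comment> \<open>The coefficient is zero here, so any torus index is a witness.\<close>
    moreover have "1 \<in> K_idx m n" using m_pos by (simp add: K_idx_def)
    moreover have "A.cong 0 (vscale 0 x)" for x by simp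
    ultimately show ?thesis by metis
  qed
qed

abbreviation "tot \<equiv> R.total N"

text \<open>Exchanging \<open>K\<^sub>i\<close> and its inverse for \<open>i > m\<close> turns \<open>q\<^sub>i = 1 / q\<close> into \<open>q\<close>.\<close>

primrec gen_image :: "gen \<Rightarrow> (idx, 'f ratfun) cmat" where
  "gen_image (GE i) = fE tot i"
| "gen_image (GF i) = fF tot i"
| "gen_image (GK i) = (if i \<le> m then fK tot i else fK' tot i)"
| "gen_image (GKinv i) = (if i \<le> m then fK' tot i else fK tot i)"

section \<open>The homomorphism into matrices\<close>

definition phi :: "'f falg \<Rightarrow> (idx, 'f ratfun) cmat" where
  "phi = R.ev gen_image"

lemma phi_simps:
  "phi (x + y) = phi x + phi y" "phi (x - y) = phi x - phi y" "phi 0 = 0" "phi 1 = 1" "phi (- x) = - phi x"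
  "phi (x * y) = phi x * phi y" "phi (vscale c x) = mscale c (phi x)" "phi (letter a) = gen_image a"
  "phi (scal c) = mscale c 1" "phi (x ^ k) = phi x ^ k"
  by (simp_all add: phi_def R.ev_add R.ev_diff R.ev_mult R.ev_vscale R.ev_letter letter_def
      R.ev_power R.ev_uminus)
    (simp add: scal_def R.ev_single)

lemmas D = R.qfamilyD[OF R.qfamily_total[of N]]

lemma conj_eq: "k * x = mscale c (x * k) \<Longrightarrow> k * k' = 1 \<Longrightarrow> k * x * k' = mscale c (x :: (idx, 'f ratfun) cmat)"
  by (simp add: R.scale_mult_left mult.assoc)

lemma R_serre: "R.serre x y = x ^ 2 * y - mscale (qvar + inverse qvar) (x * y * x) + y * x ^ 2"
  by (simp add: R.serre_def power2_eq_square mult.assoc)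

lemma phi_rel: "Uq_rel m n x y \<Longrightarrow> phi x = phi y"
proof (induction rule: Uq_rel.induct)
  case (R1_comm i j)
  then show ?case using D(1) D(11) D(12) by (simp add: phi_simps)
next
  case (R1_rinv i)
  then show ?case by (simp add: phi_simps D)
next
  case (R1_linv i)
  then show ?case by (simp add: phi_simps D)
next
  case (R2_E i j)
  show ?case
  proof (cases "i \<le> m")
    case True
    then show ?thesis using conj_eq[OF D(4) D(2)] by (simp add: phi_simps R.scale_mult_left qi_def pairing_def)
  next
    case False
    then show ?thesis using conj_eq[OF D(9) D(3)]
      by (simp add: phi_simps R.scale_mult_left qi_def pairing_def power_int_inverse flip: power_int_minus)
  qed
next
  case (R2_F i j)
  show ?case
  proof (cases "i \<le> m")
    case True
    then show ?thesis using conj_eq[OF D(5) D(2)] by (simp add: phi_simps R.scale_mult_left qi_def pairing_def)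
  next
    case False
    then show ?thesis using conj_eq[OF D(10) D(3)]
      by (simp add: phi_simps R.scale_mult_left qi_def pairing_def power_int_inverse flip: power_int_minus)
  qed
next
  case (R3 i j)
  \<comment> \<open>The bound makes \<open>kappa\<close> the structure constant at i. As i differs
    from m, the letters K_i and K_{i+1} are either both exchanged with their inverses or both
    kept.\<close>
  have i: "i < N" "i \<noteq> m" using R3 by (auto simp: E_idx_def)
  have L: "phi (EE i * FF j - FF j * EE i) = (if i = j then mscale (R.kappa N i) (R.Kalpha tot i) - mscale (R.kappa N i) (R.Kalpha_inv tot i) else 0)"
    by (simp add: phi_simps D(6))
  show ?case
  proof (cases "i = j")
    case True
    show ?thesis
    proof (cases "i < m")
      case True
      then show ?thesis unfolding L
        by (simp add: \<open>i = j\<close> phi_simps qi_def R.Kalpha_def R.Kalpha_inv_def R.kappa_def i[unfolded \<open>i = j\<close>]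
            R.scale_right_diff_distrib R.scale_mult_left divide_inverse)
    next
      case False
      then have *: "\<not> i \<le> m" using i by simp
      \<comment> \<open>Beyond m the exchange swaps \<open>Kalpha\<close> with its inverse, and q_i
        = 1 / q changes the sign of the denominator; the two signs cancel.\<close>
      have inv: "inverse (inverse qvar - inverse (inverse qvar)) = - inverse (qvar - inverse (qvar :: 'f ratfun))"
        by (metis inverse_inverse_eq inverse_minus_eq minus_diff_eq)
      show ?thesis unfolding L using *
        by (simp add: \<open>i = j\<close> phi_simps qi_def R.Kalpha_def R.Kalpha_inv_def R.kappa_def i[unfolded \<open>i = j\<close>]
            R.scale_right_diff_distrib R.scale_mult_left divide_inverse inv[simplified])
    qed
  next
    case False
    then show ?thesis unfolding L by (simp add: phi_simps R.scale_mult_left)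
  qed
next
  case (R5_E i j)
  then have "Suc i < j \<or> Suc j < i" by auto
  then show ?case using D(7) unfolding R.braided0_def phi_simps gen_image.simps by metis
next
  case (R5_F i j)
  then have "Suc i < j \<or> Suc j < i" by auto
  then show ?case using D(8) unfolding R.braided0_def phi_simps gen_image.simps by metis
next
  case (R6 i j)
  then have "j = Suc i \<or> i = Suc j" by auto
  then have "R.serre (fE tot i) (fE tot j) = 0" using D(7) unfolding R.braided0_def by blast
  then show ?case by (simp add: phi_simps R.scale_mult_left R_serre)
next
  case (R7 i j)
  then have "j = Suc i \<or> i = Suc j" by auto
  then have "R.serre (fF tot i) (fF tot j) = 0" using D(8) unfolding R.braided0_def by blast
  then show ?case by (simp add: phi_simps R.scale_mult_left R_serre)
qed

text \<open>The kernel of \<open>phi\<close> on the carrier is an ideal containing the relations,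
  hence contains the ideal that they generate.\<close>

lemma phi_ideal:
  assumes "x \<in> Uq_ideal m n"
  shows "phi x = 0"
proof -
  let ?A = "free_alg m n :: 'f falg ring"
  define J where "J = {x \<in> carrier ?A. phi x = 0}"
  have neg: "\<ominus>\<^bsub>?A\<^esub> x = - x" if "x \<in> carrier ?A" for x
    by (rule abelian_group.minus_equality[OF ring.is_abelian_group[OF ring_free_alg]])
      (use that in \<open>auto simp: keys_minus\<close>)
  have "ideal J ?A"
  proof (rule idealI[OF ring_free_alg])
    show "subgroup J (add_monoid ?A)"
    proof
      show "inv\<^bsub>add_monoid ?A\<^esub> x \<in> J" if "x \<in> J" for x
      proof -
        have "inv\<^bsub>add_monoid ?A\<^esub> x = - x" using neg that unfolding a_inv_def J_def by blast
        then show ?thesis using that by (simp add: J_def phi_simps keys_minus)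
      qed
    qed (auto simp: J_def phi_simps dest: keys_add_lists[THEN subsetD])
  qed (auto simp: J_def phi_simps dest: keys_mult_lists[THEN subsetD])
  moreover have "{x - y |x y. Uq_rel m n x y} \<subseteq> J"
  proof
    fix z :: "'f falg" assume "z \<in> {x - y |x y. Uq_rel m n x y}"
    then obtain x y where z: "z = x - y" and r: "Uq_rel m n x y" by blast
    have "z \<in> carrier ?A"
      using Uq_rel_carrier[OF r] unfolding z free_alg_simps by (rule keys_diff_lists)
    then show "z \<in> J" using phi_rel[OF r] by (simp add: J_def z phi_simps)
  qed
  ultimately have "Uq_ideal m n \<subseteq> J" unfolding Uq_ideal_def by (rule ring.genideal_minimal[OF ring_free_alg])
  then show ?thesis using assms by (auto simp: J_def)
qed

section \<open>Normalised monomials\<close>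

declare upt_Suc [simp del] One_nat_def [simp del]

text \<open>The positive roots of the even part: intervals of nodes that avoid node m. The interval
  \<open>(i, t)\<close> belongs to the matrix position (i, t + 1).\<close>

definition good_roots :: "(nat \<times> nat) set" where
  "good_roots = {(i, t). 1 \<le> i \<and> i \<le> t \<and> t < N \<and> \<not> (i \<le> m \<and> m \<le> t)}"

type_synonym exps = "(nat \<times> nat \<Rightarrow> nat) \<times> (nat \<Rightarrow> int) \<times> (nat \<times> nat \<Rightarrow> nat)"

text \<open>Exponents are zero off the admissible roots and torus indices, since otherwise different
  functions would describe the same monomial and leading exponents could not be injective.\<close>

definition good_exps :: "exps set" where
  "good_exps = {(f, \<mu>, e). (\<forall>r. r \<notin> good_roots \<longrightarrow> f r = 0 \<and> e r = 0) \<and> (\<forall>k. k \<notin> {1..N} \<longrightarrow> \<mu> k = 0)}"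

lemma root_elem_bad:
  assumes "r \<in> set (A.root_columns N)" "r \<notin> good_roots" "x 0 = 0" "x m = 0"
  shows "A.root_elem x r = 0"
proof -
  obtain i t where r: "r = (i, t)" "i \<le> t" "t < N" using assms(1) by (auto simp: A.set_root_columns)
  then have "i = 0 \<or> i \<le> m \<and> m \<le> t" using assms(2) by (auto simp: good_roots_def)
  then show ?thesis
    using assms(3,4) r A0.root_vec_eq_0[of x 0 i "t - i"] A0.root_vec_eq_0[of x m i "t - i"]
    by (auto simp: A.root_elem_def)
qed

lemma mon_restrict:
  assumes "x 0 = 0" "x m = 0"
  shows "A.mon (A.root_elem x) (A.root_columns N) e = 0 \<or>
    A.mon (A.root_elem x) (A.root_columns N) e = A.mon (A.root_elem x) (A.root_columns N) (\<lambda>r. if r \<in> good_roots then e r else 0)"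
proof (cases "\<exists>r\<in>set (A.root_columns N). r \<notin> good_roots \<and> e r \<noteq> 0")
  case True
  then obtain r where r: "r \<in> set (A.root_columns N)" "r \<notin> good_roots" "e r \<noteq> 0" by blast
  then have "A.root_elem x r ^ e r = 0" using root_elem_bad[OF r(1,2) assms] by (simp add: power_0_left)
  then have "0 \<in> set (map (\<lambda>r. A.root_elem x r ^ e r) (A.root_columns N))" using r(1) by (force simp: image_iff)
  then show ?thesis unfolding A.mon_def using prod_list_zero by blast
next
  case False
  then show ?thesis by (intro disjI2 A.mon_cong) auto
qed

text \<open>A root vector through node 0 or m contains a zero generator, so a monomial using it
  vanishes. In the others, setting exponents outside the admissible range to zero does not change
  the product.\<close>

lemma pbw_good_exps: "T.pbw t = 0 \<or> T.pbw t \<in> T.pbw ` good_exps"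
proof -
  obtain f \<mu> e where t: "t = (f, \<mu>, e)" by (cases t)
  let ?r = "\<lambda>e r. if r \<in> good_roots then e r else (0 :: nat)"
  let ?\<mu> = "\<lambda>k. if k \<in> {1..N} then \<mu> k else 0"
  have x: "E_gen 0 = 0" "E_gen m = 0" "F_gen 0 = 0" "F_gen m = 0" by (simp_all add: E_gen_def F_gen_def E_idx_def)
  have k: "T.K_mon [1..<Suc N] \<mu> = T.K_mon [1..<Suc N] ?\<mu>"
    unfolding T.K_mon_def by (intro arg_cong[of _ _ prod_list] map_cong) auto
  have "T.pbw t = 0 \<or> T.pbw t = T.pbw (?r f, ?\<mu>, ?r e)"
    using mon_restrict[of F_gen f, OF x(3,4)] mon_restrict[of E_gen e, OF x(1,2)] k
    unfolding t T.pbw_def by auto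
  moreover have "(?r f, ?\<mu>, ?r e) \<in> good_exps" by (auto simp: good_exps_def)
  ultimately show ?thesis by blast
qed

lemma letter_words:
  assumes "w \<in> lists (gens m n)"
  shows "(Poly_Mapping.single w 1 :: 'f falg) \<in> A.words (range E_gen \<union> range F_gen \<union> T.Kgens)"
proof -
  have "(letter a :: 'f falg) \<in> range E_gen \<union> range F_gen \<union> T.Kgens" if "a \<in> gens m n" for a
  proof -
    have E: "(EE i :: 'f falg) \<in> range E_gen" "(FF i :: 'f falg) \<in> range F_gen" if "i \<in> E_idx m n" for i
      using that E_gen_def[of i] F_gen_def[of i] by (metis rangeI)+
    have "(KK k :: 'f falg) \<in> T.Kgens" "(KKinv k :: 'f falg) \<in> T.Kgens" if "k \<in> K_idx m n" for k
      using that unfolding K_set by blast+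
    with E that show ?thesis unfolding gens_def by blast
  qed
  then have "set (map letter w) \<subseteq> range E_gen \<union> range F_gen \<union> T.Kgens"
    using assms by (auto simp only: set_map image_subset_iff lists_eq_set mem_Collect_eq)
  then show ?thesis unfolding A.words_def prod_letters[symmetric] by blast
qed

lemma carrier_span:
  assumes "Poly_Mapping.keys x \<subseteq> lists (gens m n)"
  shows "x \<in> A.spanI (range T.pbw)"
proof -
  have "x = (\<Sum>w\<in>Poly_Mapping.keys x. vscale (Poly_Mapping.lookup x w) (Poly_Mapping.single w 1))"
    using lext_single_id[of x] unfolding vscale.lext_def by (rule sym)
  also have "\<dots> \<in> A.spanI (range T.pbw)"
    unfolding A.spanI_def
  proof (intro vscale.span_sum vscale.span_scale)
    fix w assume "w \<in> Poly_Mapping.keys x"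
    then have "w \<in> lists (gens m n)" using assms by blast
    from T.pbw_spanning[OF letter_words[OF this]]
    show "Poly_Mapping.single w 1 \<in> vscale.span (range T.pbw \<union> full_ideal)"
      unfolding A.spanI_def .
  qed
  finally show ?thesis .
qed

text \<open>Elements with such an expansion form a subspace that contains the ideal and all
  monomials, so the spanning theorem applies.\<close>

lemma carrier_expansion:
  assumes "Poly_Mapping.keys x \<subseteq> lists (gens m n)"
  shows "\<exists>p. Poly_Mapping.keys p \<subseteq> good_exps \<and> x - vscale.lext T.pbw p \<in> full_ideal"
proof -
  define X where "X = {x. \<exists>p. Poly_Mapping.keys p \<subseteq> good_exps \<and> x - vscale.lext T.pbw p \<in> full_ideal}"
  have base: "y \<in> X" if "y \<in> full_ideal" for y
    unfolding X_def using that by (intro CollectI exI[of _ 0]) simp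
  have "vscale.subspace X"
  proof (rule vscale.subspaceI)
    show "0 \<in> X" using base A.I_closed(5) by blast
    show "y + z \<in> X" if yz: "y \<in> X" "z \<in> X" for y z
    proof -
      obtain p where p: "Poly_Mapping.keys p \<subseteq> good_exps" "y - vscale.lext T.pbw p \<in> full_ideal"
        using yz(1) unfolding X_def by blast
      obtain p' where p': "Poly_Mapping.keys p' \<subseteq> good_exps" "z - vscale.lext T.pbw p' \<in> full_ideal"
        using yz(2) unfolding X_def by blast
      have "y + z - vscale.lext T.pbw (p + p') \<in> full_ideal"
        using A.I_closed(1)[OF p(2) p'(2)] by (simp add: vscale.lext_add algebra_simps)
      moreover have "Poly_Mapping.keys (p + p') \<subseteq> good_exps"
        using p(1) p'(1) by (intro order_trans[OF Poly_Mapping.keys_add] Un_least)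
      ultimately show ?thesis unfolding X_def by (intro CollectI exI[of _ "p + p'"] conjI)
    qed
    show "vscale c y \<in> X" if y: "y \<in> X" for c y
    proof -
      obtain p where p: "Poly_Mapping.keys p \<subseteq> good_exps" "y - vscale.lext T.pbw p \<in> full_ideal"
        using y unfolding X_def by blast
      have "vscale c y - vscale.lext T.pbw (vscale c p) \<in> full_ideal"
        using A.I_closed(4)[OF p(2), of c] by (simp add: lext_vscale vscale.scale_right_diff_distrib)
      moreover have "Poly_Mapping.keys (vscale c p) \<subseteq> good_exps"
        by (rule order_trans[OF keys_vscale p(1)])
      ultimately show ?thesis unfolding X_def by (intro CollectI exI[of _ "vscale c p"] conjI)
    qed
  qed
  moreover have "range T.pbw \<union> full_ideal \<subseteq> X"
  proof -
    have "T.pbw t \<in> X" for t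
    proof (cases "T.pbw t = 0")
      case True
      then show ?thesis using base A.I_closed(5) by simp
    next
      case False
      then have "T.pbw t \<in> T.pbw ` good_exps" using pbw_good_exps[of t] by simp
      then obtain t' where t': "T.pbw t = T.pbw t'" "t' \<in> good_exps" by (rule imageE)
      have "T.pbw t - vscale.lext T.pbw (Poly_Mapping.single t' 1) \<in> full_ideal"
        by (simp only: t'(1) vscale.lext_single vscale.scale_one diff_self A.I_closed(5))
      moreover have "Poly_Mapping.keys (Poly_Mapping.single t' (1 :: 'f ratfun)) \<subseteq> good_exps"
        using t'(2) by simp
      ultimately show ?thesis
        unfolding X_def by (intro CollectI exI[of _ "Poly_Mapping.single t' 1"] conjI)
    qed
    then show ?thesis using base by blast
  qed
  ultimately have "A.spanI (range T.pbw) \<subseteq> X"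
    unfolding A.spanI_def by (rule vscale.span_minimal[rotated])
  then have "x \<in> X" using carrier_span[OF assms] by (rule subsetD)
  then show ?thesis unfolding X_def by (rule CollectD)
qed

section \<open>Leading exponents of monomials\<close>

definition root_exp :: "nat \<Rightarrow> (nat \<times> nat \<Rightarrow> nat) \<Rightarrow> coords" where
  "root_exp \<kappa> e = (\<Sum>r\<in>set (A.root_columns N). \<Sum>j<e r. R.chain_exp \<kappa> 0 (fst r) (snd r - fst r))"

text \<open>The sign reflects the exchange of K_k with its inverse for k > m in
  \<open>gen_image\<close>.\<close>

definition torus_exp :: "(nat \<Rightarrow> int) \<Rightarrow> coords" where
  "torus_exp \<mu> = (\<Sum>k\<in>set [1..<Suc N]. Poly_Mapping.single (2, k, 0) ((if k \<le> m then 1 else - 1) * \<mu> k))"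

definition leading_exp :: "exps \<Rightarrow> idx" where
  "leading_exp = (\<lambda>(f, \<mu>, e). (root_exp 1 f + root_exp 0 e, torus_exp \<mu>))"

lemma phi_root_vec: "phi (A0.root_vec x i k) = R.root_vec (\<lambda>j. phi (x j)) i k"
  by (induction k arbitrary: i) (simp_all add: phi_simps)

lemma phi_root_elem:
  assumes "(i, t) \<in> good_roots"
  shows "phi (A.root_elem E_gen (i, t)) = R.root_vec (fE tot) i (t - i)" "phi (A.root_elem F_gen (i, t)) = R.root_vec (fF tot) i (t - i)"
proof -
  have "j \<in> E_idx m n" if "i \<le> j" "j \<le> t" for j
    using that assms by (auto simp: good_roots_def E_idx_def)
  then have "phi (E_gen j) = fE tot j" "phi (F_gen j) = fF tot j" if "i \<le> j" "j \<le> i + (t - i)" for j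
    using that assms by (auto simp: E_gen_def F_gen_def phi_simps good_roots_def)
  then show "phi (A.root_elem E_gen (i, t)) = R.root_vec (fE tot) i (t - i)"
    "phi (A.root_elem F_gen (i, t)) = R.root_vec (fF tot) i (t - i)"
    unfolding A.root_elem_def prod.case phi_root_vec by (auto intro!: R.root_vec_cong)
qed

lemma phi_prod_list: "phi (prod_list xs) = prod_list (map phi xs)"
  by (induction xs) (simp_all add: phi_simps)

lemma lead_mon:
  assumes x: "\<And>i t. (i, t) \<in> good_roots \<Longrightarrow> phi (A.root_elem x (i, t)) = R.root_vec y i (t - i)"
    and y: "R.leads \<kappa> 0 N y" and e: "\<And>r. r \<notin> good_roots \<Longrightarrow> e r = 0"
  shows "R.lead (root_exp \<kappa> e, 0) (phi (A.mon (A.root_elem x) (A.root_columns N) e))"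
proof -
  have "R.lead (\<Sum>j<e r. (R.chain_exp \<kappa> 0 (fst r) (snd r - fst r), 0)) (phi (A.root_elem x r ^ e r))" for r
  proof (cases "r \<in> good_roots")
    case True
    then obtain i t where r: "r = (i, t)" "t < N" by (auto simp: good_roots_def)
    \<comment> \<open>There are N copies, enough for every interval of the diagram.\<close>
    have "t - i < N" using r(2) by simp
    then have "R.lead (R.chain_exp \<kappa> 0 i (t - i), 0) (R.root_vec y i (t - i))"
      using y unfolding R.leads_def by blast
    then show ?thesis using x True unfolding r phi_simps by (auto intro: R.lead_power)
  next
    case False
    then show ?thesis by (simp add: e phi_simps R.lead_1)
  qed
  then have "R.lead (\<Sum>r\<in>set (A.root_columns N). \<Sum>j<e r. (R.chain_exp \<kappa> 0 (fst r) (snd r - fst r), 0))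
      (prod_list (map (\<lambda>r. phi (A.root_elem x r ^ e r)) (A.root_columns N)))"
    by (intro R.lead_prod_list A.distinct_root_columns)
  moreover have "(\<Sum>r\<in>set (A.root_columns N). \<Sum>j<e r. (R.chain_exp \<kappa> 0 (fst r) (snd r - fst r), 0)) = ((root_exp \<kappa> e, 0) :: idx)"
    by (simp add: root_exp_def prod_eq_iff fst_sum snd_sum)
  ultimately show ?thesis by (simp add: A.mon_def phi_prod_list o_def)
qed

lemma sum_single: "(\<Sum>j<k. Poly_Mapping.single a c) = Poly_Mapping.single a (int k * c)"
  by (induction k) (simp_all add: algebra_simps flip: single_add)

lemma lead_K_power:
  "R.lead (0, Poly_Mapping.single (2, k, 0) ((if k \<le> m then 1 else - 1) * z)) (phi (T.K_power k z))"
proof -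
  let ?s = "if k \<le> m then 1 else - 1 :: int"
  have unit_vec: "unit_vec (2, 0) k = (0, Poly_Mapping.single (2, k, 0) 1)" by (simp add: unit_vec_def)
  have K: "R.lead (0, Poly_Mapping.single (2, k, 0) ?s) (phi (KK k))"
    "R.lead (0, Poly_Mapping.single (2, k, 0) (- ?s)) (phi (KKinv k))"
    using R.lead_total_K[where N = N and j = k] unfolding unit_vec
    by (auto simp: phi_simps single_uminus)
  have S: "(\<Sum>j<l. (0, Poly_Mapping.single (2, k, 0) c)) = (0 :: coords, Poly_Mapping.single (2, k, 0) (int l * c) :: coords)" for l c
    by (simp add: prod_eq_iff fst_sum snd_sum sum_single del: sum_constant)
  show ?thesis
    using R.lead_power[OF K(1), of "nat z"] R.lead_power[OF K(2), of "nat (- z)"]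
    unfolding S by (auto simp: T.K_power_def phi_simps mult.commute split: if_splits)
qed

lemma lead_K_mon: "R.lead (0, torus_exp \<mu>) (phi (T.K_mon [1..<Suc N] \<mu>))"
proof -
  have "R.lead (\<Sum>k\<in>set [1..<Suc N]. (0, Poly_Mapping.single (2, k, 0) ((if k \<le> m then 1 else - 1) * \<mu> k)))
    (prod_list (map (\<lambda>k. phi (T.K_power k (\<mu> k))) [1..<Suc N]))"
    by (intro R.lead_prod_list lead_K_power) simp
  moreover have "(\<Sum>k\<in>set [1..<Suc N]. (0, Poly_Mapping.single (2, k, 0) ((if k \<le> m then 1 else - 1) * \<mu> k)))
     = ((0, torus_exp \<mu>) :: idx)"
    by (simp add: torus_exp_def prod_eq_iff fst_sum snd_sum)
  ultimately show ?thesis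
    by (simp only: T.K_mon_def phi_prod_list map_map o_def)
qed

lemma lead_pbw:
  assumes "t \<in> good_exps"
  shows "R.lead (leading_exp t) (phi (T.pbw t))"
proof -
  obtain f \<mu> e where t: "t = (f, \<mu>, e)" by (cases t)
  have "R.lead (root_exp 1 f, 0) (phi (A.mon (A.root_elem F_gen) (A.root_columns N) f))"
    by (rule lead_mon[OF phi_root_elem(2) R.leads_total_F]) (use assms in \<open>auto simp: t good_exps_def\<close>)
  moreover have "R.lead (root_exp 0 e, 0) (phi (A.mon (A.root_elem E_gen) (A.root_columns N) e))"
    by (rule lead_mon[OF phi_root_elem(1) R.leads_total_E]) (use assms in \<open>auto simp: t good_exps_def\<close>)
  ultimately show ?thesis
    using R.lead_mult[OF R.lead_mult[OF _ lead_K_mon]] unfolding t T.pbw_def leading_exp_def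
    by (fastforce simp: phi_simps simp del: upt_Suc)
qed

text \<open>A chain meets node p in the copy with label p - i exactly if it starts at i and reaches
  p. This coordinate therefore counts the intervals from i that reach p.\<close>

lemma lookup_root_exp:
  assumes "i \<le> p"
  shows "Poly_Mapping.lookup (root_exp \<kappa> e) (\<kappa>', p, p - i) = of_bool (\<kappa> = \<kappa>') * (\<Sum>t\<in>{p..<N}. int (e (i, t)))"
proof -
  have "Poly_Mapping.lookup (root_exp \<kappa> e) (\<kappa>', p, p - i)
    = (\<Sum>r\<in>set (A.root_columns N). int (e r) * of_bool (\<kappa>' = \<kappa> \<and> fst r = i \<and> p \<le> snd r))"
    unfolding root_exp_def lookup_sum
  proof (rule sum.cong[OF refl])
    fix r assume "r \<in> set (A.root_columns N)"
    then have "fst r \<le> snd r" by (auto simp: A.set_root_columns)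
    then show "(\<Sum>j<e r. Poly_Mapping.lookup (R.chain_exp \<kappa> 0 (fst r) (snd r - fst r)) (\<kappa>', p, p - i))
        = int (e r) * of_bool (\<kappa>' = \<kappa> \<and> fst r = i \<and> p \<le> snd r)"
      using assms by (auto simp: R.lookup_chain_exp)
  qed
  also have "\<dots> = (\<Sum>r\<in>Pair i ` {p..<N}. int (e r) * of_bool (\<kappa>' = \<kappa> \<and> fst r = i \<and> p \<le> snd r))"
    using assms by (intro sum.mono_neutral_right finite_set) (auto simp: A.set_root_columns image_iff)
  also have "\<dots> = of_bool (\<kappa> = \<kappa>') * (\<Sum>t\<in>{p..<N}. int (e (i, t)))"
    by (subst sum.reindex) (auto simp: inj_on_def)
  finally show ?thesis .
qed

text \<open>Tails of the sum that start at consecutive p differ by a single exponent.\<close>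

lemma root_exp_inj:
  assumes "\<And>i p. i \<le> p \<Longrightarrow> (\<Sum>t\<in>{p..<N}. int (e (i, t))) = (\<Sum>t\<in>{p..<N}. int (e' (i, t)))"
    and "\<And>r. r \<notin> good_roots \<Longrightarrow> e r = 0" "\<And>r. r \<notin> good_roots \<Longrightarrow> e' r = 0"
  shows "e = e'"
proof
  fix r
  show "e r = e' r"
  proof (cases "r \<in> good_roots")
    case True
    then obtain i t where r: "r = (i, t)" "i \<le> t" "t < N" by (auto simp: good_roots_def)
    have "(\<Sum>t\<in>{t..<N}. int (e (i, t))) = int (e (i, t)) + (\<Sum>t\<in>{Suc t..<N}. int (e (i, t)))" for e
      using r(3) by (simp add: sum.atLeast_Suc_lessThan)
    from this[of e] this[of e'] assms(1)[of i t] assms(1)[of i "Suc t"] r(2) have "e (i, t) = e' (i, t)" by simp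
    then show ?thesis by (simp add: r)
  qed (use assms(2,3) in auto)
qed

text \<open>Kinds 0 and 1 keep the E and F exponents in disjoint coordinates of the first component;
  the torus exponents are read off from the second.\<close>

lemma leading_exp_inj: "inj_on leading_exp good_exps"
proof (rule inj_onI)
  fix t t' assume T: "t \<in> good_exps" "t' \<in> good_exps" and eq: "leading_exp t = leading_exp t'"
  obtain f \<mu> e where t: "t = (f, \<mu>, e)" by (cases t)
  obtain f' \<mu>' e' where t': "t' = (f', \<mu>', e')" by (cases t')
  have E: "root_exp 1 f + root_exp 0 e = root_exp 1 f' + root_exp 0 e'" and K: "torus_exp \<mu> = torus_exp \<mu>'"
    using eq by (simp_all add: leading_exp_def t t')
  have L: "Poly_Mapping.lookup (root_exp 1 f) (\<kappa>, p, p - i) + Poly_Mapping.lookup (root_exp 0 e) (\<kappa>, p, p - i)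
    = Poly_Mapping.lookup (root_exp 1 f') (\<kappa>, p, p - i) + Poly_Mapping.lookup (root_exp 0 e') (\<kappa>, p, p - i)" for \<kappa> p i
    using E by (metis lookup_add)
  have G: "f r = 0" "f' r = 0" "e r = 0" "e' r = 0" if "r \<notin> good_roots" for r
    using T that unfolding good_exps_def t t' mem_Collect_eq prod.case by blast+
  have "f = f'"
  proof (rule root_exp_inj)
    show "(\<Sum>t\<in>{p..<N}. int (f (i, t))) = (\<Sum>t\<in>{p..<N}. int (f' (i, t)))" if "i \<le> p" for i p
      using L[of 1 p i] that by (simp add: lookup_root_exp)
  qed (rule G; assumption)+
  moreover have "e = e'"
  proof (rule root_exp_inj)
    show "(\<Sum>t\<in>{p..<N}. int (e (i, t))) = (\<Sum>t\<in>{p..<N}. int (e' (i, t)))" if "i \<le> p" for i p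
      using L[of 0 p i] that by (simp add: lookup_root_exp)
  qed (rule G; assumption)+
  moreover have "\<mu> = \<mu>'"
  proof
    fix k
    have lk: "Poly_Mapping.lookup (torus_exp \<mu>) (2, k, 0) = (if k \<in> {1..N} then (if k \<le> m then 1 else - 1) * \<mu> k else 0)" for \<mu>
    proof -
      have "Poly_Mapping.lookup (torus_exp \<mu>) (2, k, 0)
          = (\<Sum>j\<in>{1..N}. if j = k then (if k \<le> m then 1 else - 1) * \<mu> k else 0)"
        unfolding torus_exp_def lookup_sum by (rule sum.cong) (auto simp: lookup_single when_def)
      then show ?thesis by simp
    qed
    show "\<mu> k = \<mu>' k"
      using arg_cong[OF K, of "\<lambda>p. Poly_Mapping.lookup p (2, k, 0)"] T unfolding lk
      by (auto simp: t t' good_exps_def split: if_splits)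
  qed
  ultimately show "t = t'" by (simp add: t t')
qed

section \<open>Nonzero elements have top terms\<close>

lemma res_root_vec: "(\<And>j. res (x j) = x j) \<Longrightarrow> res (A0.root_vec x i k) = A0.root_vec x i k"
  by (induction k arbitrary: i) (simp_all add: res_simps)

lemma res_1: "res 1 = 1"
  by (simp add: res_def)

lemma res_power: "res x = x \<Longrightarrow> res (x ^ k) = x ^ k"
  by (induction k) (simp_all add: res_simps res_1)

lemma res_prod_list: "(\<And>x. x \<in> set xs \<Longrightarrow> res x = x) \<Longrightarrow> res (prod_list xs) = prod_list xs"
  by (induction xs) (simp_all add: res_simps res_1)

lemma res_letter: "a \<in> gens m n \<Longrightarrow> res (letter a) = letter a"
  by (intro res_id keys_letter_lists)

text \<open>Serves to return from \<open>full_ideal\<close>, which contains inadmissible letters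
  that \<open>phi\<close> need not kill, to \<open>Uq_ideal\<close>, where \<open>phi\<close>
  vanishes.\<close>

lemma res_pbw: "res (T.pbw t) = T.pbw t"
proof -
  obtain f \<mu> e where t: "t = (f, \<mu>, e)" by (cases t)
  have "res (E_gen i) = E_gen i" "res (F_gen i) = F_gen i" for i
    by (simp_all add: E_gen_def F_gen_def res_simps res_letter gens_def)
  then have "res (A.mon (A.root_elem E_gen) L e) = A.mon (A.root_elem E_gen) L e" "res (A.mon (A.root_elem F_gen) L e) = A.mon (A.root_elem F_gen) L e" for L e
    unfolding A.mon_def A.root_elem_def by (auto intro!: res_prod_list res_power res_root_vec split: prod.split)
  moreover have "res (T.K_mon [1..<Suc N] \<mu>) = T.K_mon [1..<Suc N] \<mu>"
    unfolding T.K_mon_def T.K_power_def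
    by (rule res_prod_list) (auto intro!: res_power res_letter simp: gens_def K_idx_def)
  ultimately show ?thesis by (simp add: t T.pbw_def res_simps)
qed

text \<open>Different normalised monomials have different leading exponents, so the largest one in
  an expansion of \<open>x\<close> survives under \<open>phi\<close>. The expansion is nonzero
  because \<open>x\<close> lies outside the ideal.\<close>

lemma phi_top:
  assumes "x \<in> carrier (free_alg m n)" "x \<notin> Uq_ideal m n"
  shows "\<exists>s. R.top_term s (phi x)"
proof -
  have "Poly_Mapping.keys x \<subseteq> lists (gens m n)" using assms(1) by simp
  then obtain p where p: "Poly_Mapping.keys p \<subseteq> good_exps" "x - vscale.lext T.pbw p \<in> full_ideal"
    using carrier_expansion by (elim carrier_expansion[THEN exE] conjE)
  have "p \<noteq> 0"
    using p(2) assms full_ideal_iff by auto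
  have rl: "res (vscale.lext T.pbw p) = vscale.lext T.pbw p"
  proof -
    have "res (\<Sum>t\<in>B. vscale (Poly_Mapping.lookup p t) (T.pbw t)) = (\<Sum>t\<in>B. vscale (Poly_Mapping.lookup p t) (T.pbw t))" for B
      by (induction B rule: infinite_finite_induct) (simp_all add: res_simps res_pbw)
    then show ?thesis by (simp add: vscale.lext_def)
  qed
  have "res x = x" using assms(1) by (intro res_id) simp
  then have "x - vscale.lext T.pbw p \<in> Uq_ideal m n"
    using p(2) rl by (simp add: full_ideal_def res_simps)
  then have "phi x = phi (vscale.lext T.pbw p)"
    using phi_ideal phi_simps(2) by fastforce
  also have "\<dots> = (\<Sum>t\<in>Poly_Mapping.keys p. mscale (Poly_Mapping.lookup p t) (phi (T.pbw t)))"
    unfolding vscale.lext_def phi_def R.ev_sum R.ev_vscale ..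
  finally have e: "phi x = (\<Sum>t\<in>Poly_Mapping.keys p. mscale (Poly_Mapping.lookup p t) (phi (T.pbw t)))" .
  have "\<exists>t\<in>Poly_Mapping.keys p. R.top_term (leading_exp t)
      (\<Sum>t\<in>Poly_Mapping.keys p. mscale (Poly_Mapping.lookup p t) (phi (T.pbw t)))"
  proof (rule R.top_term_sum)
    show "inj_on leading_exp (Poly_Mapping.keys p)" using leading_exp_inj p(1) by (rule inj_on_subset)
    show "R.top_term (leading_exp t) (phi (T.pbw t))" if "t \<in> Poly_Mapping.keys p" for t
      using that p(1) lead_pbw R.lead_top_term by blast
  qed (use \<open>p \<noteq> 0\<close> in \<open>auto simp: in_keys_iff\<close>)
  then show ?thesis unfolding e by blast
qed

theorem ideal_prime:
  fixes x y :: "'f falg"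
  assumes "x \<in> carrier (free_alg m n)" "y \<in> carrier (free_alg m n)" "x * y \<in> Uq_ideal m n"
  shows "x \<in> Uq_ideal m n \<or> y \<in> Uq_ideal m n"
proof (rule ccontr)
  assume "\<not> ?thesis"
  then obtain s t where "R.top_term s (phi x)" "R.top_term t (phi y)"
    using phi_top assms(1,2) by blast
  then have "phi (x * y) \<noteq> 0" unfolding phi_simps by (rule R.top_term_mult_nz)
  then show False using phi_ideal[OF assms(3)] by simp
qed

end

theorem corollary3p2:
  fixes m n :: nat and a b :: "'f::field_char_0 falg set"
  assumes "m \<ge> 1" and "n \<ge> 1"
    and "a \<in> carrier (Uq_even m n)" and "b \<in> carrier (Uq_even m n)"
    and "a \<otimes>\<^bsub>Uq_even m n\<^esub> b = \<zero>\<^bsub>Uq_even m n\<^esub>"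
  shows "a = \<zero>\<^bsub>Uq_even m n\<^esub> \<or> b = \<zero>\<^bsub>Uq_even m n\<^esub>"
proof -
  let ?R = "free_alg m n :: 'f falg ring" and ?I = "Uq_ideal m n :: 'f falg set"
  interpret uq m n "TYPE('f)" by standard (rule assms(1))
  interpret I: ideal ?I ?R by (rule ideal_Uq_ideal)
  have sub: "abelian_subgroup ?I ?R"
    by (rule abelian_subgroupI3) (rule I.additive_subgroup_axioms I.is_abelian_group)+
  obtain x where x: "x \<in> carrier ?R" "a = ?I +>\<^bsub>?R\<^esub> x"
    using assms(3) unfolding Uq_even_def FactRing_def A_RCOSETS_def' by auto
  obtain y where y: "y \<in> carrier ?R" "b = ?I +>\<^bsub>?R\<^esub> y"
    using assms(4) unfolding Uq_even_def FactRing_def A_RCOSETS_def' by auto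
  have zero: "\<zero>\<^bsub>Uq_even m n\<^esub> = ?I" by (simp add: Uq_even_def FactRing_def)
  have "a \<otimes>\<^bsub>Uq_even m n\<^esub> b = ?I +>\<^bsub>?R\<^esub> (x \<otimes>\<^bsub>?R\<^esub> y)"
    unfolding x(2) y(2) using I.rcoset_mult_add[OF x(1) y(1)] by (simp add: Uq_even_def FactRing_def)
  then have "?I +>\<^bsub>?R\<^esub> (x \<otimes>\<^bsub>?R\<^esub> y) = ?I" using assms(5) zero by simp
  then have "x * y \<in> ?I"
    using abelian_subgroup.a_rcos_self[OF sub, of "x \<otimes>\<^bsub>?R\<^esub> y"] I.m_closed[OF x(1) y(1)] by simp
  then have "x \<in> ?I \<or> y \<in> ?I" using ideal_prime x(1) y(1) by blast
  then show ?thesis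
    using abelian_subgroup.a_rcos_const[OF sub] unfolding zero x(2) y(2) by blast
qed

end
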